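(* Let $\mathcal{A}$ be a von Neumann algebra. Then the following are equivalent: (i) the Banach algebra $\mathcal{A}\otimes_\gamma\mathcal{A}$ is Arens regular; (ii) $\mathcal{A}$ is finite-dimensional.
   Context: $\mathcal{A}\otimes_\gamma\mathcal{A}$ is the projective Banach space tensor product (completion of $\mathcal{A}\otimes\mathcal{A}$ in $\|u\|_\gamma=\inf\{\sum_k\|x_k\|\|y_k\|:u=\sum_kx_k\otimes y_k\}$), a Banach algebra with product determined by $(a\otimes b)(c\otimes d)=ac\otimes bd$. For a Banach algebra $\mathcal{C}$, the left Arens product on $\mathcal{C}^{**}$ is $\langle X\Box Y,f\rangle=\langle X,Y\Box f\rangle$, $\langle Y\Box f,a\rangle=\langle Y,f\Box a\rangle$, $\langle f\Box a,b\rangle=\langle f,ab\rangle$ for $X,Y\in\mathcal{C}^{**}$, $f\in\mathcal{C}^*$, $a,b\in\mathcal{C}$. $\mathcal{C}$ is Arens regular if for every $X\in\mathcal{C}^{**}$ the map $Y\mapsto X\Box Y$ is $w^*$-$w^*$-continuous on $\mathcal{C}^{**}$ (equivalently, the left and right Arens products coincide). *)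

theory Defs
  imports "HOL-Analysis.Analysis" "HOL-Library.Multiset"
begin

section \<open>Von Neumann algebras\<close>

text \<open>Complex Hilbert spaces; the inner product is conjugate-linear in its first argument.\<close>

class chilbert_space = banach +
  fixes scaleC :: "complex \<Rightarrow> 'a \<Rightarrow> 'a" (infixr "*\<^sub>C" 75)
    and cinner :: "'a \<Rightarrow> 'a \<Rightarrow> complex"
  assumes scaleC_add_right: "c *\<^sub>C (x + y) = c *\<^sub>C x + c *\<^sub>C y"
    and scaleC_add_left: "(c + d) *\<^sub>C x = c *\<^sub>C x + d *\<^sub>C x"
    and scaleC_scaleC: "c *\<^sub>C d *\<^sub>C x = (c * d) *\<^sub>C x"
    and scaleC_of_real: "complex_of_real r *\<^sub>C x = r *\<^sub>R x"
    and cinner_commute: "cinner x y = cnj (cinner y x)"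
    and cinner_add_right: "cinner x (y + z) = cinner x y + cinner x z"
    and cinner_scaleC_right: "cinner x (c *\<^sub>C y) = c * cinner x y"
    and cinner_self: "cinner x x = complex_of_real ((norm x)\<^sup>2)"

definition bounded_clinear :: "('h::chilbert_space \<Rightarrow> 'h) \<Rightarrow> bool" where
  "bounded_clinear T \<longleftrightarrow> bounded_linear T \<and> (\<forall>c x. T (c *\<^sub>C x) = c *\<^sub>C T x)"

definition commutant :: "('h::chilbert_space \<Rightarrow> 'h) set \<Rightarrow> ('h \<Rightarrow> 'h) set" where
  "commutant M = {T. bounded_clinear T \<and> (\<forall>S\<in>M. T \<circ> S = S \<circ> T)}"

text \<open>A \<open>*\<close>-subalgebra of the bounded operators that equals its bicommutant (so it contains the
  identity). The operator \<open>S\<close> below is the unique adjoint of \<open>T\<close>.\<close>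

definition von_neumann_algebra :: "('h::chilbert_space \<Rightarrow> 'h) set \<Rightarrow> bool" where
  "von_neumann_algebra M \<longleftrightarrow>
     (\<forall>T\<in>M. bounded_clinear T) \<and>
     (\<forall>S\<in>M. \<forall>T\<in>M. (\<lambda>x. S x + T x) \<in> M) \<and>
     (\<forall>c. \<forall>T\<in>M. (\<lambda>x. c *\<^sub>C T x) \<in> M) \<and>
     (\<forall>S\<in>M. \<forall>T\<in>M. S \<circ> T \<in> M) \<and>
     (\<forall>T\<in>M. \<exists>S\<in>M. \<forall>x y. cinner (S x) y = cinner x (T y)) \<and>
     commutant (commutant M) = M"

definition finite_dimensional :: "('h::chilbert_space \<Rightarrow> 'h) set \<Rightarrow> bool" where
  "finite_dimensional M \<longleftrightarrow>
     (\<exists>B. finite B \<and> B \<subseteq> M \<and> (\<forall>T\<in>M. \<exists>c. T = (\<lambda>x. \<Sum>S\<in>B. c S *\<^sub>C S x)))"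


section \<open>Normed spaces and algebras with explicit carriers\<close>

text \<open>The operations are only meaningful on the carrier.\<close>

record 'a cspace =
  vcarrier :: "'a set"
  vadd :: "'a \<Rightarrow> 'a \<Rightarrow> 'a"
  vscale :: "complex \<Rightarrow> 'a \<Rightarrow> 'a"
  vnorm :: "'a \<Rightarrow> real"

record 'a calgebra = "'a cspace" +
  vmult :: "'a \<Rightarrow> 'a \<Rightarrow> 'a"

definition operator_algebra :: "('h::chilbert_space \<Rightarrow> 'h) set \<Rightarrow> ('h \<Rightarrow> 'h) calgebra" where
  "operator_algebra M =
     \<lparr>vcarrier = M,
      vadd = (\<lambda>S T x. S x + T x),
      vscale = (\<lambda>c T x. c *\<^sub>C T x),
      vnorm = onorm,
      vmult = (\<circ>)\<rparr>"


section \<open>The projective tensor product\<close>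

text \<open>The list \<open>[(x\<^sub>1, y\<^sub>1), \<dots>, (x\<^sub>n, y\<^sub>n)]\<close> stands for the formal sum
  \<open>x\<^sub>1 \<otimes> y\<^sub>1 + \<dots> + x\<^sub>n \<otimes> y\<^sub>n\<close>. The algebraic tensor product consists of the formal sums modulo
  the congruence generated by commutativity of addition and bilinearity of \<open>\<otimes>\<close>. Coefficients are
  absorbed into the first factor.\<close>

definition formal_sums :: "('a, 'r) cspace_scheme \<Rightarrow> ('b, 's) cspace_scheme \<Rightarrow> ('a \<times> 'b) list set" where
  "formal_sums E F = lists (vcarrier E \<times> vcarrier F)"

inductive_set tensor_rel ::
  "('a, 'r) cspace_scheme \<Rightarrow> ('b, 's) cspace_scheme \<Rightarrow> (('a \<times> 'b) list \<times> ('a \<times> 'b) list) set"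
  for E F where
  perm: "us \<in> formal_sums E F \<Longrightarrow> mset us = mset vs \<Longrightarrow> (us, vs) \<in> tensor_rel E F"
| sym: "(us, vs) \<in> tensor_rel E F \<Longrightarrow> (vs, us) \<in> tensor_rel E F"
| trans: "(us, vs) \<in> tensor_rel E F \<Longrightarrow> (vs, ws) \<in> tensor_rel E F \<Longrightarrow> (us, ws) \<in> tensor_rel E F"
| append: "(us, vs) \<in> tensor_rel E F \<Longrightarrow> ws \<in> formal_sums E F \<Longrightarrow>
    (us @ ws, vs @ ws) \<in> tensor_rel E F"
| add_left: "x \<in> vcarrier E \<Longrightarrow> x' \<in> vcarrier E \<Longrightarrow> y \<in> vcarrier F \<Longrightarrow>
    ([(vadd E x x', y)], [(x, y), (x', y)]) \<in> tensor_rel E F"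
| add_right: "x \<in> vcarrier E \<Longrightarrow> y \<in> vcarrier F \<Longrightarrow> y' \<in> vcarrier F \<Longrightarrow>
    ([(x, vadd F y y')], [(x, y), (x, y')]) \<in> tensor_rel E F"
| scale: "x \<in> vcarrier E \<Longrightarrow> y \<in> vcarrier F \<Longrightarrow>
    ([(vscale E c x, y)], [(x, vscale F c y)]) \<in> tensor_rel E F"
| zero: "x \<in> vcarrier E \<Longrightarrow> y \<in> vcarrier F \<Longrightarrow>
    ([(vscale E 0 x, y)], []) \<in> tensor_rel E F"

definition algebraic_tensor ::
  "('a, 'r) calgebra_scheme \<Rightarrow> ('b, 's) calgebra_scheme \<Rightarrow> ('a \<times> 'b) list set calgebra" where
  "algebraic_tensor A B =
     \<lparr>vcarrier = formal_sums A B // tensor_rel A B,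
      vadd = (\<lambda>U V. \<Union>us\<in>U. \<Union>vs\<in>V. tensor_rel A B `` {us @ vs}),
      vscale = (\<lambda>c U. \<Union>us\<in>U. tensor_rel A B `` {map (\<lambda>(x, y). (vscale A c x, y)) us}),
      vnorm = (\<lambda>U. INF us\<in>U. \<Sum>(x, y)\<leftarrow>us. vnorm A x * vnorm B y),
      vmult = (\<lambda>U V. \<Union>us\<in>U. \<Union>vs\<in>V. tensor_rel A B ``
        {map (\<lambda>((a, b), (c, d)). (vmult A a c, vmult B b d)) (List.product us vs)})\<rparr>"

text \<open>The completion, as Cauchy sequences modulo null sequences.\<close>

definition vdist :: "('a, 'r) cspace_scheme \<Rightarrow> 'a \<Rightarrow> 'a \<Rightarrow> real" where
  "vdist E x y = vnorm E (vadd E x (vscale E (-1) y))"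

definition cauchy_seqs :: "('a, 'r) cspace_scheme \<Rightarrow> (nat \<Rightarrow> 'a) set" where
  "cauchy_seqs E = {s. (\<forall>n. s n \<in> vcarrier E) \<and>
     (\<forall>e>0. \<exists>N. \<forall>m\<ge>N. \<forall>n\<ge>N. vdist E (s m) (s n) < e)}"

definition null_rel :: "('a, 'r) cspace_scheme \<Rightarrow> ((nat \<Rightarrow> 'a) \<times> (nat \<Rightarrow> 'a)) set" where
  "null_rel E = {(s, t). s \<in> cauchy_seqs E \<and> t \<in> cauchy_seqs E \<and>
     (\<lambda>n. vdist E (s n) (t n)) \<longlonglongrightarrow> 0}"

definition completion :: "('a, 'r) calgebra_scheme \<Rightarrow> (nat \<Rightarrow> 'a) set calgebra" where
  "completion A =
     \<lparr>vcarrier = cauchy_seqs A // null_rel A,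
      vadd = (\<lambda>X Y. \<Union>s\<in>X. \<Union>t\<in>Y. null_rel A `` {\<lambda>n. vadd A (s n) (t n)}),
      vscale = (\<lambda>c X. \<Union>s\<in>X. null_rel A `` {\<lambda>n. vscale A c (s n)}),
      vnorm = (\<lambda>X. the_elem ((\<lambda>s. lim (\<lambda>n. vnorm A (s n))) ` X)),
      vmult = (\<lambda>X Y. \<Union>s\<in>X. \<Union>t\<in>Y. null_rel A `` {\<lambda>n. vmult A (s n) (t n)})\<rparr>"

definition projective_tensor ::
  "('a, 'r) calgebra_scheme \<Rightarrow> ('b, 's) calgebra_scheme \<Rightarrow> (nat \<Rightarrow> ('a \<times> 'b) list set) set calgebra" where
  "projective_tensor A B = completion (algebraic_tensor A B)"


section \<open>Arens regularity\<close>

text \<open>Functionals are extensional, i.e. \<open>undefined\<close> outside the carrier, so that equality of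
  functionals is equality on the carrier.\<close>

definition dual_space :: "('a, 'r) cspace_scheme \<Rightarrow> ('a \<Rightarrow> complex) cspace" where
  "dual_space E =
     \<lparr>vcarrier = {f \<in> extensional (vcarrier E).
        (\<forall>x\<in>vcarrier E. \<forall>y\<in>vcarrier E. f (vadd E x y) = f x + f y) \<and>
        (\<forall>c. \<forall>x\<in>vcarrier E. f (vscale E c x) = c * f x) \<and>
        (\<exists>K. \<forall>x\<in>vcarrier E. cmod (f x) \<le> K * vnorm E x)},
      vadd = (\<lambda>f g. \<lambda>x\<in>vcarrier E. f x + g x),
      vscale = (\<lambda>c f. \<lambda>x\<in>vcarrier E. c * f x),
      vnorm = (\<lambda>f. SUP x\<in>{x \<in> vcarrier E. vnorm E x \<le> 1}. cmod (f x))\<rparr>"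

text \<open>The topology of pointwise convergence on the dual of \<open>E\<close>.\<close>

definition weak_star :: "('a, 'r) cspace_scheme \<Rightarrow> ('a \<Rightarrow> complex) topology" where
  "weak_star E =
     subtopology (product_topology (\<lambda>_. euclidean) (vcarrier E)) (vcarrier (dual_space E))"

abbreviation bidual :: "('a, 'r) cspace_scheme \<Rightarrow> (('a \<Rightarrow> complex) \<Rightarrow> complex) cspace" where
  "bidual E \<equiv> dual_space (dual_space E)"

text \<open>The left Arens product \<open>arens A X Y\<close> of \<open>X\<close> and \<open>Y\<close>, with the two module actions
  \<open>\<langle>f \<box> a, b\<rangle> = \<langle>f, ab\<rangle>\<close> and \<open>\<langle>Y \<box> f, a\<rangle> = \<langle>Y, f \<box> a\<rangle>\<close> it is built from.\<close>

definition arens_fa :: "('a, 'r) calgebra_scheme \<Rightarrow> ('a \<Rightarrow> complex) \<Rightarrow> 'a \<Rightarrow> 'a \<Rightarrow> complex" where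
  "arens_fa A f a = (\<lambda>b\<in>vcarrier A. f (vmult A a b))"

definition arens_Yf ::
  "('a, 'r) calgebra_scheme \<Rightarrow> (('a \<Rightarrow> complex) \<Rightarrow> complex) \<Rightarrow> ('a \<Rightarrow> complex) \<Rightarrow> 'a \<Rightarrow> complex" where
  "arens_Yf A Y f = (\<lambda>a\<in>vcarrier A. Y (arens_fa A f a))"

definition arens ::
  "('a, 'r) calgebra_scheme \<Rightarrow> (('a \<Rightarrow> complex) \<Rightarrow> complex) \<Rightarrow> (('a \<Rightarrow> complex) \<Rightarrow> complex) \<Rightarrow>
    ('a \<Rightarrow> complex) \<Rightarrow> complex" where
  "arens A X Y = (\<lambda>f\<in>vcarrier (dual_space A). X (arens_Yf A Y f))"

definition arens_regular :: "('a, 'r) calgebra_scheme \<Rightarrow> bool" where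
  "arens_regular A \<longleftrightarrow>
     (\<forall>X\<in>vcarrier (bidual A).
        continuous_map (weak_star (dual_space A)) (weak_star (dual_space A)) (arens A X))"

end

theory Submission imports Defs
begin

text \<open>If \<open>M\<close> is finite-dimensional, finitely many elementary tensors separate the points of the dual of
  \<open>M \<otimes>\<^sub>\<gamma> M\<close>, so every functional on that dual is a finite combination of evaluations and the Arens product
  is visibly continuous. Otherwise \<open>M\<close> contains a sequence of nonzero orthogonal projections \<open>q\<^sub>n\<close>, and as
  \<open>M\<close> is strongly closed it contains the Rademacher operators \<open>r\<^sub>k = \<Sum>\<^sub>n \<plusminus> q\<^sub>n\<close>, the sign being given by the
  \<open>k\<close>-th binary digit of \<open>n\<close>. The products \<open>w\<^sub>i\<^sub>j = r\<^sub>2\<^sub>i r\<^sub>2\<^sub>j\<^sub>+\<^sub>1\<close> are orthonormal with respect to suitable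
  vector states, so by Bessel's inequality there is a bounded bilinear form \<open>u\<close> on \<open>M\<close> with
  \<open>u(w\<^sub>i\<^sub>j, w\<^sub>i\<^sub>j) = 1\<close> for \<open>i < j\<close> and \<open>0\<close> otherwise. Hence the functional on \<open>M \<otimes>\<^sub>\<gamma> M\<close> induced by \<open>u\<close> has
  different iterated limits on the products of \<open>r\<^sub>2\<^sub>i \<otimes> r\<^sub>2\<^sub>i\<close> and \<open>r\<^sub>2\<^sub>j\<^sub>+\<^sub>1 \<otimes> r\<^sub>2\<^sub>j\<^sub>+\<^sub>1\<close>, and \<open>M \<otimes>\<^sub>\<gamma> M\<close> is not
  Arens regular.\<close>

section \<open>Limits along an ultrafilter and Arens regularity\<close>

text \<open>A C*-algebra by itself is Arens regular, so a failure must come from the interplay of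
  two tensor factors. Over an orthonormal family the coefficients
  \<open>cinner (w \<zeta>) (x \<zeta>)\<close> of one operator x are only square-summable, and
  their sum over all pairs i < j need not be bounded uniformly in the number of pairs. A product of
  two such coefficients is summable by the Cauchy-Schwarz inequality; this is why the test elements
  are diagonal tensors. No single vector makes all products of Rademacher operators orthonormal:
  every product acts on the range of q_n by a sign, so Bessel's inequality would force every
  component q_n \<zeta> to vanish. Hence a vector for each finite range of indices, and a limit
  along an ultrafilter. The projections q_n come from cutting projections repeatedly. If the process
  stops, then 1 is a finite sum of minimal projections, and M is finite-dimensional because a corner
  between two minimal projections has dimension at most 1. The cutting is done without the spectral
  theorem: moduli and support projections are strong limits of polynomials.\<close>

lemma ex_ultrafilter:
  assumes "F0 \<noteq> (bot :: 'a filter)"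
  obtains U where "U \<noteq> bot" "U \<le> F0" "\<And>G. G \<noteq> bot \<Longrightarrow> G \<le> U \<Longrightarrow> G = U"
proof -
  define A where "A = {F. F \<noteq> bot \<and> F \<le> F0}"
  \<comment> \<open>Zorn's lemma is applied to the reversed order: a maximal element is a finest
    proper filter, and a chain is bounded by its infimum.\<close>
  define P where "P = (\<lambda>F G :: 'a filter. G \<le> F)"
  have "\<exists>m\<in>A. \<forall>a\<in>A. P m a \<longrightarrow> a = m"
  proof (rule predicate_Zorn)
    show "partial_order_on A (relation_of P A)"
      by (rule partial_order_on_relation_ofI) (auto simp: P_def)
    fix C assume C: "C \<in> Chains (relation_of P A)"
    show "\<exists>u\<in>A. \<forall>a\<in>C. P a u"
    proof (cases "C = {}")
      case True
      then show ?thesis using assms by (auto simp: A_def)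
    next
      case False
      have sub: "C \<subseteq> A" using C by (auto simp: Chains_def relation_of_def)
      have dir: "\<exists>x\<in>C. x \<le> inf F G" if "F \<in> C" "G \<in> C" for F G
      proof -
        have "F \<le> G \<or> G \<le> F" using C that by (auto simp: Chains_def relation_of_def P_def)
        then show ?thesis using that by (auto intro: bexI[of _ F] bexI[of _ G])
      qed
      \<comment> \<open>A chain is a filter base: if \<open>False\<close> held eventually for the
        infimum, it would do so for one of the members, which are proper.\<close>
      have "Inf C \<noteq> bot"
      proof
        assume "Inf C = bot"
        then have "eventually (\<lambda>_. False) (Inf C)" by simp
        then obtain F where "F \<in> C" "eventually (\<lambda>_. False) F"
          using eventually_Inf_base[OF False dir] by metis
        then show False using sub by (auto simp: A_def trivial_limit_def[symmetric])
      qed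
      moreover have "Inf C \<le> F0" using False sub by (auto simp: A_def intro: Inf_lower2)
      ultimately show ?thesis by (auto simp: A_def P_def intro!: bexI[of _ "Inf C"] Inf_lower)
    qed
  qed
  then obtain U where "U \<in> A" "\<forall>a\<in>A. a \<le> U \<longrightarrow> a = U" by (auto simp: P_def)
  then show ?thesis using that[of U] by (auto simp: A_def)
qed

text \<open>Compactness gives a cluster point l of f along U. Adding the preimages of the
  neighbourhoods of l to U leaves a proper filter, which by maximality is U itself, so l is a
  limit.\<close>

lemma ultrafilter_tendsto_compact:
  assumes U: "U \<noteq> bot" "\<And>G. G \<noteq> bot \<Longrightarrow> G \<le> U \<Longrightarrow> G = U"
    and K: "compact K" and ev: "eventually (\<lambda>x. f x \<in> K) U"
  shows "\<exists>l. (f \<longlongrightarrow> l) U"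
proof -
  have "filtermap f U \<noteq> bot" using U(1) by (simp add: filtermap_bot_iff)
  moreover have "eventually (\<lambda>x. x \<in> K) (filtermap f U)" using ev by (simp add: eventually_filtermap)
  ultimately obtain l where l: "inf (nhds l) (filtermap f U) \<noteq> bot"
    using K compact_filter by blast
  have "inf U (filtercomap f (nhds l)) \<noteq> bot"
  proof
    assume "inf U (filtercomap f (nhds l)) = bot"
    then have "eventually (\<lambda>_. False) (inf U (filtercomap f (nhds l)))" by simp
    then obtain P Q where PQ: "eventually P U" "eventually Q (filtercomap f (nhds l))"
      "\<And>x. P x \<and> Q x \<Longrightarrow> False"
      unfolding eventually_inf by blast
    from PQ(2) obtain R where R: "eventually R (nhds l)" "\<And>x. R (f x) \<Longrightarrow> Q x"
      unfolding eventually_filtercomap by blast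
    have "eventually (\<lambda>y. \<not> R y) (filtermap f U)"
      unfolding eventually_filtermap using PQ(1) by eventually_elim (use R PQ in blast)
    then have "eventually (\<lambda>_. False) (inf (nhds l) (filtermap f U))"
      unfolding eventually_inf using R(1) by blast
    then show False using l by (simp add: trivial_limit_def[symmetric])
  qed
  then have "inf U (filtercomap f (nhds l)) = U" using U(2) by simp
  then have "U \<le> filtercomap f (nhds l)" by (metis inf.cobounded2)
  then have "(f \<longlongrightarrow> l) U" by (simp add: filterlim_iff_le_filtercomap)
  then show ?thesis by blast
qed

text \<open>Makes \<open>Lim U\<close> a choice of limits for all bounded complex sequences that
  respects sums and multiples. It agrees with ordinary limits because U refines
  \<open>sequentially\<close>.\<close>

lemma ex_bounded_limit_filter:
  obtains U :: "nat filter" where "U \<noteq> bot" "U \<le> sequentially"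
    "\<And>(f :: nat \<Rightarrow> complex) K. (\<And>n. cmod (f n) \<le> K) \<Longrightarrow> (f \<longlongrightarrow> Lim U f) U"
proof -
  obtain U :: "nat filter" where U: "U \<noteq> bot" "U \<le> sequentially"
    "\<And>G. G \<noteq> bot \<Longrightarrow> G \<le> U \<Longrightarrow> G = U"
    using ex_ultrafilter[of "sequentially :: nat filter"] by auto
  have "(f \<longlongrightarrow> Lim U f) U" if "\<And>n. cmod (f n) \<le> K" for f :: "nat \<Rightarrow> complex" and K
  proof -
    have "\<exists>l. (f \<longlongrightarrow> l) U"
      by (rule ultrafilter_tendsto_compact[OF U(1,3), of "cball 0 K"]) (use that in auto)
    then show ?thesis using tendsto_Lim[OF U(1)] by metis
  qed
  with U show ?thesis using that by blast
qed

section \<open>Normed algebras on a carrier, their duals and Arens products\<close>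

text \<open>The common interface of the operator algebra, the algebraic tensor product and
  completions. The records have no zero element, so \<open>vscale A 0 y\<close> stands for it, and
  \<open>add_zero\<close> makes all these zeros equal. The norm is a seminorm, and
  \<open>norm_scale_le\<close> is an inequality because this is what an infimum or a limit yields
  directly; equality follows from it.\<close>

locale normed_calgebra =
  fixes A :: "('a, 'r) calgebra_scheme"
  assumes carrier_ne: "vcarrier A \<noteq> {}"
    and add_closed [simp, intro]: "x \<in> vcarrier A \<Longrightarrow> y \<in> vcarrier A \<Longrightarrow> vadd A x y \<in> vcarrier A"
    and scale_closed [simp, intro]: "x \<in> vcarrier A \<Longrightarrow> vscale A c x \<in> vcarrier A"
    and mult_closed [simp, intro]: "x \<in> vcarrier A \<Longrightarrow> y \<in> vcarrier A \<Longrightarrow> vmult A x y \<in> vcarrier A"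
    and add_assoc: "x \<in> vcarrier A \<Longrightarrow> y \<in> vcarrier A \<Longrightarrow> z \<in> vcarrier A \<Longrightarrow>
      vadd A (vadd A x y) z = vadd A x (vadd A y z)"
    and add_commute: "x \<in> vcarrier A \<Longrightarrow> y \<in> vcarrier A \<Longrightarrow> vadd A x y = vadd A y x"
    and add_zero: "x \<in> vcarrier A \<Longrightarrow> y \<in> vcarrier A \<Longrightarrow> vadd A x (vscale A 0 y) = x"
    and scale_add_right: "x \<in> vcarrier A \<Longrightarrow> y \<in> vcarrier A \<Longrightarrow>
      vscale A c (vadd A x y) = vadd A (vscale A c x) (vscale A c y)"
    and scale_add_left: "x \<in> vcarrier A \<Longrightarrow> vscale A (c + d) x = vadd A (vscale A c x) (vscale A d x)"
    and scale_scale: "x \<in> vcarrier A \<Longrightarrow> vscale A c (vscale A d x) = vscale A (c * d) x"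
    and scale_one: "x \<in> vcarrier A \<Longrightarrow> vscale A 1 x = x"
    and mult_add_right: "x \<in> vcarrier A \<Longrightarrow> y \<in> vcarrier A \<Longrightarrow> z \<in> vcarrier A \<Longrightarrow>
      vmult A x (vadd A y z) = vadd A (vmult A x y) (vmult A x z)"
    and mult_add_left: "x \<in> vcarrier A \<Longrightarrow> y \<in> vcarrier A \<Longrightarrow> z \<in> vcarrier A \<Longrightarrow>
      vmult A (vadd A x y) z = vadd A (vmult A x z) (vmult A y z)"
    and mult_scale_right: "x \<in> vcarrier A \<Longrightarrow> y \<in> vcarrier A \<Longrightarrow>
      vmult A x (vscale A c y) = vscale A c (vmult A x y)"
    and mult_scale_left: "x \<in> vcarrier A \<Longrightarrow> y \<in> vcarrier A \<Longrightarrow>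
      vmult A (vscale A c x) y = vscale A c (vmult A x y)"
    and norm_nonneg [simp]: "x \<in> vcarrier A \<Longrightarrow> 0 \<le> vnorm A x"
    and norm_triangle: "x \<in> vcarrier A \<Longrightarrow> y \<in> vcarrier A \<Longrightarrow>
      vnorm A (vadd A x y) \<le> vnorm A x + vnorm A y"
    and norm_scale_le: "x \<in> vcarrier A \<Longrightarrow> vnorm A (vscale A c x) \<le> cmod c * vnorm A x"
    and norm_mult_le: "x \<in> vcarrier A \<Longrightarrow> y \<in> vcarrier A \<Longrightarrow>
      vnorm A (vmult A x y) \<le> vnorm A x * vnorm A y"

lemma dual_spaceI:
  assumes "f \<in> extensional (vcarrier E)"
    "\<And>x y. x \<in> vcarrier E \<Longrightarrow> y \<in> vcarrier E \<Longrightarrow> f (vadd E x y) = f x + f y"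
    "\<And>c x. x \<in> vcarrier E \<Longrightarrow> f (vscale E c x) = c * f x"
    "\<And>x. x \<in> vcarrier E \<Longrightarrow> cmod (f x) \<le> K * vnorm E x"
  shows "f \<in> vcarrier (dual_space E)"
  using assms unfolding dual_space_def by simp blast

lemma dual_spaceD:
  assumes "f \<in> vcarrier (dual_space E)"
  shows "f \<in> extensional (vcarrier E)"
    "\<And>x y. x \<in> vcarrier E \<Longrightarrow> y \<in> vcarrier E \<Longrightarrow> f (vadd E x y) = f x + f y"
    "\<And>c x. x \<in> vcarrier E \<Longrightarrow> f (vscale E c x) = c * f x"
    "\<exists>K. \<forall>x\<in>vcarrier E. cmod (f x) \<le> K * vnorm E x"
  using assms unfolding dual_space_def by auto

lemma dual_space_simps:
  "vadd (dual_space E) f g = (\<lambda>x\<in>vcarrier E. f x + g x)"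
  "vscale (dual_space E) c f = (\<lambda>x\<in>vcarrier E. c * f x)"
  "vnorm (dual_space E) f = (SUP x\<in>{x \<in> vcarrier E. vnorm E x \<le> 1}. cmod (f x))"
  unfolding dual_space_def by auto

context normed_calgebra
begin

lemma norm_scale: 
  assumes "x \<in> vcarrier A"
  shows "vnorm A (vscale A c x) = cmod c * vnorm A x"
proof (cases "c = 0")
  case True
  then show ?thesis using norm_scale_le[OF assms, of 0] norm_nonneg[OF scale_closed[OF assms, of 0]] by simp
next
  case False
  have "vnorm A x = vnorm A (vscale A (1/c) (vscale A c x))"
    using False assms by (simp add: scale_scale scale_one)
  also have "\<dots> \<le> cmod (1/c) * vnorm A (vscale A c x)"
    using assms by (intro norm_scale_le) auto
  finally have "cmod c * vnorm A x \<le> vnorm A (vscale A c x)"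
    using False by (simp add: norm_divide field_simps)
  then show ?thesis using norm_scale_le[OF assms, of c] by linarith
qed

lemma dual_bdd_above:
  assumes f: "f \<in> vcarrier (dual_space A)"
  shows "bdd_above ((\<lambda>x. cmod (f x)) ` {x \<in> vcarrier A. vnorm A x \<le> 1})"
proof -
  obtain K where K: "\<And>x. x \<in> vcarrier A \<Longrightarrow> cmod (f x) \<le> K * vnorm A x"
    using dual_spaceD(4)[OF f] by auto
  show ?thesis
  proof (rule bdd_aboveI2)
    fix x assume "x \<in> {x \<in> vcarrier A. vnorm A x \<le> 1}"
    then have x: "x \<in> vcarrier A" "vnorm A x \<le> 1" by auto
    have "cmod (f x) \<le> K * vnorm A x" using K x by auto
    also have "\<dots> \<le> \<bar>K\<bar> * vnorm A x" using x by (intro mult_right_mono) auto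
    also have "\<dots> \<le> \<bar>K\<bar> * 1" using x by (intro mult_left_mono) auto
    finally show "cmod (f x) \<le> \<bar>K\<bar>" by simp
  qed
qed

text \<open>By scaling to norm 1, except on the kernel of the seminorm, where boundedness forces f
  to vanish.\<close>

lemma dual_norm_bound:
  assumes f: "f \<in> vcarrier (dual_space A)" and x: "x \<in> vcarrier A"
  shows "cmod (f x) \<le> vnorm (dual_space A) f * vnorm A x"
proof -
  note bdd = dual_bdd_above[OF f]
  show ?thesis
  proof (cases "vnorm A x = 0")
    case True
    then show ?thesis using dual_spaceD(4)[OF f] x by force
  next
    case False
    then have pos: "vnorm A x > 0" using norm_nonneg[OF x] by simp
    let ?c = "complex_of_real (1 / vnorm A x)"
    have "cmod (f (vscale A ?c x)) \<le> vnorm (dual_space A) f"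
      unfolding dual_space_simps
      by (rule cSUP_upper[OF _ bdd]) (use pos x in \<open>auto simp: norm_scale norm_divide\<close>)
    also have "f (vscale A ?c x) = ?c * f x" by (rule dual_spaceD(3)[OF f x])
    finally have "cmod (f x) / vnorm A x \<le> vnorm (dual_space A) f"
      using pos by (simp add: norm_divide)
    then show ?thesis using pos by (simp add: pos_divide_le_eq)
  qed
qed

lemma dual_norm_le:
  assumes "0 \<le> K" "\<And>x. x \<in> vcarrier A \<Longrightarrow> cmod (f x) \<le> K * vnorm A x"
  shows "vnorm (dual_space A) f \<le> K"
  unfolding dual_space_simps
proof (rule cSUP_least)
  obtain x where x: "x \<in> vcarrier A" using carrier_ne by auto
  then have "vscale A 0 x \<in> {x \<in> vcarrier A. vnorm A x \<le> 1}" by (simp add: norm_scale)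
  then show "{x \<in> vcarrier A. vnorm A x \<le> 1} \<noteq> {}" by blast
next
  fix x assume "x \<in> {x \<in> vcarrier A. vnorm A x \<le> 1}"
  then have x: "x \<in> vcarrier A" "vnorm A x \<le> 1" by auto
  have "cmod (f x) \<le> K * vnorm A x" using assms x by auto
  also have "\<dots> \<le> K * 1" using x assms by (intro mult_left_mono) auto
  finally show "cmod (f x) \<le> K" by simp
qed

lemma dual_norm_nonneg:
  assumes f: "f \<in> vcarrier (dual_space A)"
  shows "0 \<le> vnorm (dual_space A) f"
proof -
  obtain x where x: "x \<in> vcarrier A" using carrier_ne by auto
  show ?thesis
  proof (cases "vnorm A x = 0")
    case False
    then have "0 < vnorm A x" using norm_nonneg[OF x] by simp
    moreover have "0 \<le> vnorm (dual_space A) f * vnorm A x"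
      using dual_norm_bound[OF f x] norm_ge_zero order_trans by blast
    ultimately show ?thesis by (simp add: zero_le_mult_iff)
  next
    case True
    have "cmod (f x) \<le> vnorm (dual_space A) f"
      unfolding dual_space_simps by (rule cSUP_upper2[OF dual_bdd_above[OF f] _ order_refl]) (use x True in auto)
    then show ?thesis using norm_ge_zero order_trans by blast
  qed
qed

text \<open>\<open>dual_space A\<close> has no multiplication and hence is not an instance of the
  locale, so an explicit constant takes the place of the norm of X. Its sign is recorded because it
  is multiplied into inequalities.\<close>

lemma bidual_bound:
  assumes "X \<in> vcarrier (bidual A)"
  obtains K where "0 \<le> K" "\<And>f. f \<in> vcarrier (dual_space A) \<Longrightarrow> cmod (X f) \<le> K * vnorm (dual_space A) f"
proof -
  obtain K where K: "\<And>f. f \<in> vcarrier (dual_space A) \<Longrightarrow> cmod (X f) \<le> K * vnorm (dual_space A) f"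
    using dual_spaceD(4)[OF assms] by auto
  have "cmod (X f) \<le> \<bar>K\<bar> * vnorm (dual_space A) f" if "f \<in> vcarrier (dual_space A)" for f
    using K[OF that] mult_right_mono[OF abs_ge_self dual_norm_nonneg[OF that], of K] by linarith
  then show ?thesis using that[of "\<bar>K\<bar>"] by auto
qed

lemma dual_add_closed:
  assumes "f \<in> vcarrier (dual_space A)" "g \<in> vcarrier (dual_space A)"
  shows "vadd (dual_space A) f g \<in> vcarrier (dual_space A)"
proof (rule dual_spaceI[where K="vnorm (dual_space A) f + vnorm (dual_space A) g"])
  fix x assume x: "x \<in> vcarrier A"
  show "cmod (vadd (dual_space A) f g x) \<le> (vnorm (dual_space A) f + vnorm (dual_space A) g) * vnorm A x"
    using norm_triangle_ineq[of "f x" "g x"] dual_norm_bound[OF assms(1) x] dual_norm_bound[OF assms(2) x] x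
    by (simp add: dual_space_simps(1) algebra_simps)
qed (use assms[THEN dual_spaceD(2)] assms[THEN dual_spaceD(3)] in \<open>auto simp: dual_space_simps algebra_simps\<close>)

lemma dual_scale_closed:
  assumes "f \<in> vcarrier (dual_space A)"
  shows "vscale (dual_space A) c f \<in> vcarrier (dual_space A)"
proof (rule dual_spaceI[where K="cmod c * vnorm (dual_space A) f"])
  fix x assume x: "x \<in> vcarrier A"
  show "cmod (vscale (dual_space A) c f x) \<le> cmod c * vnorm (dual_space A) f * vnorm A x"
    using mult_left_mono[OF dual_norm_bound[OF assms(1) x], of "cmod c"] x
    by (simp add: dual_space_simps(2) norm_mult algebra_simps)
qed (use dual_spaceD(2)[OF assms] dual_spaceD(3)[OF assms] in \<open>auto simp: dual_space_simps algebra_simps\<close>)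

lemma arens_fa_dual:
  assumes f: "f \<in> vcarrier (dual_space A)" and a: "a \<in> vcarrier A"
  shows "arens_fa A f a \<in> vcarrier (dual_space A)"
    and "vnorm (dual_space A) (arens_fa A f a) \<le> vnorm (dual_space A) f * vnorm A a"
proof -
  have *: "cmod (arens_fa A f a x) \<le> vnorm (dual_space A) f * vnorm A a * vnorm A x" if x: "x \<in> vcarrier A" for x
  proof -
    have "cmod (f (vmult A a x)) \<le> vnorm (dual_space A) f * vnorm A (vmult A a x)"
      using a x by (intro dual_norm_bound f) auto
    also have "\<dots> \<le> vnorm (dual_space A) f * (vnorm A a * vnorm A x)"
      using a x by (intro mult_left_mono norm_mult_le dual_norm_nonneg f)
    finally show ?thesis using x by (simp add: arens_fa_def algebra_simps)
  qed
  show "arens_fa A f a \<in> vcarrier (dual_space A)"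
    by (rule dual_spaceI[OF _ _ _ *])
      (use a dual_spaceD(2)[OF f] dual_spaceD(3)[OF f] in
        \<open>simp_all add: arens_fa_def mult_add_right mult_scale_right extensional_def\<close>)
  show "vnorm (dual_space A) (arens_fa A f a) \<le> vnorm (dual_space A) f * vnorm A a"
    by (rule dual_norm_le[OF _ *]) (use dual_norm_nonneg[OF f] a in auto)
qed

lemma arens_Yf_dual:
  assumes Y: "Y \<in> vcarrier (bidual A)" and f: "f \<in> vcarrier (dual_space A)"
    and K: "0 \<le> K" "\<And>f. f \<in> vcarrier (dual_space A) \<Longrightarrow> cmod (Y f) \<le> K * vnorm (dual_space A) f"
  shows "arens_Yf A Y f \<in> vcarrier (dual_space A)"
    and "vnorm (dual_space A) (arens_Yf A Y f) \<le> K * vnorm (dual_space A) f"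
proof -
  have *: "cmod (arens_Yf A Y f a) \<le> K * vnorm (dual_space A) f * vnorm A a" if a: "a \<in> vcarrier A" for a
  proof -
    have "cmod (Y (arens_fa A f a)) \<le> K * vnorm (dual_space A) (arens_fa A f a)"
      by (intro K arens_fa_dual f a)
    also have "\<dots> \<le> K * (vnorm (dual_space A) f * vnorm A a)"
      by (intro mult_left_mono K arens_fa_dual f a)
    finally show ?thesis using a by (simp add: arens_Yf_def algebra_simps)
  qed
  show "arens_Yf A Y f \<in> vcarrier (dual_space A)"
  proof (rule dual_spaceI[OF _ _ _ *])
    fix x y assume xy: "x \<in> vcarrier A" "y \<in> vcarrier A"
    have "arens_fa A f (vadd A x y) = vadd (dual_space A) (arens_fa A f x) (arens_fa A f y)"
      using xy by (auto simp: arens_fa_def dual_space_simps mult_add_left dual_spaceD(2)[OF f])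
    then show "arens_Yf A Y f (vadd A x y) = arens_Yf A Y f x + arens_Yf A Y f y"
      using xy f by (simp add: arens_Yf_def dual_spaceD(2)[OF Y] arens_fa_dual)
  next
    fix c x assume x: "x \<in> vcarrier A"
    have "arens_fa A f (vscale A c x) = vscale (dual_space A) c (arens_fa A f x)"
      using x by (auto simp: arens_fa_def dual_space_simps mult_scale_left dual_spaceD(3)[OF f])
    then show "arens_Yf A Y f (vscale A c x) = c * arens_Yf A Y f x"
      using x f by (simp add: arens_Yf_def dual_spaceD(3)[OF Y] arens_fa_dual)
  qed (simp add: arens_Yf_def extensional_def)
  show "vnorm (dual_space A) (arens_Yf A Y f) \<le> K * vnorm (dual_space A) f"
    by (rule dual_norm_le[OF _ *]) (use dual_norm_nonneg[OF f] K in auto)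
qed

lemma arens_closed:
  assumes X: "X \<in> vcarrier (bidual A)" and Y: "Y \<in> vcarrier (bidual A)"
  shows "arens A X Y \<in> vcarrier (bidual A)"
proof -
  obtain K where K: "0 \<le> K" "\<And>f. f \<in> vcarrier (dual_space A) \<Longrightarrow> cmod (X f) \<le> K * vnorm (dual_space A) f"
    using bidual_bound[OF X] by metis
  obtain L where L: "0 \<le> L" "\<And>f. f \<in> vcarrier (dual_space A) \<Longrightarrow> cmod (Y f) \<le> L * vnorm (dual_space A) f"
    using bidual_bound[OF Y] by metis
  note Yf = arens_Yf_dual[OF Y _ L]
  show ?thesis
  proof (rule dual_spaceI[where K="K * L"])
    show "arens A X Y \<in> extensional (vcarrier (dual_space A))" by (simp add: arens_def)
  next
    fix f g assume fg: "f \<in> vcarrier (dual_space A)" "g \<in> vcarrier (dual_space A)"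
    have fa: "arens_fa A (vadd (dual_space A) f g) a = vadd (dual_space A) (arens_fa A f a) (arens_fa A g a)"
      if "a \<in> vcarrier A" for a
      using that by (auto simp: arens_fa_def dual_space_simps)
    have "arens_Yf A Y (vadd (dual_space A) f g) = vadd (dual_space A) (arens_Yf A Y f) (arens_Yf A Y g)"
      unfolding arens_Yf_def dual_space_simps(1)[of A "\<lambda>a\<in>vcarrier A. _ a"]
      by (rule restrict_ext) (use fg in \<open>simp add: fa dual_spaceD(2)[OF Y] arens_fa_dual\<close>)
    then show "arens A X Y (vadd (dual_space A) f g) = arens A X Y f + arens A X Y g"
      using fg by (simp add: arens_def dual_add_closed dual_spaceD(2)[OF X] Yf)
  next
    fix c f assume f: "f \<in> vcarrier (dual_space A)"
    have fa: "arens_fa A (vscale (dual_space A) c f) a = vscale (dual_space A) c (arens_fa A f a)"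
      if "a \<in> vcarrier A" for a
      using that by (auto simp: arens_fa_def dual_space_simps)
    have "arens_Yf A Y (vscale (dual_space A) c f) = vscale (dual_space A) c (arens_Yf A Y f)"
      unfolding arens_Yf_def dual_space_simps(2)[of A _ "\<lambda>a\<in>vcarrier A. _ a"]
      by (rule restrict_ext) (use f in \<open>simp add: fa dual_spaceD(3)[OF Y] arens_fa_dual\<close>)
    then show "arens A X Y (vscale (dual_space A) c f) = c * arens A X Y f"
      using f by (simp add: arens_def dual_scale_closed dual_spaceD(3)[OF X] Yf)
  next
    fix f assume f: "f \<in> vcarrier (dual_space A)"
    have "cmod (X (arens_Yf A Y f)) \<le> K * vnorm (dual_space A) (arens_Yf A Y f)"
      by (intro K Yf f)
    also have "\<dots> \<le> K * (L * vnorm (dual_space A) f)" by (intro mult_left_mono K Yf f)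
    finally show "cmod (arens A X Y f) \<le> K * L * vnorm (dual_space A) f"
      using f by (simp add: arens_def)
  qed
qed

end

section \<open>Criteria for Arens regularity and for its failure\<close>

text \<open>Induction on I: on the kernel of one evaluation the remaining ones suffice, and a vector
  off that kernel fixes the last coefficient. Hence W has to vary. Addition and scaling are
  parameters because a dual space is a carrier set and not a type.\<close>

lemma functional_eq_combination_of_evaluations:
  fixes ev :: "'i \<Rightarrow> 'v \<Rightarrow> complex" and X :: "'v \<Rightarrow> complex"
    and add :: "'v \<Rightarrow> 'v \<Rightarrow> 'v" and scale :: "complex \<Rightarrow> 'v \<Rightarrow> 'v"
  assumes "finite I" and "W \<noteq> {}"
    and "\<And>g h. g \<in> W \<Longrightarrow> h \<in> W \<Longrightarrow> add g h \<in> W" and "\<And>c g. g \<in> W \<Longrightarrow> scale c g \<in> W"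
    and "\<And>g h. g \<in> W \<Longrightarrow> h \<in> W \<Longrightarrow> X (add g h) = X g + X h"
    and "\<And>c g. g \<in> W \<Longrightarrow> X (scale c g) = c * X g"
    and "\<And>i g h. i \<in> I \<Longrightarrow> g \<in> W \<Longrightarrow> h \<in> W \<Longrightarrow> ev i (add g h) = ev i g + ev i h"
    and "\<And>i c g. i \<in> I \<Longrightarrow> g \<in> W \<Longrightarrow> ev i (scale c g) = c * ev i g"
    and "\<And>g. g \<in> W \<Longrightarrow> (\<And>i. i \<in> I \<Longrightarrow> ev i g = 0) \<Longrightarrow> X g = 0"
  shows "\<exists>c. \<forall>g\<in>W. X g = (\<Sum>i\<in>I. c i * ev i g)"
  using assms
proof (induction I arbitrary: W rule: finite_induct)
  case empty
  then show ?case by simp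
next
  case (insert a I)
  note add = insert.prems(2) and scale = insert.prems(3) and Xadd = insert.prems(4)
    and Xscale = insert.prems(5) and evadd = insert.prems(6) and evscale = insert.prems(7)
  define W' where "W' = {g \<in> W. ev a g = 0}"
  obtain w where w: "w \<in> W" using insert.prems(1) by auto
  have "\<exists>c. \<forall>g\<in>W'. X g = (\<Sum>i\<in>I. c i * ev i g)"
  proof (rule insert.IH)
    have "scale 0 w \<in> W'" using w scale evscale unfolding W'_def by simp
    then show "W' \<noteq> {}" by blast
    show "X g = 0" if "g \<in> W'" "\<And>i. i \<in> I \<Longrightarrow> ev i g = 0" for g
      by (rule insert.prems(8)) (use that in \<open>auto simp: W'_def\<close>)
  qed (use insert.prems(2-7) in \<open>auto simp: W'_def\<close>)
  then obtain c where c: "\<And>g. g \<in> W' \<Longrightarrow> X g = (\<Sum>i\<in>I. c i * ev i g)" by blast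
  show ?case
  proof (cases "\<exists>g0\<in>W. ev a g0 \<noteq> 0")
    case False
    then have "W' = W" by (auto simp: W'_def)
    have "X g = (\<Sum>i\<in>insert a I. c i * ev i g)" if "g \<in> W" for g
      using c[of g] that False insert.hyps by (auto simp: \<open>W' = W\<close>)
    then show ?thesis by blast
  next
    case True
    then obtain g0 where g0: "g0 \<in> W" "ev a g0 \<noteq> 0" by blast
    \<comment> \<open>The only value that makes the formula true at g0; every other g differs from a
      multiple of g0 by an element of \<open>W'\<close>.\<close>
    define d where "d = (X g0 - (\<Sum>i\<in>I. c i * ev i g0)) / ev a g0"
    have "X g = (\<Sum>i\<in>insert a I. (c(a := d)) i * ev i g)" if g: "g \<in> W" for g
    proof -
      define k where "k = - (ev a g / ev a g0)"
      define h where "h = add g (scale k g0)"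
      have "h \<in> W'" unfolding W'_def h_def k_def using g g0 add scale evadd evscale by simp
      then have "X h = (\<Sum>i\<in>I. c i * ev i h)" by (rule c)
      moreover have "X h = X g + k * X g0" unfolding h_def using g g0 Xadd Xscale scale by simp
      moreover have "(\<Sum>i\<in>I. c i * ev i h) = (\<Sum>i\<in>I. c i * ev i g) + k * (\<Sum>i\<in>I. c i * ev i g0)"
        unfolding sum_distrib_left sum.distrib[symmetric]
        by (rule sum.cong) (use g g0 evadd evscale scale in \<open>auto simp: h_def algebra_simps\<close>)
      moreover have "(\<Sum>i\<in>insert a I. (c(a := d)) i * ev i g) = d * ev a g + (\<Sum>i\<in>I. c i * ev i g)"
        using insert.hyps by (simp, intro sum.cong) auto
      moreover have "X g0 - (\<Sum>i\<in>I. c i * ev i g0) = d * ev a g0" "ev a g = - k * ev a g0"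
        using g0 by (simp_all add: d_def k_def)
      ultimately show ?thesis by (simp del: fun_upd_apply) algebra
    qed
    then show ?thesis by blast
  qed
qed

lemma topspace_weak_star: "topspace (weak_star E) = vcarrier (dual_space E)"
  by (auto simp: weak_star_def dual_space_def PiE_def)

context normed_calgebra
begin

text \<open>X is a combination of evaluations at points of F, so multiplication by X from the left
  reads only the finitely many coordinates \<open>Y (arens_fa A f a)\<close> of Y, and coordinates
  are weak-star continuous.\<close>

lemma arens_regularI_finite:
  assumes F: "finite F" "F \<subseteq> vcarrier A"
    and sep: "\<And>g a. g \<in> vcarrier (dual_space A) \<Longrightarrow> (\<And>a. a \<in> F \<Longrightarrow> g a = 0) \<Longrightarrow> a \<in> vcarrier A \<Longrightarrow> g a = 0"
  shows "arens_regular A"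
  unfolding arens_regular_def
proof
  fix X assume X: "X \<in> vcarrier (bidual A)"
  have zero: "(\<lambda>a\<in>vcarrier A. 0) \<in> vcarrier (dual_space A)"
    by (rule dual_spaceI[where K=0]) auto
  have "\<exists>c. \<forall>g\<in>vcarrier (dual_space A). X g = (\<Sum>a\<in>F. c a * g a)"
  proof (rule functional_eq_combination_of_evaluations[where add="vadd (dual_space A)" and scale="vscale (dual_space A)" and ev="\<lambda>a g. g a"])
    fix g assume g: "g \<in> vcarrier (dual_space A)" and "\<And>a. a \<in> F \<Longrightarrow> g a = 0"
    then have "g a = 0" if "a \<in> vcarrier A" for a using sep that by blast
    then have "g = vscale (dual_space A) 0 g"
      using dual_spaceD(1)[OF g] by (auto simp: dual_space_simps extensional_def)
    then show "X g = 0" using dual_spaceD(3)[OF X g, of 0] by simp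
  qed (use F zero dual_add_closed dual_scale_closed dual_spaceD(2)[OF X] dual_spaceD(3)[OF X] in
      \<open>auto simp: dual_space_simps\<close>)
  then obtain c where c: "\<And>g. g \<in> vcarrier (dual_space A) \<Longrightarrow> X g = (\<Sum>a\<in>F. c a * g a)" by blast
  have eq: "arens A X Y f = (\<Sum>a\<in>F. c a * Y (arens_fa A f a))"
    if Y: "Y \<in> vcarrier (bidual A)" and f: "f \<in> vcarrier (dual_space A)" for Y f
  proof -
    obtain K where K: "0 \<le> K" "\<And>f. f \<in> vcarrier (dual_space A) \<Longrightarrow> cmod (Y f) \<le> K * vnorm (dual_space A) f"
      using bidual_bound[OF Y] by metis
    have "X (arens_Yf A Y f) = (\<Sum>a\<in>F. c a * arens_Yf A Y f a)"
      by (rule c) (rule arens_Yf_dual[OF Y f K])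
    also have "\<dots> = (\<Sum>a\<in>F. c a * Y (arens_fa A f a))"
      by (rule sum.cong) (use F in \<open>auto simp: arens_Yf_def\<close>)
    finally show ?thesis using f by (simp add: arens_def)
  qed
  have cont: "continuous_map (weak_star (dual_space A)) euclidean (\<lambda>Y. arens A X Y f)"
    if f: "f \<in> vcarrier (dual_space A)" for f
  proof (rule continuous_map_eq)
    show "continuous_map (weak_star (dual_space A)) euclidean (\<lambda>Y. \<Sum>a\<in>F. c a * Y (arens_fa A f a))"
    proof (intro continuous_map_sum F)
      fix a assume "a \<in> F"
      then have h: "arens_fa A f a \<in> vcarrier (dual_space A)" using F f arens_fa_dual by blast
      have 1: "continuous_map (weak_star (dual_space A)) euclidean (\<lambda>Y. Y (arens_fa A f a))"
        unfolding weak_star_def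
        by (intro continuous_map_from_subtopology continuous_map_product_projection h)
      have 2: "continuous_map euclidean euclidean (\<lambda>z. c a * z)"
        by (simp add: continuous_on_mult_left)
      show "continuous_map (weak_star (dual_space A)) euclidean (\<lambda>Y. c a * Y (arens_fa A f a))"
        using continuous_map_compose[OF 1 2] by (simp add: o_def)
    qed
  qed (use eq f in \<open>auto simp: topspace_weak_star\<close>)
  show "continuous_map (weak_star (dual_space A)) (weak_star (dual_space A)) (arens A X)"
    unfolding weak_star_def[of "dual_space A"]
  proof (rule continuous_map_into_subtopology)
    show "continuous_map (subtopology (product_topology (\<lambda>_. euclidean) (vcarrier (dual_space A))) (vcarrier (bidual A)))
        (product_topology (\<lambda>_. euclidean) (vcarrier (dual_space A))) (arens A X)"
      unfolding continuous_map_componentwise weak_star_def[of "dual_space A", symmetric]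
      using cont by (auto simp: arens_def)
  qed (use X arens_closed in auto)
qed

text \<open>One direction of the double limit criterion. X and Y are the limits of a and b in the
  bidual along U. As X is applied last, the product of X and Y at f is the limit over i of the
  limits over j, which is 1; the product of X with the image of a single \<open>b j\<close> is a
  limit over i alone, which is 0. Weak-star continuity would let the latter tend to the
  former.\<close>

lemma not_arens_regularI:
  fixes a b :: "nat \<Rightarrow> 'a"
  assumes f: "f \<in> vcarrier (dual_space A)"
    and a: "\<And>n. a n \<in> vcarrier A" "\<And>n. vnorm A (a n) \<le> K"
    and b: "\<And>n. b n \<in> vcarrier A" "\<And>n. vnorm A (b n) \<le> K"
    and fab: "\<And>i j. f (vmult A (a i) (b j)) = (if i < j then 1 else 0)"
  shows "\<not> arens_regular A"
proof
  assume reg: "arens_regular A"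
  obtain U :: "nat filter" where U: "U \<noteq> bot" "U \<le> sequentially"
    "\<And>(f :: nat \<Rightarrow> complex) K. (\<And>n. cmod (f n) \<le> K) \<Longrightarrow> (f \<longlongrightarrow> Lim U f) U"
    using ex_bounded_limit_filter by metis
  have K: "0 \<le> K" using a norm_nonneg order_trans by blast
  have lim: "((\<lambda>n. g (x n)) \<longlongrightarrow> Lim U (\<lambda>n. g (x n))) U" "cmod (Lim U (\<lambda>n. g (x n))) \<le> K * vnorm (dual_space A) g"
    if x: "\<And>n. x n \<in> vcarrier A" "\<And>n. vnorm A (x n) \<le> K" and g: "g \<in> vcarrier (dual_space A)" for x g
  proof -
    have bd: "cmod (g (x n)) \<le> K * vnorm (dual_space A) g" for n
      using dual_norm_bound[OF g x(1), of n] mult_left_mono[OF x(2) dual_norm_nonneg[OF g], of n]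
      by (simp add: mult.commute)
    then show 1: "((\<lambda>n. g (x n)) \<longlongrightarrow> Lim U (\<lambda>n. g (x n))) U" by (rule U(3))
    show "cmod (Lim U (\<lambda>n. g (x n))) \<le> K * vnorm (dual_space A) g"
      by (rule tendsto_upperbound[OF tendsto_norm[OF 1] _ U(1)]) (simp add: bd)
  qed
  have mem: "(\<lambda>g\<in>vcarrier (dual_space A). Lim U (\<lambda>n. g (x n))) \<in> vcarrier (bidual A)"
    if x: "\<And>n. x n \<in> vcarrier A" "\<And>n. vnorm A (x n) \<le> K" for x
  proof (rule dual_spaceI[where K=K])
    fix g h assume gh: "g \<in> vcarrier (dual_space A)" "h \<in> vcarrier (dual_space A)"
    show "(\<lambda>g\<in>vcarrier (dual_space A). Lim U (\<lambda>n. g (x n))) (vadd (dual_space A) g h) =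
      (\<lambda>g\<in>vcarrier (dual_space A). Lim U (\<lambda>n. g (x n))) g + (\<lambda>g\<in>vcarrier (dual_space A). Lim U (\<lambda>n. g (x n))) h"
      using tendsto_Lim[OF U(1) tendsto_add[OF lim(1)[OF x gh(1)] lim(1)[OF x gh(2)]]] gh x
      by (simp add: dual_add_closed) (simp add: dual_space_simps)
  next
    fix c g assume g: "g \<in> vcarrier (dual_space A)"
    show "(\<lambda>g\<in>vcarrier (dual_space A). Lim U (\<lambda>n. g (x n))) (vscale (dual_space A) c g) =
      c * (\<lambda>g\<in>vcarrier (dual_space A). Lim U (\<lambda>n. g (x n))) g"
      using tendsto_Lim[OF U(1) tendsto_mult_left[OF lim(1)[OF x g]], of c] g x
      by (simp add: dual_scale_closed) (simp add: dual_space_simps)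
  qed (use lim(2)[OF x] in auto)
  define X where "X = (\<lambda>g\<in>vcarrier (dual_space A). Lim U (\<lambda>n. g (a n)))"
  define Y where "Y = (\<lambda>g\<in>vcarrier (dual_space A). Lim U (\<lambda>n. g (b n)))"
  \<comment> \<open>The canonical image of \<open>b j\<close> in the bidual. It is the limit of a
    constant sequence, so \<open>mem\<close> covers it as well.\<close>
  define Yj where "Yj = (\<lambda>j. \<lambda>g\<in>vcarrier (dual_space A). g (b j))"
  have X: "X \<in> vcarrier (bidual A)" unfolding X_def by (rule mem[OF a])
  have Y: "Y \<in> vcarrier (bidual A)" unfolding Y_def by (rule mem[OF b])
  have Yj: "Yj j \<in> vcarrier (bidual A)" for j
  proof -
    have const: "Lim U (\<lambda>_. z) = z" for z :: complex by (rule tendsto_Lim[OF U(1) tendsto_const])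
    show ?thesis using mem[of "\<lambda>_. b j"] b unfolding Yj_def const by blast
  qed
  have limY: "limitin (weak_star (dual_space A)) Yj Y U"
    unfolding weak_star_def limitin_subtopology limitin_componentwise
    using Y Yj lim(1)[OF b] dual_spaceD(1)[OF Yj] by (auto simp: Y_def Yj_def)
  have Yfd: "arens_Yf A Z f \<in> vcarrier (dual_space A)" if Z: "Z \<in> vcarrier (bidual A)" for Z
    using bidual_bound[OF Z] arens_Yf_dual(1)[OF Z f] by metis
  have "limitin (weak_star (dual_space A)) (arens A X \<circ> Yj) (arens A X Y) U"
    by (rule continuous_map_limit[OF _ limY]) (use reg X in \<open>simp add: arens_regular_def\<close>)
  then have "((\<lambda>j. arens A X (Yj j) f) \<longlongrightarrow> arens A X Y f) U"
    unfolding weak_star_def limitin_subtopology limitin_componentwise using f by auto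
  moreover have "arens A X (Yj j) f = 0" for j
  proof -
    have "arens A X (Yj j) f = Lim U (\<lambda>i. f (vmult A (a i) (b j)))"
      using f a b Yfd[OF Yj] arens_fa_dual(1)[OF f]
      by (simp add: arens_def X_def) (simp add: arens_Yf_def Yj_def arens_fa_def)
    also have "\<dots> = 0"
    proof (rule tendsto_Lim[OF U(1)])
      have "(\<lambda>i. if i < j then 1 else 0 :: complex) \<longlonglongrightarrow> 0"
        by (rule tendsto_eventually) (auto intro: eventually_mono[OF eventually_ge_at_top[of j]])
      then show "((\<lambda>i. f (vmult A (a i) (b j))) \<longlongrightarrow> 0) U"
        unfolding fab using U(2) tendsto_mono by blast
    qed
    finally show ?thesis .
  qed
  moreover have "arens A X Y f = 1"
  proof -
    have "Lim U (\<lambda>j. f (vmult A (a i) (b j))) = 1" for i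
    proof (rule tendsto_Lim[OF U(1)])
      have "(\<lambda>j. if i < j then 1 else 0 :: complex) \<longlonglongrightarrow> 1"
        by (rule tendsto_eventually) (auto intro: eventually_mono[OF eventually_gt_at_top[of i]])
      then show "((\<lambda>j. f (vmult A (a i) (b j))) \<longlongrightarrow> 1) U"
        unfolding fab using U(2) tendsto_mono by blast
    qed
    then have "arens_Yf A Y f (a i) = 1" for i
      using a b arens_fa_dual(1)[OF f] by (simp add: arens_Yf_def Y_def) (simp add: arens_fa_def)
    then show ?thesis
      using f Yfd[OF Y] tendsto_Lim[OF U(1) tendsto_const] by (simp add: arens_def X_def)
  qed
  ultimately have "((\<lambda>j::nat. 0::complex) \<longlongrightarrow> 1) U" by simp
  then show False using tendsto_unique[OF U(1) _ tendsto_const] by fastforce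
qed

end

section \<open>Completions\<close>

context normed_calgebra
begin

lemma add_left_commute:
  "x \<in> vcarrier A \<Longrightarrow> y \<in> vcarrier A \<Longrightarrow> z \<in> vcarrier A \<Longrightarrow>
    vadd A x (vadd A y z) = vadd A y (vadd A x z)"
  by (metis add_assoc add_commute)

lemmas add_ac = add_assoc add_commute add_left_commute

lemma zero_add: "x \<in> vcarrier A \<Longrightarrow> y \<in> vcarrier A \<Longrightarrow> vadd A (vscale A 0 y) x = x"
  by (simp add: add_commute[of "vscale A 0 y" x] add_zero)

lemma add_neg: "x \<in> vcarrier A \<Longrightarrow> vadd A x (vscale A (-1) x) = vscale A 0 x"
  using scale_add_left[of x 1 "-1"] by (simp add: scale_one)

lemma neg_add_cancel:
  "x \<in> vcarrier A \<Longrightarrow> y \<in> vcarrier A \<Longrightarrow> vadd A (vscale A (-1) x) (vadd A x y) = y"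
  by (subst add_assoc[symmetric]) (simp_all add: add_commute[of "vscale A (-1) x" x] add_neg zero_add)

lemma vdist_nonneg: "x \<in> vcarrier A \<Longrightarrow> y \<in> vcarrier A \<Longrightarrow> 0 \<le> vdist A x y"
  by (simp add: vdist_def)

lemma vdist_self: "x \<in> vcarrier A \<Longrightarrow> vdist A x x = 0"
  by (simp add: vdist_def add_neg norm_scale)

lemma vdist_commute:
  assumes "x \<in> vcarrier A" "y \<in> vcarrier A"
  shows "vdist A x y = vdist A y x"
proof -
  have "vadd A y (vscale A (-1) x) = vscale A (-1) (vadd A x (vscale A (-1) y))"
    using assms by (simp add: scale_add_right scale_scale scale_one add_commute)
  then show ?thesis using assms by (simp add: vdist_def norm_scale)
qed

lemma vdist_triangle:
  assumes "x \<in> vcarrier A" "y \<in> vcarrier A" "z \<in> vcarrier A"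
  shows "vdist A x z \<le> vdist A x y + vdist A y z"
proof -
  have "vadd A x (vscale A (-1) z) = vadd A (vadd A x (vscale A (-1) y)) (vadd A y (vscale A (-1) z))"
    using assms by (simp add: add_assoc neg_add_cancel)
  then show ?thesis using assms by (simp add: vdist_def norm_triangle)
qed

lemma vdist_add:
  assumes "x \<in> vcarrier A" "y \<in> vcarrier A" "x' \<in> vcarrier A" "y' \<in> vcarrier A"
  shows "vdist A (vadd A x y) (vadd A x' y') \<le> vdist A x x' + vdist A y y'"
proof -
  have "vadd A (vadd A x y) (vscale A (-1) (vadd A x' y')) =
    vadd A (vadd A x (vscale A (-1) x')) (vadd A y (vscale A (-1) y'))"
    using assms by (simp add: scale_add_right add_ac)
  then show ?thesis using assms by (simp add: vdist_def norm_triangle)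
qed

lemma vdist_scale:
  assumes "x \<in> vcarrier A" "y \<in> vcarrier A"
  shows "vdist A (vscale A c x) (vscale A c y) = cmod c * vdist A x y"
proof -
  have "vadd A (vscale A c x) (vscale A (-1) (vscale A c y)) = vscale A c (vadd A x (vscale A (-1) y))"
    using assms by (simp add: scale_add_right scale_scale)
  then show ?thesis using assms by (simp add: vdist_def norm_scale)
qed

text \<open>By splitting xy - x'y' as x(y - y') + (x - x')y'.\<close>

lemma vdist_mult:
  assumes "x \<in> vcarrier A" "y \<in> vcarrier A" "x' \<in> vcarrier A" "y' \<in> vcarrier A"
  shows "vdist A (vmult A x y) (vmult A x' y') \<le> vnorm A x * vdist A y y' + vdist A x x' * vnorm A y'"
proof -
  have "vadd A (vmult A x y) (vscale A (-1) (vmult A x' y')) =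
    vadd A (vmult A x (vadd A y (vscale A (-1) y'))) (vmult A (vadd A x (vscale A (-1) x')) y')"
    using assms by (simp add: mult_add_right mult_add_left mult_scale_left mult_scale_right add_assoc neg_add_cancel)
  then have "vdist A (vmult A x y) (vmult A x' y') \<le>
    vnorm A (vmult A x (vadd A y (vscale A (-1) y'))) + vnorm A (vmult A (vadd A x (vscale A (-1) x')) y')"
    using assms by (simp add: vdist_def norm_triangle)
  also have "\<dots> \<le> vnorm A x * vdist A y y' + vdist A x x' * vnorm A y'"
    unfolding vdist_def using assms by (intro add_mono norm_mult_le) auto
  finally show ?thesis .
qed

lemma norm_le_add_vdist:
  assumes "x \<in> vcarrier A" "y \<in> vcarrier A"
  shows "vnorm A x \<le> vnorm A y + vdist A x y"
proof -
  have "vadd A y (vadd A x (vscale A (-1) y)) = x"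
    using assms by (simp add: add_left_commute[of y x] add_neg add_zero)
  then show ?thesis using norm_triangle[of y "vadd A x (vscale A (-1) y)"] assms by (simp add: vdist_def)
qed

lemma abs_norm_diff_le_vdist:
  assumes "x \<in> vcarrier A" "y \<in> vcarrier A"
  shows "\<bar>vnorm A x - vnorm A y\<bar> \<le> vdist A x y"
  using norm_le_add_vdist[OF assms] norm_le_add_vdist[OF assms(2,1)] vdist_commute[OF assms] by linarith

lemma cauchy_seqsI:
  assumes "\<And>n. s n \<in> vcarrier A" "\<And>e. e > 0 \<Longrightarrow> \<exists>N. \<forall>m\<ge>N. \<forall>n\<ge>N. vdist A (s m) (s n) < e"
  shows "s \<in> cauchy_seqs A"
  using assms by (auto simp: cauchy_seqs_def)

lemma cauchy_seqsD:
  assumes "s \<in> cauchy_seqs A"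
  shows "s n \<in> vcarrier A" "e > 0 \<Longrightarrow> \<exists>N. \<forall>m\<ge>N. \<forall>n\<ge>N. vdist A (s m) (s n) < e"
  using assms by (auto simp: cauchy_seqs_def)

lemma cauchy_seqs_bounded:
  assumes "s \<in> cauchy_seqs A"
  obtains K where "0 < K" "\<And>n. vnorm A (s n) \<le> K"
proof -
  obtain N where N: "\<And>n. n \<ge> N \<Longrightarrow> vdist A (s n) (s N) < 1"
    using cauchy_seqsD(2)[OF assms, of 1] by (meson le_refl zero_less_one)
  define K where "K = Max ((\<lambda>n. vnorm A (s n)) ` {..N}) + 1"
  have le: "vnorm A (s n) \<le> K - 1" if "n \<le> N" for n
    unfolding K_def using that by (simp add: Max_ge)
  have "vnorm A (s n) \<le> K" for n
  proof (cases "n \<le> N")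
    case True
    then show ?thesis using le[of n] by simp
  next
    case False
    then show ?thesis using N[of n] le[of N] norm_le_add_vdist[of "s n" "s N"] cauchy_seqsD(1)[OF assms]
      by fastforce
  qed
  moreover have "0 < K" using le[of 0] norm_nonneg[OF cauchy_seqsD(1)[OF assms], of 0] by linarith
  ultimately show ?thesis using that by blast
qed

lemma cauchy_seqs_const: "x \<in> vcarrier A \<Longrightarrow> (\<lambda>_. x) \<in> cauchy_seqs A"
  by (rule cauchy_seqsI) (auto simp: vdist_self)

lemma cauchy_seqs_add:
  assumes "s \<in> cauchy_seqs A" "t \<in> cauchy_seqs A"
  shows "(\<lambda>n. vadd A (s n) (t n)) \<in> cauchy_seqs A"
proof (rule cauchy_seqsI)
  note S = cauchy_seqsD[OF assms(1)] and T = cauchy_seqsD[OF assms(2)]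
  fix e :: real assume "e > 0"
  then obtain N M where N: "\<forall>m\<ge>N. \<forall>n\<ge>N. vdist A (s m) (s n) < e/2" and M: "\<forall>m\<ge>M. \<forall>n\<ge>M. vdist A (t m) (t n) < e/2"
    using S(2)[of "e/2"] T(2)[of "e/2"] by auto
  show "\<exists>N. \<forall>m\<ge>N. \<forall>n\<ge>N. vdist A (vadd A (s m) (t m)) (vadd A (s n) (t n)) < e"
  proof (intro exI allI impI)
    fix m n assume "m \<ge> max N M" "n \<ge> max N M"
    then have "vdist A (s m) (s n) < e/2" "vdist A (t m) (t n) < e/2" using N M by auto
    then show "vdist A (vadd A (s m) (t m)) (vadd A (s n) (t n)) < e"
      using vdist_add[OF S(1) T(1) S(1) T(1), of m m n n] by linarith
  qed
qed (use assms[THEN cauchy_seqsD(1)] in auto)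

lemma cauchy_seqs_scale:
  assumes "s \<in> cauchy_seqs A"
  shows "(\<lambda>n. vscale A c (s n)) \<in> cauchy_seqs A"
proof (rule cauchy_seqsI)
  note S = cauchy_seqsD[OF assms(1)]
  fix e :: real assume "e > 0"
  then obtain N where N: "\<forall>m\<ge>N. \<forall>n\<ge>N. vdist A (s m) (s n) < e / (cmod c + 1)"
    using S(2)[of "e / (cmod c + 1)"] by (auto simp: add_nonneg_pos)
  show "\<exists>N. \<forall>m\<ge>N. \<forall>n\<ge>N. vdist A (vscale A c (s m)) (vscale A c (s n)) < e"
  proof (intro exI allI impI)
    fix m n assume "m \<ge> N" "n \<ge> N"
    then have "vdist A (s m) (s n) * (cmod c + 1) < e"
      using N by (simp add: pos_less_divide_eq add_nonneg_pos)
    moreover have "0 \<le> vdist A (s m) (s n)" using S(1) vdist_nonneg by simp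
    ultimately show "vdist A (vscale A c (s m)) (vscale A c (s n)) < e"
      using S(1) by (simp add: vdist_scale algebra_simps)
  qed
qed (use cauchy_seqsD(1)[OF assms] in auto)

lemma cauchy_seqs_mult:
  assumes "s \<in> cauchy_seqs A" "t \<in> cauchy_seqs A"
  shows "(\<lambda>n. vmult A (s n) (t n)) \<in> cauchy_seqs A"
proof (rule cauchy_seqsI)
  note S = cauchy_seqsD[OF assms(1)] and T = cauchy_seqsD[OF assms(2)]
  obtain K where K: "0 < K" "\<And>n. vnorm A (s n) \<le> K" using cauchy_seqs_bounded[OF assms(1)] by metis
  obtain L where L: "0 < L" "\<And>n. vnorm A (t n) \<le> L" using cauchy_seqs_bounded[OF assms(2)] by metis
  fix e :: real assume "e > 0"
  then obtain N M where N: "\<forall>m\<ge>N. \<forall>n\<ge>N. vdist A (s m) (s n) < e/(2*L)" and M: "\<forall>m\<ge>M. \<forall>n\<ge>M. vdist A (t m) (t n) < e/(2*K)"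
    using S(2)[of "e/(2*L)"] T(2)[of "e/(2*K)"] K L by auto
  show "\<exists>N. \<forall>m\<ge>N. \<forall>n\<ge>N. vdist A (vmult A (s m) (t m)) (vmult A (s n) (t n)) < e"
  proof (intro exI allI impI)
    fix m n assume "m \<ge> max N M" "n \<ge> max N M"
    then have *: "vdist A (s m) (s n) < e/(2*L)" "vdist A (t m) (t n) < e/(2*K)" using N M by auto
    have "vnorm A (s m) * vdist A (t m) (t n) \<le> K * vdist A (t m) (t n)"
      by (intro mult_right_mono K vdist_nonneg T)
    also have "\<dots> < e/2" using * K by (simp add: field_simps)
    finally have 1: "vnorm A (s m) * vdist A (t m) (t n) < e/2" .
    have "vdist A (s m) (s n) * vnorm A (t n) \<le> vdist A (s m) (s n) * L"
      by (intro mult_left_mono L vdist_nonneg S)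
    also have "\<dots> < e/2" using * L by (simp add: field_simps)
    finally show "vdist A (vmult A (s m) (t m)) (vmult A (s n) (t n)) < e"
      using vdist_mult[OF S(1) T(1) S(1) T(1), of m m n n] 1 by linarith
  qed
qed (use assms[THEN cauchy_seqsD(1)] in auto)

lemma null_relI:
  assumes "s \<in> cauchy_seqs A" "t \<in> cauchy_seqs A" "(\<lambda>n. vdist A (s n) (t n)) \<longlonglongrightarrow> 0"
  shows "(s, t) \<in> null_rel A"
  using assms by (simp add: null_rel_def)

lemma null_relD:
  assumes "(s, t) \<in> null_rel A"
  shows "s \<in> cauchy_seqs A" "t \<in> cauchy_seqs A" "(\<lambda>n. vdist A (s n) (t n)) \<longlonglongrightarrow> 0"
  using assms by (auto simp: null_rel_def)

lemma tendsto_vdist_zero_le: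
  assumes "\<And>n. s n \<in> vcarrier A" "\<And>n. t n \<in> vcarrier A" "\<And>n. vdist A (s n) (t n) \<le> f n" "f \<longlonglongrightarrow> 0"
  shows "(\<lambda>n. vdist A (s n) (t n)) \<longlonglongrightarrow> 0"
  by (rule tendsto_sandwich[OF _ _ tendsto_const assms(4)]) (use assms vdist_nonneg in auto)

lemma equiv_null_rel: "equiv (cauchy_seqs A) (null_rel A)"
proof (rule equivI)
  show "null_rel A \<subseteq> cauchy_seqs A \<times> cauchy_seqs A" by (auto simp: null_rel_def)
  show "refl_on (cauchy_seqs A) (null_rel A)"
    by (auto simp: refl_on_def null_rel_def vdist_self[OF cauchy_seqsD(1)])
  show "sym (null_rel A)"
    by (auto simp: sym_def null_rel_def cauchy_seqsD(1) vdist_commute)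
  show "trans (null_rel A)"
  proof (rule transI)
    fix r s t assume rs: "(r, s) \<in> null_rel A" "(s, t) \<in> null_rel A"
    note D = null_relD[OF rs(1)] null_relD[OF rs(2)]
    note C = cauchy_seqsD(1)[OF D(1)] cauchy_seqsD(1)[OF D(2)] cauchy_seqsD(1)[OF D(5)]
    show "(r, t) \<in> null_rel A"
    proof (rule null_relI[OF D(1,5) tendsto_vdist_zero_le[OF C(1,3)]])
      show "vdist A (r n) (t n) \<le> vdist A (r n) (s n) + vdist A (s n) (t n)" for n
        by (rule vdist_triangle[OF C])
      show "(\<lambda>n. vdist A (r n) (s n) + vdist A (s n) (t n)) \<longlonglongrightarrow> 0"
        using tendsto_add[OF D(3) D(6)] by simp
    qed
  qed
qed

lemma completion_carrier: "vcarrier (completion A) = cauchy_seqs A // null_rel A"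
  by (simp add: completion_def)

lemma completion_carrierE:
  assumes "X \<in> vcarrier (completion A)"
  obtains s where "s \<in> cauchy_seqs A" "X = null_rel A `` {s}"
  using assms unfolding completion_carrier by (auto elim: quotientE)

lemma completion_carrierI: "s \<in> cauchy_seqs A \<Longrightarrow> null_rel A `` {s} \<in> vcarrier (completion A)"
  unfolding completion_carrier by (rule quotientI)

lemma completion_add:
  assumes "s \<in> cauchy_seqs A" "t \<in> cauchy_seqs A"
  shows "vadd (completion A) (null_rel A `` {s}) (null_rel A `` {t}) = null_rel A `` {\<lambda>n. vadd A (s n) (t n)}"
proof -
  have "congruent2 (null_rel A) (null_rel A) (\<lambda>s t. null_rel A `` {\<lambda>n. vadd A (s n) (t n)})"
  proof (rule congruent2I')
    fix s s' t t' assume st: "(s, s') \<in> null_rel A" "(t, t') \<in> null_rel A"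
    note S = null_relD[OF st(1)] and T = null_relD[OF st(2)]
    show "null_rel A `` {\<lambda>n. vadd A (s n) (t n)} = null_rel A `` {\<lambda>n. vadd A (s' n) (t' n)}"
    proof (intro equiv_class_eq[OF equiv_null_rel] null_relI cauchy_seqs_add S T)
      show "(\<lambda>n. vdist A (vadd A (s n) (t n)) (vadd A (s' n) (t' n))) \<longlonglongrightarrow> 0"
      proof (rule tendsto_vdist_zero_le[OF _ _ vdist_add])
        show "(\<lambda>n. vdist A (s n) (s' n) + vdist A (t n) (t' n)) \<longlonglongrightarrow> 0"
          using tendsto_add[OF S(3) T(3)] by simp
      qed (use S T cauchy_seqsD(1) in auto)
    qed
  qed
  from UN_equiv_class2[OF equiv_null_rel equiv_null_rel this assms] show ?thesis
    by (simp add: completion_def)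
qed

lemma completion_scale:
  assumes "s \<in> cauchy_seqs A"
  shows "vscale (completion A) c (null_rel A `` {s}) = null_rel A `` {\<lambda>n. vscale A c (s n)}"
proof -
  have "(\<lambda>s. null_rel A `` {\<lambda>n. vscale A c (s n)}) respects null_rel A"
  proof (rule congruentI)
    fix s s' assume s: "(s, s') \<in> null_rel A"
    note S = null_relD[OF s]
    show "null_rel A `` {\<lambda>n. vscale A c (s n)} = null_rel A `` {\<lambda>n. vscale A c (s' n)}"
    proof (intro equiv_class_eq[OF equiv_null_rel] null_relI cauchy_seqs_scale S)
      show "(\<lambda>n. vdist A (vscale A c (s n)) (vscale A c (s' n))) \<longlonglongrightarrow> 0"
      proof (rule tendsto_vdist_zero_le[OF _ _ eq_refl[OF vdist_scale]])
        show "(\<lambda>n. cmod c * vdist A (s n) (s' n)) \<longlonglongrightarrow> 0"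
          using tendsto_mult_left[OF S(3)] by simp
      qed (use S cauchy_seqsD(1) in auto)
    qed
  qed
  from UN_equiv_class[OF equiv_null_rel this assms] show ?thesis
    by (simp add: completion_def)
qed

lemma completion_mult:
  assumes "s \<in> cauchy_seqs A" "t \<in> cauchy_seqs A"
  shows "vmult (completion A) (null_rel A `` {s}) (null_rel A `` {t}) = null_rel A `` {\<lambda>n. vmult A (s n) (t n)}"
proof -
  have "congruent2 (null_rel A) (null_rel A) (\<lambda>s t. null_rel A `` {\<lambda>n. vmult A (s n) (t n)})"
  proof (rule congruent2I')
    fix s s' t t' assume st: "(s, s') \<in> null_rel A" "(t, t') \<in> null_rel A"
    note S = null_relD[OF st(1)] and T = null_relD[OF st(2)]
    note C = cauchy_seqsD(1)[OF S(1)] cauchy_seqsD(1)[OF S(2)] cauchy_seqsD(1)[OF T(1)] cauchy_seqsD(1)[OF T(2)]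
    obtain K where K: "\<And>n. vnorm A (s n) \<le> K" using cauchy_seqs_bounded[OF S(1)] by metis
    obtain L where L: "\<And>n. vnorm A (t' n) \<le> L" using cauchy_seqs_bounded[OF T(2)] by metis
    show "null_rel A `` {\<lambda>n. vmult A (s n) (t n)} = null_rel A `` {\<lambda>n. vmult A (s' n) (t' n)}"
    proof (intro equiv_class_eq[OF equiv_null_rel] null_relI cauchy_seqs_mult S T tendsto_vdist_zero_le)
      show "vdist A (vmult A (s n) (t n)) (vmult A (s' n) (t' n)) \<le> K * vdist A (t n) (t' n) + vdist A (s n) (s' n) * L" for n
        using vdist_mult[OF C(1,3,2,4), of n n n n]
          mult_right_mono[OF K vdist_nonneg[OF C(3,4)], of n n n] mult_left_mono[OF L vdist_nonneg[OF C(1,2)], of n n n]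
        by linarith
      show "(\<lambda>n. K * vdist A (t n) (t' n) + vdist A (s n) (s' n) * L) \<longlonglongrightarrow> 0"
        using tendsto_add[OF tendsto_mult_left[OF T(3)] tendsto_mult_right[OF S(3)], of K L] by simp
    qed (use C in auto)
  qed
  from UN_equiv_class2[OF equiv_null_rel equiv_null_rel this assms] show ?thesis
    by (simp add: completion_def)
qed

text \<open>Serves both the norm of the completion and the extension of functionals. Limits along
  equivalent sequences agree, so the set under \<open>the_elem\<close> is a singleton and the
  formula by representatives means the limit.\<close>

lemma lipschitz_limit_completion:
  fixes h :: "'a \<Rightarrow> 'z :: banach"
  assumes h: "\<And>x y. x \<in> vcarrier A \<Longrightarrow> y \<in> vcarrier A \<Longrightarrow> dist (h x) (h y) \<le> K * vdist A x y"
    and s: "s \<in> cauchy_seqs A"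
  shows "(\<lambda>n. h (s n)) \<longlonglongrightarrow> the_elem ((\<lambda>s. lim (\<lambda>n. h (s n))) ` (null_rel A `` {s}))"
proof -
  have conv: "(\<lambda>n. h (s n)) \<longlonglongrightarrow> lim (\<lambda>n. h (s n))" if s: "s \<in> cauchy_seqs A" for s
  proof -
    have "Cauchy (\<lambda>n. h (s n))"
    proof (rule metric_CauchyI)
      fix e :: real assume e: "e > 0"
      then obtain N where N: "\<forall>m\<ge>N. \<forall>n\<ge>N. vdist A (s m) (s n) < e / (\<bar>K\<bar> + 1)"
        using cauchy_seqsD(2)[OF s, of "e / (\<bar>K\<bar> + 1)"] by (auto simp: add_nonneg_pos)
      show "\<exists>N. \<forall>m\<ge>N. \<forall>n\<ge>N. dist (h (s m)) (h (s n)) < e"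
      proof (intro exI allI impI)
        fix m n assume "m \<ge> N" "n \<ge> N"
        then have 1: "vdist A (s m) (s n) * (\<bar>K\<bar> + 1) < e"
          using N by (simp add: pos_less_divide_eq add_nonneg_pos)
        have 0: "0 \<le> vdist A (s m) (s n)" using cauchy_seqsD(1)[OF s] vdist_nonneg by simp
        have "dist (h (s m)) (h (s n)) \<le> K * vdist A (s m) (s n)"
          using h cauchy_seqsD(1)[OF s] by simp
        also have "\<dots> \<le> \<bar>K\<bar> * vdist A (s m) (s n)" by (rule mult_right_mono[OF abs_ge_self 0])
        finally show "dist (h (s m)) (h (s n)) < e" using 0 1 by (simp add: algebra_simps)
      qed
    qed
    then show ?thesis by (simp add: Cauchy_convergent_iff convergent_LIMSEQ_iff)
  qed
  have eq: "lim (\<lambda>n. h (t n)) = lim (\<lambda>n. h (s n))" if t: "t \<in> null_rel A `` {s}" for t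
  proof -
    have st: "(s, t) \<in> null_rel A" using t by simp
    note S = null_relD[OF st]
    have "(\<lambda>n. dist (h (s n)) (h (t n))) \<longlonglongrightarrow> 0"
    proof (rule tendsto_sandwich[OF _ _ tendsto_const])
      show "\<forall>\<^sub>F n in sequentially. dist (h (s n)) (h (t n)) \<le> K * vdist A (s n) (t n)"
        using h cauchy_seqsD(1)[OF S(1)] cauchy_seqsD(1)[OF S(2)] by simp
      show "(\<lambda>n. K * vdist A (s n) (t n)) \<longlonglongrightarrow> 0" using tendsto_mult_left[OF S(3), of K] by simp
    qed simp
    moreover have "(\<lambda>n. dist (h (s n)) (h (t n))) \<longlonglongrightarrow> dist (lim (\<lambda>n. h (s n))) (lim (\<lambda>n. h (t n)))"
      by (intro tendsto_dist conv S)
    ultimately show ?thesis using LIMSEQ_unique by fastforce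
  qed
  have "s \<in> null_rel A `` {s}" using equiv_class_self[OF equiv_null_rel s] .
  then have "(\<lambda>s. lim (\<lambda>n. h (s n))) ` (null_rel A `` {s}) = {lim (\<lambda>n. h (s n))}"
    using eq by (blast intro: image_eqI)
  then show ?thesis using conv[OF s] by simp
qed

lemma completion_norm:
  assumes "s \<in> cauchy_seqs A"
  shows "(\<lambda>n. vnorm A (s n)) \<longlonglongrightarrow> vnorm (completion A) (null_rel A `` {s})"
  unfolding completion_def
  using lipschitz_limit_completion[of "vnorm A" 1, OF _ assms] abs_norm_diff_le_vdist
  by (simp add: dist_real_def)

text \<open>Each algebraic law holds termwise for representatives, and each norm inequality survives
  the limit.\<close>

lemma normed_calgebra_completion: "normed_calgebra (completion A)"
proof
  show "vcarrier (completion A) \<noteq> {}"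
    using carrier_ne cauchy_seqs_const completion_carrierI by blast
next
  fix x y assume "x \<in> vcarrier (completion A)" "y \<in> vcarrier (completion A)"
  then obtain s t where st: "s \<in> cauchy_seqs A" "x = null_rel A `` {s}" "t \<in> cauchy_seqs A" "y = null_rel A `` {t}"
    by (metis completion_carrierE)
  note C = cauchy_seqsD(1)[OF st(1)] cauchy_seqsD(1)[OF st(3)]
  note simps = st completion_add completion_mult completion_scale cauchy_seqs_add cauchy_seqs_mult
    cauchy_seqs_scale completion_carrierI C
  show "vadd (completion A) x y \<in> vcarrier (completion A)" by (simp add: simps)
  show "vmult (completion A) x y \<in> vcarrier (completion A)" by (simp add: simps)
  show "vadd (completion A) x y = vadd (completion A) y x"
    by (simp add: simps) (simp add: add_commute C)
  show "vadd (completion A) x (vscale (completion A) 0 y) = x"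
    by (simp add: simps) (simp add: add_zero C)
  show "vscale (completion A) c (vadd (completion A) x y) =
      vadd (completion A) (vscale (completion A) c x) (vscale (completion A) c y)" for c
    by (simp add: simps) (simp add: scale_add_right C)
  show "vmult (completion A) x (vscale (completion A) c y) = vscale (completion A) c (vmult (completion A) x y)" for c
    by (simp add: simps) (simp add: mult_scale_right C)
  show "vmult (completion A) (vscale (completion A) c x) y = vscale (completion A) c (vmult (completion A) x y)" for c
    by (simp add: simps) (simp add: mult_scale_left C)
  show "vnorm (completion A) (vadd (completion A) x y) \<le> vnorm (completion A) x + vnorm (completion A) y"
    unfolding st completion_add[OF st(1,3)]
    by (rule LIMSEQ_le[OF completion_norm[OF cauchy_seqs_add[OF st(1,3)]]
        tendsto_add[OF completion_norm[OF st(1)] completion_norm[OF st(3)]]])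
      (use norm_triangle C in auto)
  show "vnorm (completion A) (vmult (completion A) x y) \<le> vnorm (completion A) x * vnorm (completion A) y"
    unfolding st completion_mult[OF st(1,3)]
    by (rule LIMSEQ_le[OF completion_norm[OF cauchy_seqs_mult[OF st(1,3)]]
        tendsto_mult[OF completion_norm[OF st(1)] completion_norm[OF st(3)]]])
      (use norm_mult_le C in auto)
next
  fix x c assume "x \<in> vcarrier (completion A)"
  then obtain s where st: "s \<in> cauchy_seqs A" "x = null_rel A `` {s}" by (metis completion_carrierE)
  note C = cauchy_seqsD(1)[OF st(1)]
  note simps = st completion_add completion_scale cauchy_seqs_scale completion_carrierI C
  show "vscale (completion A) c x \<in> vcarrier (completion A)" by (simp add: simps)
  show "vscale (completion A) (c + d) x = vadd (completion A) (vscale (completion A) c x) (vscale (completion A) d x)" for d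
    by (simp add: simps) (simp add: scale_add_left C)
  show "vscale (completion A) c (vscale (completion A) d x) = vscale (completion A) (c * d) x" for d
    by (simp add: simps) (simp add: scale_scale C)
  show "vscale (completion A) 1 x = x"
    by (simp add: simps) (simp add: scale_one C)
  show "0 \<le> vnorm (completion A) x"
    unfolding st by (rule LIMSEQ_le_const[OF completion_norm[OF st(1)]]) (use C in auto)
  show "vnorm (completion A) (vscale (completion A) c x) \<le> cmod c * vnorm (completion A) x"
    unfolding st completion_scale[OF st(1)]
    by (rule LIMSEQ_le[OF completion_norm[OF cauchy_seqs_scale[OF st(1)]]
        tendsto_mult_left[OF completion_norm[OF st(1)]]])
      (use norm_scale_le C in auto)
next
  fix x y z assume "x \<in> vcarrier (completion A)" "y \<in> vcarrier (completion A)" "z \<in> vcarrier (completion A)"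
  then obtain r s t where st: "r \<in> cauchy_seqs A" "x = null_rel A `` {r}" 
    "s \<in> cauchy_seqs A" "y = null_rel A `` {s}" "t \<in> cauchy_seqs A" "z = null_rel A `` {t}"
    by (metis completion_carrierE)
  note C = cauchy_seqsD(1)[OF st(1)] cauchy_seqsD(1)[OF st(3)] cauchy_seqsD(1)[OF st(5)]
  note simps = st completion_add completion_mult cauchy_seqs_add cauchy_seqs_mult
  show "vadd (completion A) (vadd (completion A) x y) z = vadd (completion A) x (vadd (completion A) y z)"
    by (simp add: simps) (simp add: add_assoc C)
  show "vmult (completion A) x (vadd (completion A) y z) = vadd (completion A) (vmult (completion A) x y) (vmult (completion A) x z)"
    by (simp add: simps) (simp add: mult_add_right C)
  show "vmult (completion A) (vadd (completion A) x y) z = vadd (completion A) (vmult (completion A) x z) (vmult (completion A) y z)"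
    by (simp add: simps) (simp add: mult_add_left C)
qed

definition completion_embed :: "'a \<Rightarrow> (nat \<Rightarrow> 'a) set" where
  "completion_embed x = null_rel A `` {\<lambda>_. x}"

lemma completion_embed:
  assumes "x \<in> vcarrier A"
  shows "completion_embed x \<in> vcarrier (completion A)"
    and "vnorm (completion A) (completion_embed x) = vnorm A x"
    and "y \<in> vcarrier A \<Longrightarrow> vadd (completion A) (completion_embed x) (completion_embed y) = completion_embed (vadd A x y)"
    and "y \<in> vcarrier A \<Longrightarrow> vmult (completion A) (completion_embed x) (completion_embed y) = completion_embed (vmult A x y)"
    and "vscale (completion A) c (completion_embed x) = completion_embed (vscale A c x)"
  unfolding completion_embed_def
  using assms cauchy_seqs_const completion_norm[OF cauchy_seqs_const[OF assms]]
  by (auto simp: completion_carrierI completion_add completion_scale completion_mult intro: LIMSEQ_unique)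

section \<open>Functionals on a completion\<close>

lemma dual_lipschitz:
  assumes g: "g \<in> vcarrier (dual_space A)" and "x \<in> vcarrier A" "y \<in> vcarrier A"
  shows "dist (g x) (g y) \<le> vnorm (dual_space A) g * vdist A x y"
proof -
  have "g x - g y = g (vadd A x (vscale A (-1) y))"
    using assms dual_spaceD(2)[OF g] dual_spaceD(3)[OF g] by simp
  then show ?thesis unfolding dist_norm vdist_def using dual_norm_bound[OF g] assms by simp
qed

lemma extend_functional_completion:
  assumes g: "g \<in> vcarrier (dual_space A)"
  obtains f where "f \<in> vcarrier (dual_space (completion A))"
    "\<And>x. x \<in> vcarrier A \<Longrightarrow> f (completion_embed x) = g x"
proof -
  define f where "f = (\<lambda>X\<in>vcarrier (completion A). the_elem ((\<lambda>s. lim (\<lambda>n. g (s n))) ` X))"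
  have f: "(\<lambda>n. g (s n)) \<longlonglongrightarrow> f (null_rel A `` {s})" if s: "s \<in> cauchy_seqs A" for s
    using lipschitz_limit_completion[OF dual_lipschitz[OF g] s] completion_carrierI[OF s] by (simp add: f_def)
  have "f \<in> vcarrier (dual_space (completion A))"
  proof (rule dual_spaceI[where K="vnorm (dual_space A) g"])
    show "f \<in> extensional (vcarrier (completion A))" by (simp add: f_def)
  next
    fix x y assume "x \<in> vcarrier (completion A)" "y \<in> vcarrier (completion A)"
    then obtain s t where st: "s \<in> cauchy_seqs A" "x = null_rel A `` {s}" "t \<in> cauchy_seqs A" "y = null_rel A `` {t}"
      by (metis completion_carrierE)
    have "(\<lambda>n. g (vadd A (s n) (t n))) \<longlonglongrightarrow> f x + f y"
      using tendsto_add[OF f[OF st(1)] f[OF st(3)]] dual_spaceD(2)[OF g] cauchy_seqsD(1)[OF st(1)] cauchy_seqsD(1)[OF st(3)] st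
      by simp
    then show "f (vadd (completion A) x y) = f x + f y"
      using f[OF cauchy_seqs_add[OF st(1,3)]] st by (simp add: completion_add LIMSEQ_unique)
  next
    fix c x assume "x \<in> vcarrier (completion A)"
    then obtain s where st: "s \<in> cauchy_seqs A" "x = null_rel A `` {s}" by (metis completion_carrierE)
    have "(\<lambda>n. g (vscale A c (s n))) \<longlonglongrightarrow> c * f x"
      using tendsto_mult_left[OF f[OF st(1)], of c] dual_spaceD(3)[OF g] cauchy_seqsD(1)[OF st(1)] st
      by simp
    then show "f (vscale (completion A) c x) = c * f x"
      using f[OF cauchy_seqs_scale[OF st(1)]] st by (simp add: completion_scale) (blast intro: LIMSEQ_unique)
  next
    fix x assume "x \<in> vcarrier (completion A)"
    then obtain s where st: "s \<in> cauchy_seqs A" "x = null_rel A `` {s}" by (metis completion_carrierE)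
    show "cmod (f x) \<le> vnorm (dual_space A) g * vnorm (completion A) x"
      unfolding st
      by (rule LIMSEQ_le[OF tendsto_norm[OF f[OF st(1)]] tendsto_mult_left[OF completion_norm[OF st(1)]]])
        (use dual_norm_bound[OF g] cauchy_seqsD(1)[OF st(1)] in auto)
  qed
  moreover have "f (completion_embed x) = g x" if "x \<in> vcarrier A" for x
    using f[OF cauchy_seqs_const[OF that]] unfolding completion_embed_def
    by (metis LIMSEQ_unique tendsto_const)
  ultimately show ?thesis using that by blast
qed

text \<open>The embedded algebra is dense: X is approached by the terms of a sequence that
  represents it, and f is Lipschitz.\<close>

lemma functional_zero_completion:
  assumes f: "f \<in> vcarrier (dual_space (completion A))"
    and zero: "\<And>x. x \<in> vcarrier A \<Longrightarrow> f (completion_embed x) = 0" and X: "X \<in> vcarrier (completion A)"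
  shows "f X = 0"
proof -
  interpret C: normed_calgebra "completion A" by (rule normed_calgebra_completion)
  obtain s where s: "s \<in> cauchy_seqs A" "X = null_rel A `` {s}" using X by (metis completion_carrierE)
  note S = cauchy_seqsD[OF s(1)]
  \<comment> \<open>The distance from X to an embedded term is a limit of distances between terms,
    so the Cauchy condition makes it small.\<close>
  have vd: "(\<lambda>m. vdist A (s m) (s n)) \<longlonglongrightarrow> vdist (completion A) X (completion_embed (s n))" for n
    using completion_norm[OF cauchy_seqs_add[OF s(1) cauchy_seqs_const[OF scale_closed[OF S(1)]]], of "-1" n]
    by (simp add: vdist_def s(2) completion_embed_def completion_add completion_scale s(1) cauchy_seqs_const S(1))
  define L where "L = vnorm (dual_space (completion A)) f"
  have "cmod (f X) \<le> e" if e: "e > 0" for e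
  proof -
    have L: "0 \<le> L" unfolding L_def by (rule C.dual_norm_nonneg[OF f])
    \<comment> \<open>The denominator \<open>L + 1\<close> also covers a functional of norm
      0.\<close>
    obtain N where N: "\<forall>m\<ge>N. \<forall>n\<ge>N. vdist A (s m) (s n) < e / (L + 1)"
      using S(2)[of "e / (L + 1)"] e L by auto
    have "vdist (completion A) X (completion_embed (s N)) \<le> e / (L + 1)"
      by (rule LIMSEQ_le_const2[OF vd]) (use N less_imp_le in blast)
    moreover have "cmod (f X) \<le> L * vdist (completion A) X (completion_embed (s N))"
      using C.dual_lipschitz[OF f X completion_embed(1)[OF S(1)], of N] zero[OF S(1)] by (simp add: L_def)
    ultimately have "cmod (f X) \<le> L * (e / (L + 1))" using L mult_left_mono order_trans by blast
    also have "\<dots> \<le> e" using L e by (simp add: field_simps)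
    finally show ?thesis .
  qed
  then have "cmod (f X) \<le> 0" by (rule field_le_epsilon) simp
  then show ?thesis by simp
qed

end

section \<open>The projective tensor product\<close>

locale calgebra_pair = A: normed_calgebra A + B: normed_calgebra B
  for A :: "('a, 'r) calgebra_scheme" and B :: "('b, 's) calgebra_scheme"
begin

abbreviation "FS \<equiv> formal_sums A B"
abbreviation "TR \<equiv> tensor_rel A B"
abbreviation "AT \<equiv> algebraic_tensor A B"

lemma formal_sums_simps [simp]:
  "[] \<in> FS" "u # us \<in> FS \<longleftrightarrow> fst u \<in> vcarrier A \<and> snd u \<in> vcarrier B \<and> us \<in> FS"
  "us @ vs \<in> FS \<longleftrightarrow> us \<in> FS \<and> vs \<in> FS"
  by (auto simp: formal_sums_def mem_Times_iff)

lemma formal_sums_mset: "mset us = mset vs \<Longrightarrow> us \<in> FS \<longleftrightarrow> vs \<in> FS"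
  unfolding formal_sums_def by (metis in_lists_conv_set set_mset_mset)

lemma tensor_rel_formal_sums: "(us, vs) \<in> TR \<Longrightarrow> us \<in> FS \<and> vs \<in> FS"
proof (induction rule: tensor_rel.induct)
  case (perm us vs)
  then show ?case using formal_sums_mset by blast
qed auto

lemma equiv_tensor_rel: "equiv FS TR"
proof (rule equivI)
  show "TR \<subseteq> FS \<times> FS" using tensor_rel_formal_sums by auto
  show "refl_on FS TR" by (auto simp: refl_on_def intro: tensor_rel.perm)
  show "sym TR" by (rule symI) (rule tensor_rel.sym)
  show "trans TR" by (rule transI) (rule tensor_rel.trans)
qed

lemma tensor_rel_refl: "us \<in> FS \<Longrightarrow> (us, us) \<in> TR"
  by (rule tensor_rel.perm) auto

lemma tensor_rel_append:
  assumes "(us, us') \<in> TR" "(vs, vs') \<in> TR"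
  shows "(us @ vs, us' @ vs') \<in> TR"
proof -
  have FS: "us \<in> FS" "us' \<in> FS" "vs \<in> FS" "vs' \<in> FS" using assms tensor_rel_formal_sums by auto
  have "(us @ vs, us' @ vs) \<in> TR" by (rule tensor_rel.append[OF assms(1) FS(3)])
  moreover have "(us' @ vs, vs @ us') \<in> TR" "(vs' @ us', us' @ vs') \<in> TR"
    using FS by (auto intro: tensor_rel.perm)
  moreover have "(vs @ us', vs' @ us') \<in> TR" by (rule tensor_rel.append[OF assms(2) FS(2)])
  ultimately show ?thesis by (meson tensor_rel.trans)
qed

lemma formal_sums_map:
  assumes "\<And>x. x \<in> vcarrier A \<Longrightarrow> \<phi> x \<in> vcarrier A" "\<And>y. y \<in> vcarrier B \<Longrightarrow> \<psi> y \<in> vcarrier B" "us \<in> FS"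
  shows "map (map_prod \<phi> \<psi>) us \<in> FS"
  using assms(3) by (induction us) (auto simp: assms(1,2))

text \<open>The map \<phi> \<otimes> \<psi> is well defined on tensors. Multiplication by a fixed
  elementary tensor, from either side, and scaling are all of this kind.\<close>

lemma tensor_rel_map:
  assumes \<phi>: "\<And>x. x \<in> vcarrier A \<Longrightarrow> \<phi> x \<in> vcarrier A"
    "\<And>x y. x \<in> vcarrier A \<Longrightarrow> y \<in> vcarrier A \<Longrightarrow> \<phi> (vadd A x y) = vadd A (\<phi> x) (\<phi> y)"
    "\<And>c x. x \<in> vcarrier A \<Longrightarrow> \<phi> (vscale A c x) = vscale A c (\<phi> x)"
    and \<psi>: "\<And>x. x \<in> vcarrier B \<Longrightarrow> \<psi> x \<in> vcarrier B"
    "\<And>x y. x \<in> vcarrier B \<Longrightarrow> y \<in> vcarrier B \<Longrightarrow> \<psi> (vadd B x y) = vadd B (\<psi> x) (\<psi> y)"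
    "\<And>c x. x \<in> vcarrier B \<Longrightarrow> \<psi> (vscale B c x) = vscale B c (\<psi> x)"
    and rel: "(us, vs) \<in> TR"
  shows "(map (map_prod \<phi> \<psi>) us, map (map_prod \<phi> \<psi>) vs) \<in> TR"
  using rel
proof (induction rule: tensor_rel.induct)
  case (perm us vs)
  then show ?case by (intro tensor_rel.perm formal_sums_map \<phi>(1) \<psi>(1)) auto
next
  case (append us vs ws)
  then show ?case
    using tensor_rel.append[OF append.IH formal_sums_map[OF \<phi>(1) \<psi>(1) append.hyps(2)]] by simp
next
  case (sym us vs)
  show ?case by (rule tensor_rel.sym[OF sym.IH])
next
  case (trans us vs ws)
  show ?case by (rule tensor_rel.trans[OF trans.IH])
next
  case (add_left x x' y)
  then show ?case using \<phi> \<psi> by (simp add: tensor_rel.add_left)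
next
  case (add_right x y y')
  then show ?case using \<phi> \<psi> by (simp add: tensor_rel.add_right)
next
  case (scale x y c)
  then show ?case using \<phi> \<psi> by (simp add: tensor_rel.scale)
next
  case (zero x y)
  then show ?case using \<phi> \<psi> by (simp add: tensor_rel.zero)
qed

definition tmult :: "('a \<times> 'b) list \<Rightarrow> ('a \<times> 'b) list \<Rightarrow> ('a \<times> 'b) list" where
  "tmult us vs = map (\<lambda>((a, b), (c, d)). (vmult A a c, vmult B b d)) (List.product us vs)"

lemma tmult_Nil [simp]: "tmult [] vs = []" "tmult us [] = []"
  by (simp_all add: tmult_def product_concat_map)

lemma tmult_Cons: "tmult (u # us) vs = map (map_prod (vmult A (fst u)) (vmult B (snd u))) vs @ tmult us vs"
  by (auto simp: tmult_def split: prod.splits)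

text \<open>\<open>List.product\<close> lists the pairs row by row, so a new right factor inserts a
  column; the two lists agree only up to order, which the congruence ignores.\<close>

lemma mset_tmult_Cons_right:
  "mset (tmult us (v # vs)) =
    mset (map (map_prod (\<lambda>a. vmult A a (fst v)) (\<lambda>b. vmult B b (snd v))) us @ tmult us vs)"
  by (induction us) (auto simp: tmult_Cons map_prod_def split: prod.splits)

lemma mset_tmult_append_right: "mset (tmult us (vs @ ws)) = mset (tmult us vs @ tmult us ws)"
  by (induction us) (auto simp: tmult_Cons)

lemma tmult_append_left: "tmult (us @ vs) ws = tmult us ws @ tmult vs ws"
  by (induction us) (auto simp: tmult_Cons)

lemma tmult_closed: "us \<in> FS \<Longrightarrow> vs \<in> FS \<Longrightarrow> tmult us vs \<in> FS"
  by (induction us) (auto simp: tmult_Cons intro!: formal_sums_map)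

lemma tensor_rel_tmult_right:
  assumes "us \<in> FS" "(vs, vs') \<in> TR"
  shows "(tmult us vs, tmult us vs') \<in> TR"
  using assms(1)
proof (induction us)
  case Nil
  then show ?case by (simp add: tensor_rel_refl)
next
  case (Cons u us)
  then have "(map (map_prod (vmult A (fst u)) (vmult B (snd u))) vs, map (map_prod (vmult A (fst u)) (vmult B (snd u))) vs') \<in> TR"
    by (intro tensor_rel_map assms) (auto simp: A.mult_add_right B.mult_add_right A.mult_scale_right B.mult_scale_right)
  with Cons show ?case by (simp add: tmult_Cons tensor_rel_append)
qed

lemma tensor_rel_tmult_left:
  assumes "vs \<in> FS" "(us, us') \<in> TR"
  shows "(tmult us vs, tmult us' vs) \<in> TR"
  using assms(1)
proof (induction vs)
  case Nil
  then show ?case by (simp add: tensor_rel_refl)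
next
  case (Cons v vs)
  let ?m = "map (map_prod (\<lambda>a. vmult A a (fst v)) (\<lambda>b. vmult B b (snd v)))"
  have FS: "us \<in> FS" "us' \<in> FS" using assms tensor_rel_formal_sums by auto
  have "(?m us, ?m us') \<in> TR"
    using Cons by (intro tensor_rel_map assms) (auto simp: A.mult_add_left B.mult_add_left A.mult_scale_left B.mult_scale_left)
  then have "(?m us @ tmult us vs, ?m us' @ tmult us' vs) \<in> TR"
    using Cons by (simp add: tensor_rel_append)
  moreover have "(tmult us (v # vs), ?m us @ tmult us vs) \<in> TR" "(?m us' @ tmult us' vs, tmult us' (v # vs)) \<in> TR"
    using Cons.prems FS tmult_closed[of us "v # vs"] tmult_closed[of us' "v # vs"]
    by (intro tensor_rel.perm tensor_rel.sym[OF tensor_rel.perm] mset_tmult_Cons_right; simp)+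
  ultimately show ?case by (meson tensor_rel.trans)
qed

definition tscale :: "complex \<Rightarrow> ('a \<times> 'b) list \<Rightarrow> ('a \<times> 'b) list" where
  "tscale c us = map (map_prod (vscale A c) id) us"

lemma tscale_simps [simp]:
  "tscale c [] = []" "tscale c (u # us) = (vscale A c (fst u), snd u) # tscale c us"
  "tscale c (us @ vs) = tscale c us @ tscale c vs"
  by (auto simp: tscale_def map_prod_def split: prod.splits)

lemma tscale_closed: "us \<in> FS \<Longrightarrow> tscale c us \<in> FS"
  unfolding tscale_def by (rule formal_sums_map) auto

lemma tensor_rel_tscale:
  assumes "(us, vs) \<in> TR"
  shows "(tscale c us, tscale c vs) \<in> TR"
  unfolding tscale_def
  by (rule tensor_rel_map[OF _ _ _ _ _ _ assms]) (auto simp: A.scale_add_right A.scale_scale mult.commute)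

definition tcost :: "('a \<times> 'b) list \<Rightarrow> real" where
  "tcost us = (\<Sum>(x, y)\<leftarrow>us. vnorm A x * vnorm B y)"

lemma tcost_simps [simp]:
  "tcost [] = 0" "tcost (u # us) = vnorm A (fst u) * vnorm B (snd u) + tcost us"
  "tcost (us @ vs) = tcost us + tcost vs"
  by (auto simp: tcost_def split: prod.splits)

lemma tcost_nonneg: "us \<in> FS \<Longrightarrow> 0 \<le> tcost us"
  by (induction us) auto

lemma tcost_tscale: "us \<in> FS \<Longrightarrow> tcost (tscale c us) = cmod c * tcost us"
  by (induction us) (auto simp: A.norm_scale algebra_simps)

lemma tcost_map_mult:
  "x \<in> vcarrier A \<Longrightarrow> y \<in> vcarrier B \<Longrightarrow> us \<in> FS \<Longrightarrow>
    tcost (map (map_prod (vmult A x) (vmult B y)) us) \<le> vnorm A x * vnorm B y * tcost us"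
proof (induction us)
  case (Cons u us)
  have "vnorm A (vmult A x (fst u)) * vnorm B (vmult B y (snd u)) \<le>
    (vnorm A x * vnorm A (fst u)) * (vnorm B y * vnorm B (snd u))"
    using Cons.prems by (intro mult_mono A.norm_mult_le B.norm_mult_le) auto
  then show ?case using Cons by (simp add: algebra_simps)
qed simp

lemma tcost_tmult: "us \<in> FS \<Longrightarrow> vs \<in> FS \<Longrightarrow> tcost (tmult us vs) \<le> tcost us * tcost vs"
proof (induction us)
  case (Cons u us)
  then show ?case using tcost_map_mult[of "fst u" "snd u" vs] by (simp add: tmult_Cons algebra_simps)
qed simp

definition tcls :: "('a \<times> 'b) list \<Rightarrow> ('a \<times> 'b) list set" where
  "tcls us = TR `` {us}"

lemma algebraic_tensor_carrierI: "us \<in> FS \<Longrightarrow> tcls us \<in> vcarrier AT"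
  by (simp add: algebraic_tensor_def tcls_def quotientI)

lemma algebraic_tensor_carrierE:
  assumes "U \<in> vcarrier AT"
  obtains us where "us \<in> FS" "U = tcls us"
  using assms by (auto simp: algebraic_tensor_def tcls_def elim: quotientE)

lemma tcls_eqI: "(us, vs) \<in> TR \<Longrightarrow> tcls us = tcls vs"
  unfolding tcls_def by (rule equiv_class_eq[OF equiv_tensor_rel])

lemma tcls_perm: "us \<in> FS \<Longrightarrow> mset us = mset vs \<Longrightarrow> tcls us = tcls vs"
  by (intro tcls_eqI tensor_rel.perm)

lemma algebraic_tensor_add:
  assumes "us \<in> FS" "vs \<in> FS"
  shows "vadd AT (tcls us) (tcls vs) = tcls (us @ vs)"
proof -
  have "congruent2 TR TR (\<lambda>us vs. TR `` {us @ vs})"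
    by (rule congruent2I') (rule equiv_class_eq[OF equiv_tensor_rel tensor_rel_append])
  from UN_equiv_class2[OF equiv_tensor_rel equiv_tensor_rel this assms] show ?thesis
    by (simp add: algebraic_tensor_def tcls_def)
qed

lemma algebraic_tensor_scale:
  assumes "us \<in> FS"
  shows "vscale AT c (tcls us) = tcls (tscale c us)"
proof -
  have eq: "map (\<lambda>(x, y). (vscale A c x, y)) us = tscale c us" for us
    by (auto simp: tscale_def)
  have "(\<lambda>us. TR `` {tscale c us}) respects TR"
    by (rule congruentI) (rule equiv_class_eq[OF equiv_tensor_rel tensor_rel_tscale])
  from UN_equiv_class[OF equiv_tensor_rel this assms] show ?thesis
    by (simp add: algebraic_tensor_def tcls_def eq)
qed

lemma algebraic_tensor_mult:
  assumes "us \<in> FS" "vs \<in> FS"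
  shows "vmult AT (tcls us) (tcls vs) = tcls (tmult us vs)"
proof -
  have "congruent2 TR TR (\<lambda>us vs. TR `` {tmult us vs})"
  proof (rule congruent2I')
    fix us us' vs vs' assume *: "(us, us') \<in> TR" "(vs, vs') \<in> TR"
    then have "(tmult us vs, tmult us' vs') \<in> TR"
      using tensor_rel_tmult_left tensor_rel_tmult_right tensor_rel_formal_sums by (meson tensor_rel.trans)
    then show "TR `` {tmult us vs} = TR `` {tmult us' vs'}" by (rule equiv_class_eq[OF equiv_tensor_rel])
  qed
  from UN_equiv_class2[OF equiv_tensor_rel equiv_tensor_rel this assms] show ?thesis
    by (simp add: algebraic_tensor_def tcls_def tmult_def)
qed

lemma algebraic_tensor_norm: "vnorm AT U = (INF us\<in>U. tcost us)"
  by (simp add: algebraic_tensor_def tcost_def)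

lemma tcls_subset: "tcls us \<subseteq> FS"
  using tensor_rel_formal_sums by (auto simp: tcls_def)

lemma tcls_self: "us \<in> FS \<Longrightarrow> us \<in> tcls us"
  by (simp add: tcls_def tensor_rel_refl)

lemma algebraic_tensor_norm_le:
  assumes "us \<in> FS"
  shows "vnorm AT (tcls us) \<le> tcost us"
proof -
  have "bdd_below (tcost ` tcls us)"
    by (rule bdd_belowI2[of _ 0]) (use tcls_subset tcost_nonneg in blast)
  then show ?thesis unfolding algebraic_tensor_norm using tcls_self[OF assms] by (rule cINF_lower)
qed

lemma le_algebraic_tensor_norm:
  assumes "us \<in> FS" "\<And>vs. (us, vs) \<in> TR \<Longrightarrow> z \<le> tcost vs"
  shows "z \<le> vnorm AT (tcls us)"
  unfolding algebraic_tensor_norm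
  by (rule cINF_greatest) (use tcls_self[OF assms(1)] assms(2) in \<open>auto simp: tcls_def\<close>)

lemma algebraic_tensor_norm_nonneg: "us \<in> FS \<Longrightarrow> 0 \<le> vnorm AT (tcls us)"
  by (rule le_algebraic_tensor_norm) (use tensor_rel_formal_sums tcost_nonneg in auto)

text \<open>Moves the infimum past the factor K by division. For K = 0 a single representation
  already gives the claim.\<close>

lemma le_mult_algebraic_tensor_norm:
  assumes us: "us \<in> FS" and "0 \<le> K" and le: "\<And>vs. (us, vs) \<in> TR \<Longrightarrow> z \<le> K * tcost vs"
  shows "z \<le> K * vnorm AT (tcls us)"
proof (cases "K = 0")
  case True
  then show ?thesis using le[OF tensor_rel_refl[OF us]] by simp
next
  case False
  then have K: "K > 0" using assms by simp
  have "z / K \<le> vnorm AT (tcls us)"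
    by (rule le_algebraic_tensor_norm[OF us]) (use K le in \<open>simp add: field_simps\<close>)
  then show ?thesis using K by (simp add: field_simps)
qed

lemma tscale_add: "us \<in> FS \<Longrightarrow> (tscale (c + d) us, tscale c us @ tscale d us) \<in> TR"
proof (induction us)
  case Nil
  then show ?case by (simp add: tensor_rel_refl)
next
  case (Cons u us)
  let ?x = "fst u" and ?y = "snd u"
  have "([(vscale A (c + d) ?x, ?y)], [(vscale A c ?x, ?y), (vscale A d ?x, ?y)]) \<in> TR"
    using Cons by (auto simp: A.scale_add_left intro: tensor_rel.add_left)
  then have "([(vscale A (c + d) ?x, ?y)] @ tscale (c + d) us,
      [(vscale A c ?x, ?y), (vscale A d ?x, ?y)] @ tscale c us @ tscale d us) \<in> TR"
    using Cons by (intro tensor_rel_append) auto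
  moreover have "([(vscale A c ?x, ?y), (vscale A d ?x, ?y)] @ tscale c us @ tscale d us,
      tscale c (u # us) @ tscale d (u # us)) \<in> TR"
    using Cons by (intro tensor_rel.perm) (auto simp: tscale_closed)
  ultimately show ?case using tensor_rel.trans by fastforce
qed

lemma tscale_zero: "us \<in> FS \<Longrightarrow> (tscale 0 us, []) \<in> TR"
proof (induction us)
  case Nil
  then show ?case by (simp add: tensor_rel_refl)
next
  case (Cons u us)
  have "([(vscale A 0 (fst u), snd u)] @ tscale 0 us, [] @ []) \<in> TR"
    using Cons by (intro tensor_rel_append tensor_rel.zero) auto
  then show ?case by simp
qed

lemma tmult_tscale:
  assumes "us \<in> FS" "vs \<in> FS"
  shows "tmult us (tscale c vs) = tscale c (tmult us vs)" "tmult (tscale c us) vs = tscale c (tmult us vs)"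
proof -
  have 1: "map (map_prod (vmult A x) (vmult B y)) (tscale c vs) = tscale c (map (map_prod (vmult A x) (vmult B y)) vs)"
    "map (map_prod (vmult A (vscale A c x)) (vmult B y)) vs = tscale c (map (map_prod (vmult A x) (vmult B y)) vs)"
    if "x \<in> vcarrier A" for x y
    using that assms(2) by (induction vs) (auto simp: A.mult_scale_right A.mult_scale_left)
  show "tmult us (tscale c vs) = tscale c (tmult us vs)" "tmult (tscale c us) vs = tscale c (tmult us vs)"
    using assms(1) by (induction us) (auto simp: tmult_Cons 1)
qed

lemma normed_calgebra_algebraic_tensor: "normed_calgebra AT"
proof
  show "vcarrier AT \<noteq> {}" using algebraic_tensor_carrierI formal_sums_simps(1) by blast
next
  fix x y assume "x \<in> vcarrier AT" "y \<in> vcarrier AT"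
  then obtain us vs where uv: "us \<in> FS" "x = tcls us" "vs \<in> FS" "y = tcls vs"
    by (metis algebraic_tensor_carrierE)
  note simps = uv algebraic_tensor_add algebraic_tensor_mult algebraic_tensor_scale
    algebraic_tensor_carrierI tmult_closed tscale_closed
  show "vadd AT x y \<in> vcarrier AT" by (simp add: simps)
  show "vmult AT x y \<in> vcarrier AT" by (simp add: simps)
  show "vadd AT x y = vadd AT y x"
    by (simp add: simps) (rule tcls_perm, use uv in auto)
  have "(us @ tscale 0 vs, us @ []) \<in> TR"
    by (intro tensor_rel_append tensor_rel_refl tscale_zero uv)
  then show "vadd AT x (vscale AT 0 y) = x"
    by (simp add: simps tcls_eqI)
  show "vscale AT c (vadd AT x y) = vadd AT (vscale AT c x) (vscale AT c y)" for c
    by (simp add: simps)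
  show "vmult AT x (vscale AT c y) = vscale AT c (vmult AT x y)" for c
    by (simp add: simps tmult_tscale)
  show "vmult AT (vscale AT c x) y = vscale AT c (vmult AT x y)" for c
    by (simp add: simps tmult_tscale)
  \<comment> \<open>The two infima are taken one after the other: over \<open>vs'\<close> with
    \<open>us'\<close> fixed, then over \<open>us'\<close>. The product is treated in the same
    way.\<close>
  have le: "vnorm AT (tcls (us @ vs)) \<le> tcost us' + tcost vs'" if "(us, us') \<in> TR" "(vs, vs') \<in> TR" for us' vs'
    using algebraic_tensor_norm_le[of "us' @ vs'"] tcls_eqI[OF tensor_rel_append[OF that]]
      that[THEN tensor_rel_formal_sums] by simp
  have "vnorm AT (tcls (us @ vs)) - tcost us' \<le> vnorm AT (tcls vs)" if "(us, us') \<in> TR" for us'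
    by (rule le_algebraic_tensor_norm) (use uv le[OF that] in \<open>auto simp: algebra_simps\<close>)
  then have "vnorm AT (tcls (us @ vs)) - vnorm AT (tcls vs) \<le> vnorm AT (tcls us)"
    using uv by (intro le_algebraic_tensor_norm) (auto simp: algebra_simps)
  then show "vnorm AT (vadd AT x y) \<le> vnorm AT x + vnorm AT y" by (simp add: simps)
  have le: "vnorm AT (tcls (tmult us vs)) \<le> tcost us' * tcost vs'" if r: "(us, us') \<in> TR" "(vs, vs') \<in> TR" for us' vs'
  proof -
    have FS: "us' \<in> FS" "vs' \<in> FS" using r[THEN tensor_rel_formal_sums] by auto
    have "(tmult us vs, tmult us' vs') \<in> TR"
      using r FS uv tensor_rel_tmult_left tensor_rel_tmult_right by (meson tensor_rel.trans)
    then have "vnorm AT (tcls (tmult us vs)) \<le> tcost (tmult us' vs')"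
      using algebraic_tensor_norm_le[OF tmult_closed[OF FS]] by (simp add: tcls_eqI)
    then show ?thesis using tcost_tmult[OF FS] by linarith
  qed
  have "vnorm AT (tcls (tmult us vs)) \<le> tcost us' * vnorm AT (tcls vs)" if "(us, us') \<in> TR" for us'
    by (rule le_mult_algebraic_tensor_norm)
      (use uv le[OF that] tcost_nonneg tensor_rel_formal_sums[OF that] in auto)
  then have "vnorm AT (tcls (tmult us vs)) \<le> vnorm AT (tcls vs) * vnorm AT (tcls us)"
    by (intro le_mult_algebraic_tensor_norm) (use uv algebraic_tensor_norm_nonneg in \<open>auto simp: mult.commute\<close>)
  then show "vnorm AT (vmult AT x y) \<le> vnorm AT x * vnorm AT y"
    by (simp add: simps mult.commute)
next
  fix x c assume "x \<in> vcarrier AT"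
  then obtain us where uv: "us \<in> FS" "x = tcls us" by (metis algebraic_tensor_carrierE)
  note simps = uv algebraic_tensor_add algebraic_tensor_scale algebraic_tensor_carrierI tscale_closed
  show "vscale AT c x \<in> vcarrier AT" by (simp add: simps)
  show "vscale AT (c + d) x = vadd AT (vscale AT c x) (vscale AT d x)" for d
    by (simp add: simps tcls_eqI tscale_add)
  have "tscale c (tscale d us) = tscale (c * d) us" for d
    using uv(1) by (induction us) (auto simp: A.scale_scale)
  then show "vscale AT c (vscale AT d x) = vscale AT (c * d) x" for d by (simp add: simps)
  have "tscale 1 us = us" using uv(1) by (induction us) (auto simp: A.scale_one)
  then show "vscale AT 1 x = x" by (simp add: simps)
  show "0 \<le> vnorm AT x" using uv algebraic_tensor_norm_nonneg by simp
  have "vnorm AT (tcls (tscale c us)) \<le> cmod c * vnorm AT (tcls us)"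
  proof (rule le_mult_algebraic_tensor_norm[OF uv(1)])
    fix vs assume r: "(us, vs) \<in> TR"
    then have vs: "vs \<in> FS" using tensor_rel_formal_sums by simp
    show "vnorm AT (tcls (tscale c us)) \<le> cmod c * tcost vs"
      using algebraic_tensor_norm_le[OF tscale_closed[OF vs], of c] tcost_tscale[OF vs, of c]
        tcls_eqI[OF tensor_rel_tscale[OF r], of c] by simp
  qed simp
  then show "vnorm AT (vscale AT c x) \<le> cmod c * vnorm AT x" by (simp add: simps)
next
  fix x y z assume "x \<in> vcarrier AT" "y \<in> vcarrier AT" "z \<in> vcarrier AT"
  then obtain us vs ws where uv: "us \<in> FS" "x = tcls us" "vs \<in> FS" "y = tcls vs" "ws \<in> FS" "z = tcls ws"
    by (metis algebraic_tensor_carrierE)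
  note simps = uv algebraic_tensor_add algebraic_tensor_mult tmult_closed
  show "vadd AT (vadd AT x y) z = vadd AT x (vadd AT y z)" by (simp add: simps)
  show "vmult AT x (vadd AT y z) = vadd AT (vmult AT x y) (vmult AT x z)"
    by (simp add: simps) (rule tcls_perm, use uv mset_tmult_append_right in \<open>auto simp: tmult_closed\<close>)
  show "vmult AT (vadd AT x y) z = vadd AT (vmult AT x z) (vmult AT y z)"
    by (simp add: simps tmult_append_left)
qed

section \<open>Bilinear forms and functionals on the projective tensor product\<close>

definition bounded_bilinear_form :: "('a \<Rightarrow> 'b \<Rightarrow> complex) \<Rightarrow> real \<Rightarrow> bool" where
  "bounded_bilinear_form u K \<longleftrightarrow> 0 \<le> K \<and>
    (\<forall>x\<in>vcarrier A. \<forall>x'\<in>vcarrier A. \<forall>y\<in>vcarrier B. u (vadd A x x') y = u x y + u x' y) \<and>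
    (\<forall>x\<in>vcarrier A. \<forall>y\<in>vcarrier B. \<forall>y'\<in>vcarrier B. u x (vadd B y y') = u x y + u x y') \<and>
    (\<forall>c. \<forall>x\<in>vcarrier A. \<forall>y\<in>vcarrier B. u (vscale A c x) y = c * u x y \<and> u x (vscale B c y) = c * u x y) \<and>
    (\<forall>x\<in>vcarrier A. \<forall>y\<in>vcarrier B. cmod (u x y) \<le> K * (vnorm A x * vnorm B y))"

text \<open>The universal property of the tensor product: summing u over a formal sum is invariant
  under every generator of the congruence, and the bound \<open>K * tcost us\<close>, valid for each
  representation, passes to the infimum.\<close>

lemma functional_of_bilinear:
  assumes "bounded_bilinear_form u K"
  obtains g where "g \<in> vcarrier (dual_space AT)"
    "\<And>x y. x \<in> vcarrier A \<Longrightarrow> y \<in> vcarrier B \<Longrightarrow> g (tcls [(x, y)]) = u x y"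
proof -
  have add: "\<And>x x' y. x \<in> vcarrier A \<Longrightarrow> x' \<in> vcarrier A \<Longrightarrow> y \<in> vcarrier B \<Longrightarrow> u (vadd A x x') y = u x y + u x' y"
    "\<And>x y y'. x \<in> vcarrier A \<Longrightarrow> y \<in> vcarrier B \<Longrightarrow> y' \<in> vcarrier B \<Longrightarrow> u x (vadd B y y') = u x y + u x y'"
    and scale: "\<And>c x y. x \<in> vcarrier A \<Longrightarrow> y \<in> vcarrier B \<Longrightarrow> u (vscale A c x) y = c * u x y"
    "\<And>c x y. x \<in> vcarrier A \<Longrightarrow> y \<in> vcarrier B \<Longrightarrow> u x (vscale B c y) = c * u x y"
    and bound: "\<And>x y. x \<in> vcarrier A \<Longrightarrow> y \<in> vcarrier B \<Longrightarrow> cmod (u x y) \<le> K * (vnorm A x * vnorm B y)"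
    and "0 \<le> K"
    using assms unfolding bounded_bilinear_form_def by blast+
  define S where "S = (\<lambda>us. \<Sum>(x, y)\<leftarrow>us. u x y)"
  have S [simp]: "S [] = 0" "\<And>x us. S (x # us) = u (fst x) (snd x) + S us" "\<And>us vs. S (us @ vs) = S us + S vs"
    by (auto simp: S_def split: prod.splits)
  have perm: "S us = S vs" if "mset us = mset vs" for us vs
    unfolding S_def by (metis that mset_map sum_mset_sum_list)
  have rel: "S us = S vs" if "(us, vs) \<in> TR" for us vs
    using that
  proof (induction rule: tensor_rel.induct)
    case (perm us vs)
    then show ?case by (intro \<open>\<And>us vs. mset us = mset vs \<Longrightarrow> S us = S vs\<close>)
  qed (simp_all add: add scale)
  have Sscale: "S (tscale c us) = c * S us" if "us \<in> FS" for us c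
    using that by (induction us) (auto simp: scale algebra_simps)
  have Sbound: "cmod (S us) \<le> K * tcost us" if "us \<in> FS" for us
    using that
  proof (induction us)
    case (Cons x us)
    then show ?case using bound[of "fst x" "snd x"] norm_triangle_ineq[of "u (fst x) (snd x)" "S us"]
      by (simp add: algebra_simps)
  qed simp
  define g where "g = (\<lambda>U\<in>vcarrier AT. the_elem (S ` U))"
  have g: "g (tcls us) = S us" if us: "us \<in> FS" for us
  proof -
    have "S us' = S us" if "us' \<in> tcls us" for us' using rel[of us us'] that by (simp add: tcls_def)
    then have "S ` tcls us = {S us}" using tcls_self[OF us] by (blast intro: image_eqI)
    then show ?thesis using algebraic_tensor_carrierI[OF us] by (simp add: g_def)
  qed
  have "g \<in> vcarrier (dual_space AT)"
  proof (rule dual_spaceI[where K=K])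
    show "g \<in> extensional (vcarrier AT)" by (simp add: g_def)
  next
    fix x y assume "x \<in> vcarrier AT" "y \<in> vcarrier AT"
    then obtain us vs where "us \<in> FS" "x = tcls us" "vs \<in> FS" "y = tcls vs"
      by (metis algebraic_tensor_carrierE)
    then show "g (vadd AT x y) = g x + g y" by (simp add: algebraic_tensor_add g)
  next
    fix c x assume "x \<in> vcarrier AT"
    then obtain us where us: "us \<in> FS" "x = tcls us" by (metis algebraic_tensor_carrierE)
    then show "g (vscale AT c x) = c * g x" by (simp add: algebraic_tensor_scale g tscale_closed Sscale)
    show "cmod (g x) \<le> K * vnorm AT x"
      unfolding us(2) g[OF us(1)]
    proof (rule le_mult_algebraic_tensor_norm[OF us(1) \<open>0 \<le> K\<close>])
      fix vs assume "(us, vs) \<in> TR"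
      then show "cmod (S us) \<le> K * tcost vs" using rel Sbound tensor_rel_formal_sums by metis
    qed
  qed
  then show ?thesis using that g by simp
qed

lemma normed_calgebra_projective_tensor: "normed_calgebra (projective_tensor A B)"
  unfolding projective_tensor_def
  by (rule normed_calgebra.normed_calgebra_completion[OF normed_calgebra_algebraic_tensor])

definition elementary_tensor :: "'a \<Rightarrow> 'b \<Rightarrow> (nat \<Rightarrow> ('a \<times> 'b) list set) set" where
  "elementary_tensor x y = normed_calgebra.completion_embed AT (tcls [(x, y)])"

lemma elementary_tensor:
  assumes "x \<in> vcarrier A" "y \<in> vcarrier B"
  shows "elementary_tensor x y \<in> vcarrier (projective_tensor A B)"
    and "vnorm (projective_tensor A B) (elementary_tensor x y) \<le> vnorm A x * vnorm B y"
    and "x' \<in> vcarrier A \<Longrightarrow> y' \<in> vcarrier B \<Longrightarrow>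
      vmult (projective_tensor A B) (elementary_tensor x y) (elementary_tensor x' y') =
      elementary_tensor (vmult A x x') (vmult B y y')"
proof -
  interpret T: normed_calgebra AT by (rule normed_calgebra_algebraic_tensor)
  have c: "tcls [(x, y)] \<in> vcarrier AT" if "x \<in> vcarrier A" "y \<in> vcarrier B" for x y
    using that by (simp add: algebraic_tensor_carrierI)
  show "elementary_tensor x y \<in> vcarrier (projective_tensor A B)"
    unfolding elementary_tensor_def projective_tensor_def by (rule T.completion_embed(1)[OF c[OF assms]])
  show "vnorm (projective_tensor A B) (elementary_tensor x y) \<le> vnorm A x * vnorm B y"
    unfolding elementary_tensor_def projective_tensor_def T.completion_embed(2)[OF c[OF assms]]
    using algebraic_tensor_norm_le[of "[(x, y)]"] assms by simp
  show "vmult (projective_tensor A B) (elementary_tensor x y) (elementary_tensor x' y') =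
      elementary_tensor (vmult A x x') (vmult B y y')" if "x' \<in> vcarrier A" "y' \<in> vcarrier B"
    unfolding elementary_tensor_def projective_tensor_def T.completion_embed(4)[OF c[OF assms] c[OF that]]
    using assms that by (simp add: algebraic_tensor_mult tmult_def)
qed

lemma projective_tensor_functional_of_bilinear:
  assumes "bounded_bilinear_form u K"
  obtains f where "f \<in> vcarrier (dual_space (projective_tensor A B))"
    "\<And>x y. x \<in> vcarrier A \<Longrightarrow> y \<in> vcarrier B \<Longrightarrow> f (elementary_tensor x y) = u x y"
proof -
  interpret T: normed_calgebra AT by (rule normed_calgebra_algebraic_tensor)
  obtain g where g: "g \<in> vcarrier (dual_space AT)"
    "\<And>x y. x \<in> vcarrier A \<Longrightarrow> y \<in> vcarrier B \<Longrightarrow> g (tcls [(x, y)]) = u x y"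
    using functional_of_bilinear[OF assms] by metis
  obtain f where f: "f \<in> vcarrier (dual_space (completion AT))"
    "\<And>x. x \<in> vcarrier AT \<Longrightarrow> f (T.completion_embed x) = g x"
    using T.extend_functional_completion[OF g(1)] by metis
  then show ?thesis
    using that[of f] g(2) by (simp add: projective_tensor_def elementary_tensor_def algebraic_tensor_carrierI)
qed

text \<open>Elementary tensors span the algebraic tensor product, which is dense in its
  completion.\<close>

lemma projective_tensor_functional_zero:
  assumes f: "f \<in> vcarrier (dual_space (projective_tensor A B))"
    and zero: "\<And>x y. x \<in> vcarrier A \<Longrightarrow> y \<in> vcarrier B \<Longrightarrow> f (elementary_tensor x y) = 0"
    and X: "X \<in> vcarrier (projective_tensor A B)"
  shows "f X = 0"
proof -
  interpret T: normed_calgebra AT by (rule normed_calgebra_algebraic_tensor)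
  note f' = f[unfolded projective_tensor_def]
  have *: "f (T.completion_embed (tcls us)) = 0" if "us \<in> FS" for us
    using that
  proof (induction us)
    case Nil
    \<comment> \<open>The class of the empty sum is 0 times itself, so homogeneity forces f to
      vanish there.\<close>
    have "tcls [] = vscale AT 0 (tcls [])" by (simp add: algebraic_tensor_scale)
    then have "T.completion_embed (tcls []) = vscale (completion AT) 0 (T.completion_embed (tcls []))"
      by (simp add: T.completion_embed(5) algebraic_tensor_carrierI)
    then show ?case
      using dual_spaceD(3)[OF f', of "T.completion_embed (tcls [])" 0] algebraic_tensor_carrierI[of "[]"]
      by (simp add: T.completion_embed(1))
  next
    case (Cons u us)
    then have c: "tcls [u] \<in> vcarrier AT" "tcls us \<in> vcarrier AT" by (simp_all add: algebraic_tensor_carrierI)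
    have "tcls (u # us) = vadd AT (tcls [u]) (tcls us)"
      using Cons by (simp add: algebraic_tensor_add)
    then have "f (T.completion_embed (tcls (u # us))) = f (T.completion_embed (tcls [u])) + f (T.completion_embed (tcls us))"
      using dual_spaceD(2)[OF f' T.completion_embed(1)[OF c(1)] T.completion_embed(1)[OF c(2)]] T.completion_embed(3)[OF c]
      by simp
    then show ?case using Cons zero[of "fst u" "snd u"] by (simp add: elementary_tensor_def)
  qed
  show ?thesis
    by (rule T.functional_zero_completion[OF f' _ X[unfolded projective_tensor_def]])
      (metis * algebraic_tensor_carrierE)
qed

text \<open>That F and G span is expressed through linear functionals vanishing on them, which
  avoids finite sums in carriers. The property is used twice: in y for fixed x in F, and then in x
  for fixed y.\<close>

lemma arens_regular_projective_tensorI: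
  assumes F: "finite F" "F \<subseteq> vcarrier A" and G: "finite G" "G \<subseteq> vcarrier B"
    and spanF: "\<And>\<phi>. (\<And>x y. x \<in> vcarrier A \<Longrightarrow> y \<in> vcarrier A \<Longrightarrow> \<phi> (vadd A x y) = \<phi> x + \<phi> y) \<Longrightarrow>
      (\<And>c x. x \<in> vcarrier A \<Longrightarrow> \<phi> (vscale A c x) = c * \<phi> x) \<Longrightarrow> (\<And>x. x \<in> F \<Longrightarrow> \<phi> x = 0) \<Longrightarrow>
      (\<And>x. x \<in> vcarrier A \<Longrightarrow> \<phi> x = (0::complex))"
    and spanG: "\<And>\<phi>. (\<And>x y. x \<in> vcarrier B \<Longrightarrow> y \<in> vcarrier B \<Longrightarrow> \<phi> (vadd B x y) = \<phi> x + \<phi> y) \<Longrightarrow>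
      (\<And>c x. x \<in> vcarrier B \<Longrightarrow> \<phi> (vscale B c x) = c * \<phi> x) \<Longrightarrow> (\<And>x. x \<in> G \<Longrightarrow> \<phi> x = 0) \<Longrightarrow>
      (\<And>x. x \<in> vcarrier B \<Longrightarrow> \<phi> x = (0::complex))"
  shows "arens_regular (projective_tensor A B)"
proof -
  interpret T: normed_calgebra AT by (rule normed_calgebra_algebraic_tensor)
  interpret P: normed_calgebra "projective_tensor A B" by (rule normed_calgebra_projective_tensor)
  have addl: "elementary_tensor (vadd A x x') y = vadd (projective_tensor A B) (elementary_tensor x y) (elementary_tensor x' y)"
    if "x \<in> vcarrier A" "x' \<in> vcarrier A" "y \<in> vcarrier B" for x x' y
    using that unfolding elementary_tensor_def projective_tensor_def
    by (simp add: T.completion_embed(3) algebraic_tensor_carrierI algebraic_tensor_add tcls_eqI[OF tensor_rel.add_left])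
  have addr: "elementary_tensor x (vadd B y y') = vadd (projective_tensor A B) (elementary_tensor x y) (elementary_tensor x y')"
    if "x \<in> vcarrier A" "y \<in> vcarrier B" "y' \<in> vcarrier B" for x y y'
    using that unfolding elementary_tensor_def projective_tensor_def
    by (simp add: T.completion_embed(3) algebraic_tensor_carrierI algebraic_tensor_add tcls_eqI[OF tensor_rel.add_right])
  have scalel: "elementary_tensor (vscale A c x) y = vscale (projective_tensor A B) c (elementary_tensor x y)"
    if "x \<in> vcarrier A" "y \<in> vcarrier B" for c x y
    using that unfolding elementary_tensor_def projective_tensor_def
    by (simp add: T.completion_embed(5) algebraic_tensor_carrierI algebraic_tensor_scale)
  have scaler: "elementary_tensor x (vscale B c y) = vscale (projective_tensor A B) c (elementary_tensor x y)"
    if "x \<in> vcarrier A" "y \<in> vcarrier B" for c x y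
    using that scalel[OF that, of c] tcls_eqI[OF tensor_rel.scale[OF that, of c]] by (simp add: elementary_tensor_def)
  show ?thesis
  proof (rule P.arens_regularI_finite)
    show "finite ((\<lambda>(x, y). elementary_tensor x y) ` (F \<times> G))" using F G by simp
    show "(\<lambda>(x, y). elementary_tensor x y) ` (F \<times> G) \<subseteq> vcarrier (projective_tensor A B)"
      using F G elementary_tensor(1) by auto
    fix g X assume g: "g \<in> vcarrier (dual_space (projective_tensor A B))"
      and z: "\<And>a. a \<in> (\<lambda>(x, y). elementary_tensor x y) ` (F \<times> G) \<Longrightarrow> g a = 0"
      and X: "X \<in> vcarrier (projective_tensor A B)"
    note gadd = dual_spaceD(2)[OF g elementary_tensor(1) elementary_tensor(1)]
      and gscale = dual_spaceD(3)[OF g elementary_tensor(1)]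
    have 1: "g (elementary_tensor x y) = 0" if x: "x \<in> F" and y: "y \<in> vcarrier B" for x y
    proof (rule spanG[of "\<lambda>y. g (elementary_tensor x y)", OF _ _ _ y])
      have "x \<in> vcarrier A" using x F by auto
      then show "g (elementary_tensor x (vadd B y y')) = g (elementary_tensor x y) + g (elementary_tensor x y')"
        and "g (elementary_tensor x (vscale B c y)) = c * g (elementary_tensor x y)"
        if "y \<in> vcarrier B" "y' \<in> vcarrier B" for y y' c
        using that by (simp_all add: addr scaler gadd gscale)
    qed (use x z in blast)
    show "g X = 0"
    proof (rule projective_tensor_functional_zero[OF g _ X])
      fix x y assume x: "x \<in> vcarrier A" and y: "y \<in> vcarrier B"
      show "g (elementary_tensor x y) = 0"
        by (rule spanF[of "\<lambda>x. g (elementary_tensor x y)", OF _ _ _ x])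
          (simp_all add: addl scalel gadd gscale 1 y)
    qed
  qed
qed

end

section \<open>Operators on Hilbert space\<close>

lemma cinner_add_left: "cinner (x + y) z = cinner x z + cinner y z"
  by (metis cinner_commute cinner_add_right complex_cnj_add)

lemma cinner_scaleC_left: "cinner (c *\<^sub>C x) y = cnj c * cinner x y"
  by (metis cinner_commute cinner_scaleC_right complex_cnj_mult)

lemma cinner_scaleR_right: "cinner x (r *\<^sub>R y) = complex_of_real r * cinner x y"
  by (metis scaleC_of_real cinner_scaleC_right)

lemma cinner_scaleR_left: "cinner (r *\<^sub>R x) y = complex_of_real r * cinner x y"
  by (metis scaleC_of_real cinner_scaleC_left complex_cnj_complex_of_real)

lemma cinner_zero [simp]: "cinner x 0 = 0" "cinner 0 x = 0"
  using cinner_scaleR_right[of x 0 0] cinner_scaleR_left[of 0 0 x] by simp_all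

lemma cinner_minus_right: "cinner x (- y) = - cinner x y"
  using cinner_scaleR_right[of x "-1" y] by simp

lemma cinner_minus_left: "cinner (- x) y = - cinner x y"
  using cinner_scaleR_left[of "-1" x y] by simp

lemma cinner_diff_right: "cinner x (y - z) = cinner x y - cinner x z"
  using cinner_add_right[of x y "- z"] by (simp add: cinner_minus_right)

lemma cinner_diff_left: "cinner (x - y) z = cinner x z - cinner y z"
  using cinner_add_left[of x "- y" z] by (simp add: cinner_minus_left)

lemma cinner_sum_right: "cinner x (\<Sum>i\<in>I. f i) = (\<Sum>i\<in>I. cinner x (f i))"
  by (induction I rule: infinite_finite_induct) (auto simp: cinner_add_right)

lemma cinner_sum_left: "cinner (\<Sum>i\<in>I. f i) x = (\<Sum>i\<in>I. cinner (f i) x)"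
  by (induction I rule: infinite_finite_induct) (auto simp: cinner_add_left)

lemma norm_sq_eq_cinner: "(norm x)\<^sup>2 = Re (cinner x x)"
  by (simp add: cinner_self)

lemma scaleC_zero_left [simp]: "0 *\<^sub>C x = 0"
  using scaleC_of_real[of 0 x] by simp

lemma scaleC_zero_right [simp]: "c *\<^sub>C 0 = (0 :: 'h :: chilbert_space)"
  using scaleC_scaleC[of c 0 "0 :: 'h"] by simp

lemma scaleC_one [simp]: "1 *\<^sub>C x = x"
  using scaleC_of_real[of 1 x] by simp

lemma norm_scaleC: "norm (c *\<^sub>C x) = cmod c * norm (x :: 'h :: chilbert_space)"
proof -
  have "complex_of_real ((norm (c *\<^sub>C x))\<^sup>2) = complex_of_real ((cmod c * norm x)\<^sup>2)"
    unfolding cinner_self[symmetric] cinner_scaleC_left cinner_scaleC_right power_mult_distrib of_real_mult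
      complex_norm_square cinner_self[symmetric] by simp
  then show ?thesis by (simp only: of_real_eq_iff) (simp add: power2_eq_iff_nonneg)
qed

lemma norm_add_sq:
  "(norm (x + y))\<^sup>2 = (norm x)\<^sup>2 + 2 * Re (cinner x y) + (norm (y :: 'h :: chilbert_space))\<^sup>2"
proof -
  have "Re (cinner y x) = Re (cinner x y)" by (subst cinner_commute) simp
  then show ?thesis by (simp add: norm_sq_eq_cinner cinner_add_left cinner_add_right)
qed

lemma norm_diff_sq:
  "(norm (x - y))\<^sup>2 = (norm x)\<^sup>2 - 2 * Re (cinner x y) + (norm (y :: 'h :: chilbert_space))\<^sup>2"
  using norm_add_sq[of x "- y"] by (simp add: cinner_minus_right)

text \<open>The triangle inequality is given with the Banach space, so it suffices to square it for
  x + cy, where c is the conjugate of \<open>cinner x y\<close> and makes the cross term real and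
  nonnegative.\<close>

lemma cauchy_schwarz: "cmod (cinner x y) \<le> norm x * norm (y :: 'h :: chilbert_space)"
proof (cases "cinner x y = 0")
  case False
  define c where "c = cnj (cinner x y)"
  have "(norm (x + c *\<^sub>C y))\<^sup>2 \<le> (norm x + norm (c *\<^sub>C y))\<^sup>2"
    by (intro power_mono norm_triangle_ineq norm_ge_zero)
  then have "Re (cinner x (c *\<^sub>C y)) \<le> norm x * norm (c *\<^sub>C y)"
    by (simp add: norm_add_sq power2_sum)
  moreover have "Re (cinner x (c *\<^sub>C y)) = (cmod (cinner x y))\<^sup>2"
    unfolding c_def cinner_scaleC_right by (subst mult.commute) (simp flip: complex_norm_square)
  ultimately have "cmod (cinner x y) * cmod (cinner x y) \<le> cmod (cinner x y) * (norm x * norm y)"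
    by (simp add: norm_scaleC c_def power2_eq_square mult_ac)
  then show ?thesis using False by simp
qed simp

lemma tendsto_cinner_right:
  assumes "(f \<longlongrightarrow> l) F"
  shows "((\<lambda>n. cinner y (f n)) \<longlongrightarrow> cinner y l) F"
proof (rule Lim_transform_bound[of _ "\<lambda>n. norm y * norm (f n - l)", THEN LIM_zero_cancel])
  show "\<forall>\<^sub>F n in F. norm (cinner y (f n) - cinner y l) \<le> norm (norm y * norm (f n - l))"
    unfolding cinner_diff_right[symmetric] by (auto intro!: always_eventually cauchy_schwarz simp: abs_mult)
  show "((\<lambda>n. norm y * norm (f n - l)) \<longlongrightarrow> 0) F"
    using tendsto_mult_left[OF tendsto_norm_zero[OF LIM_zero[OF assms]], of "norm y"] by simp
qed

lemma tendsto_cinner_left: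
  assumes "(f \<longlongrightarrow> l) F"
  shows "((\<lambda>n. cinner (f n) y) \<longlongrightarrow> cinner l y) F"
  using tendsto_cnj[OF tendsto_cinner_right[OF assms, of y]] by (simp flip: cinner_commute)

lemma cinner_eqI: "(\<And>y. cinner x y = cinner x' y) \<Longrightarrow> x = x'"
proof -
  assume "\<And>y. cinner x y = cinner x' y"
  then have "cinner (x - x') (x - x') = 0" by (simp add: cinner_diff_left)
  then show "x = x'" by (simp add: cinner_self)
qed

text \<open>Let s be the orthogonal projection of x onto the span. Both <s, s> and <s, x> equal the
  sum B, so the Cauchy-Schwarz inequality gives norm s \<le> norm x.\<close>

lemma bessel_inequality:
  fixes e :: "'i \<Rightarrow> 'h :: chilbert_space"
  assumes I: "finite I" and on: "\<And>i j. i \<in> I \<Longrightarrow> j \<in> I \<Longrightarrow> cinner (e i) (e j) = (if i = j then 1 else 0)"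
  shows "(\<Sum>i\<in>I. (cmod (cinner (e i) x))\<^sup>2) \<le> (norm x)\<^sup>2"
proof -
  define B where "B = (\<Sum>i\<in>I. (cmod (cinner (e i) x))\<^sup>2)"
  define s where "s = (\<Sum>i\<in>I. cinner (e i) x *\<^sub>C e i)"
  have B: "0 \<le> B" unfolding B_def by (simp add: sum_nonneg)
  have sx: "cinner s x = complex_of_real B"
    unfolding s_def B_def cinner_sum_left cinner_scaleC_left of_real_sum
    by (intro sum.cong) (simp_all only: complex_norm_square mult.commute)
  have es: "cinner (e i) s = cinner (e i) x" if "i \<in> I" for i
  proof -
    have "cinner (e i) s = (\<Sum>j\<in>I. if i = j then cinner (e j) x else 0)"
      unfolding s_def cinner_sum_right cinner_scaleC_right using on that by (intro sum.cong) auto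
    then show ?thesis using I that by simp
  qed
  have "cinner s s = (\<Sum>i\<in>I. cnj (cinner (e i) x) * cinner (e i) s)"
    by (subst (1) s_def) (simp add: cinner_sum_left cinner_scaleC_left)
  also have "\<dots> = cinner s x"
    unfolding s_def cinner_sum_left cinner_scaleC_left by (intro sum.cong) (auto simp: es s_def[symmetric])
  finally have "(norm s)\<^sup>2 = B" by (simp add: norm_sq_eq_cinner sx)
  moreover have "B \<le> norm s * norm x" using cauchy_schwarz[of s x] B by (simp add: sx)
  ultimately have "norm s * norm s \<le> norm s * norm x" by (simp add: power2_eq_square)
  then have "norm s \<le> norm x" by (cases "norm s = 0") (auto simp: mult_le_cancel_left)
  then have "(norm s)\<^sup>2 \<le> (norm x)\<^sup>2" by (simp add: power_mono)
  then show ?thesis using \<open>(norm s)\<^sup>2 = B\<close> by (simp add: B_def)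
qed

lemma bounded_clinear_simps:
  assumes "bounded_clinear T"
  shows "T (x + y) = T x + T y" "T (c *\<^sub>C x) = c *\<^sub>C T x" "T (r *\<^sub>R x) = r *\<^sub>R T x" "T 0 = 0"
    "T (- x) = - T x" "T (x - y) = T x - T y" "T (\<Sum>i\<in>I. f i) = (\<Sum>i\<in>I. T (f i))"
    "norm (T x) \<le> onorm T * norm x" "bounded_linear T" "0 \<le> onorm T"
proof -
  show b: "bounded_linear T" using assms by (simp add: bounded_clinear_def)
  then interpret bounded_linear T .
  show "T (x + y) = T x + T y" "T (r *\<^sub>R x) = r *\<^sub>R T x" "T 0 = 0"
    "T (- x) = - T x" "T (x - y) = T x - T y" "T (\<Sum>i\<in>I. f i) = (\<Sum>i\<in>I. T (f i))"
    by (simp_all add: add scaleR neg diff sum zero)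
  show "T (c *\<^sub>C x) = c *\<^sub>C T x" using assms by (simp add: bounded_clinear_def)
  show "norm (T x) \<le> onorm T * norm x" by (rule onorm[OF b])
  show "0 \<le> onorm T" by (rule onorm_pos_le[OF b])
qed

lemma bounded_clinearI:
  assumes "\<And>x y. T (x + y) = T x + T y" "\<And>c x. T (c *\<^sub>C x) = c *\<^sub>C T x" "\<And>x. norm (T x) \<le> K * norm x"
  shows "bounded_clinear T"
proof -
  have "T (r *\<^sub>R x) = r *\<^sub>R T x" for r x using assms(2)[of "complex_of_real r" x] by (simp add: scaleC_of_real)
  then have "bounded_linear T"
    using assms(1,3) by (intro bounded_linear_intro[of _ K]) (auto simp: mult.commute)
  then show ?thesis using assms(2) by (simp add: bounded_clinear_def)
qed

lemma bounded_clinear_tendsto: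
  "bounded_clinear T \<Longrightarrow> (f \<longlongrightarrow> l) F \<Longrightarrow> ((\<lambda>n. T (f n)) \<longlongrightarrow> T l) F"
  using bounded_linear.tendsto bounded_clinear_simps(9) by blast

lemma tendsto_scaleC: "(f \<longlongrightarrow> l) F \<Longrightarrow> ((\<lambda>n. c *\<^sub>C f n) \<longlongrightarrow> c *\<^sub>C (l :: 'h :: chilbert_space)) F"
  by (rule bounded_clinear_tendsto[of "\<lambda>x. c *\<^sub>C x"], rule bounded_clinearI[of _ "cmod c"])
    (simp_all add: scaleC_add_right scaleC_scaleC mult.commute norm_scaleC)

text \<open>The common bound K replaces the uniform boundedness principle; every strong limit taken
  below comes with such a bound.\<close>

lemma bounded_clinear_strong_limit:
  assumes T: "\<And>n. bounded_clinear (T n)" and K: "\<And>n x. norm (T n x) \<le> K * norm x"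
    and lim: "\<And>x. (\<lambda>n. T n x) \<longlonglongrightarrow> L x"
  shows "bounded_clinear L" and "norm (L x) \<le> K * norm x"
proof -
  show b: "norm (L x) \<le> K * norm x" for x
    by (rule LIMSEQ_le_const2[OF tendsto_norm[OF lim]]) (use K in auto)
  show "bounded_clinear L"
  proof (rule bounded_clinearI[OF _ _ b])
    show "L (x + y) = L x + L y" for x y
      using tendsto_add[OF lim[of x] lim[of y]] lim[of "x + y"]
      by (simp add: bounded_clinear_simps(1)[OF T]) (blast intro: LIMSEQ_unique)
    show "L (c *\<^sub>C x) = c *\<^sub>C L x" for c x
      using tendsto_scaleC[OF lim[of x], of c] lim[of "c *\<^sub>C x"]
      by (simp add: bounded_clinear_simps(2)[OF T]) (blast intro: LIMSEQ_unique)
  qed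
qed

section \<open>Self-adjoint operators and square roots\<close>

definition selfadjoint :: "('h::chilbert_space \<Rightarrow> 'h) \<Rightarrow> bool" where
  "selfadjoint T \<longleftrightarrow> (\<forall>x y. cinner (T x) y = cinner x (T y))"

lemma selfadjointD: "selfadjoint T \<Longrightarrow> cinner (T x) y = cinner x (T y)"
  by (simp add: selfadjoint_def)

text \<open>Insert x + S x into the quadratic form: by self-adjointness each of the two cross terms
  is the squared norm of S x.\<close>

lemma selfadjoint_eq_zeroI:
  assumes S: "selfadjoint S" "bounded_clinear S" and z: "\<And>x. Re (cinner x (S x)) = 0"
  shows "S x = 0"
proof -
  have "Re (cinner (x + S x) (S (x + S x))) = Re (cinner x (S x)) + Re (cinner (S x) (S x)) + Re (cinner x (S (S x))) + Re (cinner (S x) (S (S x)))"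
    by (simp add: cinner_add_left cinner_add_right bounded_clinear_simps[OF S(2)])
  moreover have "cinner x (S (S x)) = cinner (S x) (S x)" using selfadjointD[OF S(1)] by simp
  ultimately have "2 * Re (cinner (S x) (S x)) = 0" using z by simp
  then show ?thesis by (simp add: cinner_self)
qed

lemma selfadjoint_limit:
  assumes "\<And>n. selfadjoint (T n)" "\<And>x. (\<lambda>n. T n x) \<longlonglongrightarrow> L x"
  shows "selfadjoint L"
  unfolding selfadjoint_def
proof (intro allI)
  fix x y
  have "(\<lambda>n. cinner (T n x) y) \<longlonglongrightarrow> cinner x (L y)"
    using tendsto_cinner_right[OF assms(2)[of y], of x] by (simp add: selfadjointD[OF assms(1)])
  then show "cinner (L x) y = cinner x (L y)"
    using tendsto_cinner_left[OF assms(2)[of x], of y] LIMSEQ_unique by blast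
qed

text \<open>Expanding the square subtracts the squared norm of b x twice, and one copy absorbs the
  squared norm of b (b x). The other copy remains as a loss, which later shows that vectors whose
  norm is preserved lie in the kernel of b.\<close>

lemma norm_one_minus_square_le:
  assumes b: "selfadjoint b" "\<And>x. norm (b x) \<le> norm x"
  shows "(norm (x - b (b x)))\<^sup>2 \<le> (norm x)\<^sup>2 - (norm (b x))\<^sup>2"
proof -
  have "Re (cinner x (b (b x))) = (norm (b x))\<^sup>2"
    using selfadjointD[OF b(1), of x "b x"] by (simp add: norm_sq_eq_cinner)
  moreover have "(norm (b (b x)))\<^sup>2 \<le> (norm (b x))\<^sup>2" by (simp add: power_mono b(2))
  ultimately show ?thesis by (simp add: norm_diff_sq)
qed

text \<open>The iteration for \<open>Y = 1 - sqrt (1 - X)\<close>, which solves \<open>Y = (X + Y\<^sup>2) / 2\<close>. Since its increments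
  are dominated by those of the scalar iteration at \<open>X = 1\<close>, it converges for every contraction.\<close>

primrec sqrt_iter :: "('h::chilbert_space \<Rightarrow> 'h) \<Rightarrow> nat \<Rightarrow> 'h \<Rightarrow> 'h" where
  "sqrt_iter X 0 = (\<lambda>x. 0)"
| "sqrt_iter X (Suc n) = (\<lambda>x. (1/2) *\<^sub>R (X x + sqrt_iter X n (sqrt_iter X n x)))"

primrec sqrt_bound :: "nat \<Rightarrow> real" where
  "sqrt_bound 0 = 0"
| "sqrt_bound (Suc n) = (1 + (sqrt_bound n)\<^sup>2) / 2"

lemma sqrt_bound_range: "0 \<le> sqrt_bound n" "sqrt_bound n \<le> 1"
proof (induction n)
  case (Suc n)
  { case 1 then show ?case by simp }
  { case 2 show ?case using Suc power_mono[of "sqrt_bound n" 1 2] by simp }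
qed auto

lemma sqrt_bound_incseq: "incseq sqrt_bound"
proof (rule incseq_SucI)
  fix n show "sqrt_bound n \<le> sqrt_bound (Suc n)"
    using zero_le_power2[of "1 - sqrt_bound n"] by (simp add: power2_diff)
qed

lemma sqrt_iter_bounded_clinear:
  assumes X: "bounded_clinear X" "\<And>x. norm (X x) \<le> norm x"
  shows "bounded_clinear (sqrt_iter X n) \<and> (\<forall>x. norm (sqrt_iter X n x) \<le> sqrt_bound n * norm x)"
proof (induction n)
  case 0
  show ?case by (auto intro!: bounded_clinearI[of _ 0])
next
  case (Suc n)
  let ?Y = "sqrt_iter X n" and ?y = "sqrt_bound n"
  have Y: "bounded_clinear ?Y" "\<And>x. norm (?Y x) \<le> ?y * norm x" using Suc by auto
  have n: "norm (sqrt_iter X (Suc n) x) \<le> sqrt_bound (Suc n) * norm x" for x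
  proof -
    have "norm (?Y (?Y x)) \<le> ?y * (?y * norm x)"
      using Y(2)[of "?Y x"] mult_left_mono[OF Y(2)[of x] sqrt_bound_range(1)[of n]] by linarith
    then have "norm (X x + ?Y (?Y x)) \<le> norm x + ?y * (?y * norm x)"
      using X(2)[of x] norm_triangle_ineq[of "X x" "?Y (?Y x)"] by linarith
    then show ?thesis by (simp add: power2_eq_square algebra_simps del: scaleR_add_right)
  qed
  moreover have "bounded_clinear (sqrt_iter X (Suc n))"
  proof (rule bounded_clinearI[OF _ _ n])
    show "sqrt_iter X (Suc n) (c *\<^sub>C x) = c *\<^sub>C sqrt_iter X (Suc n) x" for c x
      by (simp add: bounded_clinear_simps[OF X(1)] bounded_clinear_simps[OF Y(1)] flip: scaleC_of_real scaleC_add_right)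
        (simp add: scaleC_scaleC mult.commute)
  qed (simp add: bounded_clinear_simps[OF X(1)] bounded_clinear_simps[OF Y(1)] algebra_simps)
  ultimately show ?case by blast
qed

lemma sqrt_iter_commute:
  assumes "bounded_clinear T" "\<And>x. T (X x) = X (T x)"
  shows "T (sqrt_iter X n x) = sqrt_iter X n (T x)"
proof (induction n arbitrary: x)
  case 0
  then show ?case by (simp add: bounded_clinear_simps[OF assms(1)])
next
  case (Suc n)
  then show ?case by (simp add: bounded_clinear_simps[OF assms(1)] assms(2))
qed

lemma sqrt_iter_selfadjoint:
  assumes X: "selfadjoint X"
  shows "selfadjoint (sqrt_iter X n)"
proof (induction n)
  case 0
  then show ?case by (simp add: selfadjoint_def)
next
  case (Suc n)
  show ?case
    unfolding selfadjoint_def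
    by (simp add: cinner_scaleR_left cinner_scaleR_right cinner_add_left cinner_add_right selfadjointD[OF X] selfadjointD[OF Suc])
qed

text \<open>For consecutive iterates Y and Z the next increment is half of Z^2 - Y^2 = Z(Z - Y) + (Z
  - Y)Y, an identity that does not rest on Y and Z commuting. The scalar bounds y and z then give
  (z^2 - y^2)/2, which is the next scalar increment.\<close>

lemma sqrt_iter_increment:
  assumes X: "bounded_clinear X" "\<And>x. norm (X x) \<le> norm x"
  shows "norm (sqrt_iter X (Suc n) x - sqrt_iter X n x) \<le> (sqrt_bound (Suc n) - sqrt_bound n) * norm x"
proof (induction n arbitrary: x)
  case 0
  then show ?case using X(2)[of x] by simp
next
  case (Suc n)
  let ?Y = "sqrt_iter X n" and ?Z = "sqrt_iter X (Suc n)" and ?y = "sqrt_bound n" and ?z = "sqrt_bound (Suc n)"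
  have Z: "bounded_clinear ?Z" "\<And>x. norm (?Z x) \<le> ?z * norm x"
    and Y: "bounded_clinear ?Y" "\<And>x. norm (?Y x) \<le> ?y * norm x"
    using sqrt_iter_bounded_clinear[OF X] by blast+
  have inc: "0 \<le> ?z - ?y" using incseq_SucD[OF sqrt_bound_incseq, of n] by linarith
  have eq: "sqrt_iter X (Suc (Suc n)) x - ?Z x = (1/2) *\<^sub>R (?Z (?Z x - ?Y x) + (?Z (?Y x) - ?Y (?Y x)))"
    unfolding bounded_clinear_simps(6)[OF Z(1)] sqrt_iter.simps(2)[of X "Suc n"]
    unfolding sqrt_iter.simps(2)[of X n, THEN fun_cong, of x] by (simp add: scaleR_diff_right scaleR_add_right del: sqrt_iter.simps)
  have "norm (?Z (?Z x - ?Y x)) \<le> ?z * ((?z - ?y) * norm x)"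
    using Z(2)[of "?Z x - ?Y x"] mult_left_mono[OF Suc[of x] sqrt_bound_range(1)[of "Suc n"]] by linarith
  moreover have "norm (?Z (?Y x) - ?Y (?Y x)) \<le> (?z - ?y) * (?y * norm x)"
    using Suc[of "?Y x"] mult_left_mono[OF Y(2)[of x] inc] by linarith
  ultimately have "norm (?Z (?Z x - ?Y x) + (?Z (?Y x) - ?Y (?Y x))) \<le> ?z * ((?z - ?y) * norm x) + (?z - ?y) * (?y * norm x)"
    using norm_triangle_ineq order_trans add_mono by meson
  also have "\<dots> = (?z\<^sup>2 - ?y\<^sup>2) * norm x" by (simp add: power2_eq_square algebra_simps del: sqrt_bound.simps)
  finally have "norm (sqrt_iter X (Suc (Suc n)) x - ?Z x) \<le> (?z\<^sup>2 - ?y\<^sup>2) / 2 * norm x"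
    unfolding eq by (simp del: sqrt_iter.simps sqrt_bound.simps)
  also have "(?z\<^sup>2 - ?y\<^sup>2) / 2 = sqrt_bound (Suc (Suc n)) - ?z"
    unfolding sqrt_bound.simps(2)[of "Suc n"] by (subst (3) sqrt_bound.simps(2)) (simp add: field_simps)
  finally show ?case .
qed

lemma ex_one_minus_sqrt:
  fixes X :: "'h::chilbert_space \<Rightarrow> 'h"
  assumes X: "bounded_clinear X" "\<And>x. norm (X x) \<le> norm x"
  obtains Z where "\<And>x. (\<lambda>n. sqrt_iter X n x) \<longlonglongrightarrow> Z x" "\<And>x. 2 *\<^sub>R Z x = X x + Z (Z x)"
    "bounded_clinear Z" "\<And>x. norm (Z x) \<le> norm x"
proof -
  have Y: "bounded_clinear (sqrt_iter X n)" "norm (sqrt_iter X n x) \<le> 1 * norm x" for n x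
  proof -
    show "bounded_clinear (sqrt_iter X n)" using sqrt_iter_bounded_clinear[OF X] by blast
    have "norm (sqrt_iter X n x) \<le> sqrt_bound n * norm x" using sqrt_iter_bounded_clinear[OF X] by blast
    also have "\<dots> \<le> 1 * norm x" by (intro mult_right_mono sqrt_bound_range) simp
    finally show "norm (sqrt_iter X n x) \<le> 1 * norm x" .
  qed
  obtain l where l: "sqrt_bound \<longlonglongrightarrow> l"
    using incseq_convergent[OF sqrt_bound_incseq] sqrt_bound_range(2) by metis
  \<comment> \<open>The dominating series telescopes to the limit of the bounded increasing sequence
    \<open>sqrt_bound\<close>.\<close>
  have "summable (\<lambda>n. norm (sqrt_iter X (Suc n) x - sqrt_iter X n x))" for x
  proof (rule summable_comparison_test')
    show "summable (\<lambda>n. (sqrt_bound (Suc n) - sqrt_bound n) * norm x)"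
      using telescope_summable[OF l] by (rule summable_mult2)
    show "norm (norm (sqrt_iter X (Suc n) x - sqrt_iter X n x)) \<le> (sqrt_bound (Suc n) - sqrt_bound n) * norm x" for n
      using sqrt_iter_increment[OF X, of n x] by simp
  qed
  then have "convergent (\<lambda>n. sqrt_iter X n x)" for x
    using summable_LIMSEQ[OF summable_norm_cancel, of "\<lambda>n. sqrt_iter X (Suc n) x - sqrt_iter X n x"]
      sum_lessThan_telescope[of "\<lambda>n. sqrt_iter X n x"]
    unfolding convergent_def by (auto simp del: sqrt_iter.simps(2))
  then have lim: "(\<lambda>n. sqrt_iter X n x) \<longlonglongrightarrow> lim (\<lambda>n. sqrt_iter X n x)" for x
    by (simp add: convergent_LIMSEQ_iff)
  define Z where "Z = (\<lambda>x. lim (\<lambda>n. sqrt_iter X n x))"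
  have Zlim: "(\<lambda>n. sqrt_iter X n x) \<longlonglongrightarrow> Z x" for x unfolding Z_def by (rule lim)
  note Z = bounded_clinear_strong_limit[OF Y Zlim]
  \<comment> \<open>Composition is not jointly continuous for strong limits in general; here the
    uniform bound 1 on the outer operator controls the inner error.\<close>
  have "(\<lambda>n. sqrt_iter X n (sqrt_iter X n x)) \<longlonglongrightarrow> Z (Z x)" for x
  proof -
    have "(\<lambda>n. sqrt_iter X n (sqrt_iter X n x - Z x)) \<longlonglongrightarrow> 0"
    proof (rule Lim_null_comparison)
      show "\<forall>\<^sub>F n in sequentially. norm (sqrt_iter X n (sqrt_iter X n x - Z x)) \<le> norm (sqrt_iter X n x - Z x)"
        using Y(2) by simp
      show "(\<lambda>n. norm (sqrt_iter X n x - Z x)) \<longlonglongrightarrow> 0"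
        using tendsto_norm_zero[OF LIM_zero[OF Zlim]] .
    qed
    from tendsto_add[OF this Zlim[of "Z x"]] show ?thesis by (simp add: bounded_clinear_simps(6)[OF Y(1)])
  qed
  then have "(\<lambda>n. sqrt_iter X (Suc n) x) \<longlonglongrightarrow> (1/2) *\<^sub>R (X x + Z (Z x))" for x
    by (auto intro!: tendsto_intros)
  then have "Z x = (1/2) *\<^sub>R (X x + Z (Z x))" for x
    using LIMSEQ_unique LIMSEQ_Suc[OF Zlim] by blast
  then have "2 *\<^sub>R Z x = 2 *\<^sub>R ((1/2) *\<^sub>R (X x + Z (Z x)))" for x by metis
  then show ?thesis using that[OF Zlim _ Z(1)] Z(2) by simp
qed

section \<open>Von Neumann algebras: closure properties, moduli and support projections\<close>

locale vn_algebra =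
  fixes M :: "('h::chilbert_space \<Rightarrow> 'h) set"
  assumes vn: "von_neumann_algebra M"
begin

lemma bcl: "T \<in> M \<Longrightarrow> bounded_clinear T"
  using vn by (simp add: von_neumann_algebra_def)

lemmas lin = bounded_clinear_simps[OF bcl]

lemma add_mem: "S \<in> M \<Longrightarrow> T \<in> M \<Longrightarrow> (\<lambda>x. S x + T x) \<in> M"
  using vn by (simp add: von_neumann_algebra_def)

lemma scaleC_mem: "T \<in> M \<Longrightarrow> (\<lambda>x. c *\<^sub>C T x) \<in> M"
  using vn by (simp add: von_neumann_algebra_def)

lemma comp_mem: "S \<in> M \<Longrightarrow> T \<in> M \<Longrightarrow> (\<lambda>x. S (T x)) \<in> M"
  using vn by (simp add: von_neumann_algebra_def comp_def)

lemma adjoint_mem: "T \<in> M \<Longrightarrow> \<exists>S\<in>M. \<forall>x y. cinner (S x) y = cinner x (T y)"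
  using vn by (simp add: von_neumann_algebra_def)

lemma scaleR_mem: "T \<in> M \<Longrightarrow> (\<lambda>x. r *\<^sub>R T x) \<in> M"
  using scaleC_mem[of T "complex_of_real r"] by (simp add: scaleC_of_real)

lemma diff_mem: "S \<in> M \<Longrightarrow> T \<in> M \<Longrightarrow> (\<lambda>x. S x - T x) \<in> M"
  using add_mem[OF _ scaleR_mem[of T "-1"], of S] by simp

lemma bicommutantI:
  assumes "bounded_clinear T" "\<And>S x. bounded_clinear S \<Longrightarrow> (\<And>R y. R \<in> M \<Longrightarrow> S (R y) = R (S y)) \<Longrightarrow> T (S x) = S (T x)"
  shows "T \<in> M"
proof -
  have "T \<in> commutant (commutant M)"
    using assms unfolding commutant_def by (simp add: fun_eq_iff)
  then show ?thesis using vn by (simp add: von_neumann_algebra_def)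
qed

lemma id_mem: "(\<lambda>x. x) \<in> M"
  by (rule bicommutantI) (auto intro!: bounded_clinearI[of _ 1])

lemma zero_mem: "(\<lambda>x. 0) \<in> M"
  using diff_mem[OF id_mem id_mem] by simp

lemma sum_mem: "(\<And>i. i \<in> I \<Longrightarrow> T i \<in> M) \<Longrightarrow> (\<lambda>x. \<Sum>i\<in>I. T i x) \<in> M"
  by (induction I rule: infinite_finite_induct) (auto simp: zero_mem intro: add_mem)

text \<open>Commuting with a fixed bounded operator is preserved under strong limits, so a
  bicommutant contains them. This is where M has to be more than a norm-closed algebra.\<close>

lemma strong_limit_mem:
  assumes T: "\<And>n. T n \<in> M" and K: "\<And>n x. norm (T n x) \<le> K * norm x"
    and lim: "\<And>x. (\<lambda>n. T n x) \<longlonglongrightarrow> L x"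
  shows "L \<in> M"
proof (rule bicommutantI)
  show "bounded_clinear L" by (rule bounded_clinear_strong_limit[OF bcl[OF T] K lim])
  fix S x assume S: "bounded_clinear S" "\<And>R y. R \<in> M \<Longrightarrow> S (R y) = R (S y)"
  have "(\<lambda>n. T n (S x)) \<longlonglongrightarrow> S (L x)"
    using bounded_clinear_tendsto[OF S(1) lim[of x]] by (simp add: S(2)[OF T])
  then show "L (S x) = S (L x)" using lim[of "S x"] LIMSEQ_unique by blast
qed

text \<open>R is the modulus of S. For the contraction b = kS the iteration at X = 1 - b^2 yields Z
  = 1 - sqrt(b^2), so 1 - Z is k times the modulus. The last clause holds because the iterates are
  built from S alone; it is applied to S itself and to a projection commuting with S.\<close>

lemma ex_abs_operator:
  assumes S: "S \<in> M" "selfadjoint S"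
  obtains R where "R \<in> M" "selfadjoint R" "\<forall>x. R (R x) = S (S x)" "\<forall>x. 0 \<le> Re (cinner x (R x))"
    "\<forall>T. bounded_clinear T \<longrightarrow> (\<forall>x. T (S x) = S (T x)) \<longrightarrow> (\<forall>x. T (R x) = R (T x))"
proof -
  \<comment> \<open>Adding 1 avoids a division by 0 when S = 0 and still makes kS a
    contraction.\<close>
  define k where "k = 1 / (onorm S + 1)"
  have k: "0 < k" "k * onorm S \<le> 1" using lin(10)[OF S(1)] by (auto simp: k_def field_simps)
  define b where "b = (\<lambda>x. k *\<^sub>R S x)"
  have bM: "b \<in> M" unfolding b_def by (rule scaleR_mem[OF S(1)])
  have b: "selfadjoint b" using S(2) by (simp add: b_def selfadjoint_def cinner_scaleR_left cinner_scaleR_right)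
  have b1: "norm (b x) \<le> norm x" for x
  proof -
    have "norm (b x) \<le> k * (onorm S * norm x)" using lin(8)[OF S(1), of x] k(1) by (simp add: b_def)
    also have "\<dots> \<le> 1 * norm x" unfolding mult.assoc[symmetric] by (intro mult_right_mono k) simp
    finally show ?thesis by simp
  qed
  define X where "X = (\<lambda>x. x - b (b x))"
  have XM: "X \<in> M" unfolding X_def by (rule diff_mem[OF id_mem comp_mem[OF bM bM]])
  have X: "selfadjoint X" by (simp add: selfadjoint_def X_def cinner_diff_left cinner_diff_right selfadjointD[OF b])
  have X1: "norm (X x) \<le> norm x" for x
  proof (rule power2_le_imp_le)
    show "(norm (X x))\<^sup>2 \<le> (norm x)\<^sup>2"
      using norm_one_minus_square_le[OF b b1, of x] zero_le_power2[of "norm (b x)"] unfolding X_def by linarith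
  qed simp
  obtain Z where Z: "\<And>x. (\<lambda>n. sqrt_iter X n x) \<longlonglongrightarrow> Z x" "\<And>x. 2 *\<^sub>R Z x = X x + Z (Z x)"
    "bounded_clinear Z" "\<And>x. norm (Z x) \<le> norm x"
    using ex_one_minus_sqrt[OF bcl[OF XM] X1] by metis
  have YM: "sqrt_iter X n \<in> M" for n
  proof (induction n)
    case (Suc n)
    show ?case using scaleR_mem[OF add_mem[OF XM comp_mem[OF Suc Suc]]] by simp
  qed (simp add: zero_mem)
  have Y1: "norm (sqrt_iter X n x) \<le> 1 * norm x" for n x
    using sqrt_iter_bounded_clinear[OF bcl[OF XM] X1, of n] mult_right_mono[OF sqrt_bound_range(2)[of n] norm_ge_zero[of x]]
      order_trans by blast
  have ZM: "Z \<in> M" by (rule strong_limit_mem[OF YM Y1 Z(1)])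
  have Zsa: "selfadjoint Z" by (rule selfadjoint_limit[OF sqrt_iter_selfadjoint[OF X] Z(1)])
  define R where "R = (\<lambda>x. (1/k) *\<^sub>R (x - Z x))"
  show ?thesis
  proof
    show "R \<in> M" unfolding R_def by (rule scaleR_mem[OF diff_mem[OF id_mem ZM]])
    show "selfadjoint R"
      by (simp add: selfadjoint_def R_def cinner_scaleR_left cinner_scaleR_right cinner_diff_left cinner_diff_right selfadjointD[OF Zsa])
    have RR: "R (R x) = S (S x)" for x
    proof -
      have "(x - Z x) - Z (x - Z x) = x - 2 *\<^sub>R Z x + Z (Z x)"
        by (simp add: lin(6)[OF ZM] scaleR_2)
      also have "\<dots> = b (b x)" unfolding Z(2) by (simp add: X_def)
      finally have "R (R x) = (1/k) *\<^sub>R (1/k) *\<^sub>R b (b x)"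
        by (simp add: R_def lin(3)[OF ZM] flip: scaleR_diff_right)
      then show ?thesis using k by (simp add: b_def lin(3)[OF S(1)])
    qed
    then show "\<forall>x. R (R x) = S (S x)" by blast
    \<comment> \<open>Positivity of 1 - Z follows from Z being a contraction.\<close>
    have "0 \<le> Re (cinner x (R x))" for x
    proof -
      have "Re (cinner x (Z x)) \<le> norm x * norm (Z x)"
        using cauchy_schwarz[of x "Z x"] complex_Re_le_cmod order_trans by blast
      also have "\<dots> \<le> norm x * norm x" by (intro mult_left_mono Z) simp
      finally show ?thesis
        using k by (simp add: R_def cinner_scaleR_right cinner_diff_right norm_sq_eq_cinner[symmetric] power2_eq_square)
    qed
    then show "\<forall>x. 0 \<le> Re (cinner x (R x))" by blast
  next
    show "\<forall>T. bounded_clinear T \<longrightarrow> (\<forall>x. T (S x) = S (T x)) \<longrightarrow> (\<forall>x. T (R x) = R (T x))"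
    proof (intro allI impI)
      fix T x assume T: "bounded_clinear T" and "\<forall>x. T (S x) = S (T x)"
      then have TS: "T (S x) = S (T x)" for x by blast
      have "T (X x) = X (T x)" for x
        by (simp add: X_def b_def bounded_clinear_simps[OF T] lin(3)[OF S(1)] TS)
      then have "(\<lambda>n. sqrt_iter X n (T x)) \<longlonglongrightarrow> T (Z x)"
        using bounded_clinear_tendsto[OF T Z(1)[of x]] sqrt_iter_commute[OF T] by simp
      then have "Z (T x) = T (Z x)" using Z(1)[of "T x"] LIMSEQ_unique by blast
      then show "T (R x) = R (T x)" by (simp add: R_def bounded_clinear_simps[OF T])
    qed
  qed
qed

definition projection :: "('h \<Rightarrow> 'h) \<Rightarrow> bool" where
  "projection p \<longleftrightarrow> p \<in> M \<and> selfadjoint p \<and> (\<forall>x. p (p x) = p x)"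

lemma projectionD:
  assumes "projection p"
  shows "p \<in> M" "selfadjoint p" "p (p x) = p x"
  using assms by (auto simp: projection_def)

text \<open>For a self-adjoint contraction \<open>b\<close>, the even powers of \<open>1 - b\<^sup>2\<close> converge strongly to the
  projection onto the kernel of \<open>b\<close>: the norms \<open>\<parallel>W\<^sup>n x\<parallel>\<close> decrease, and inner products of even powers
  are again squared norms of this kind.\<close>

lemma ex_support_projection:
  assumes a: "a \<in> M" "selfadjoint a"
  obtains q where "projection q" "\<And>x. q x = 0 \<longleftrightarrow> a x = 0"
proof -
  define k where "k = 1 / (onorm a + 1)"
  have k: "0 < k" "k * onorm a \<le> 1" using lin(10)[OF a(1)] by (auto simp: k_def field_simps)
  define b where "b = (\<lambda>x. k *\<^sub>R a x)"
  have bM: "b \<in> M" unfolding b_def by (rule scaleR_mem[OF a(1)])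
  have b: "selfadjoint b" using a(2) by (simp add: b_def selfadjoint_def cinner_scaleR_left cinner_scaleR_right)
  have b1: "norm (b x) \<le> norm x" for x
  proof -
    have "norm (b x) \<le> k * (onorm a * norm x)" using lin(8)[OF a(1), of x] k(1) by (simp add: b_def)
    also have "\<dots> \<le> 1 * norm x" unfolding mult.assoc[symmetric] by (intro mult_right_mono k) simp
    finally show ?thesis by simp
  qed
  define W where "W = (\<lambda>x. x - b (b x))"
  have WM: "W \<in> M" unfolding W_def by (rule diff_mem[OF id_mem comp_mem[OF bM bM]])
  have W: "selfadjoint W" by (simp add: selfadjoint_def W_def cinner_diff_left cinner_diff_right selfadjointD[OF b])
  have Wle: "(norm (W x))\<^sup>2 \<le> (norm x)\<^sup>2 - (norm (b x))\<^sup>2" for x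
    unfolding W_def by (rule norm_one_minus_square_le[OF b b1])
  have W1: "norm (W x) \<le> norm x" for x
    by (rule power2_le_imp_le) (use Wle[of x] zero_le_power2[of "norm (b x)"] in linarith, simp)
  have PM: "W ^^ n \<in> M" for n
  proof (induction n)
    case (Suc n)
    then show ?case using comp_mem[OF WM Suc] by (simp add: comp_def)
  qed (simp add: id_mem id_def)
  have P1: "norm ((W ^^ n) x) \<le> 1 * norm x" for n x
    by (induction n) (auto intro: order_trans[OF W1])
  have Psa: "cinner ((W ^^ n) x) y = cinner x ((W ^^ n) y)" for n x y
  proof (induction n arbitrary: y)
    case (Suc n)
    show ?case using Suc[of "W y"] by (simp add: selfadjointD[OF W]) (simp add: funpow_swap1)
  qed simp
  define \<alpha> where "\<alpha> = (\<lambda>x n. (norm ((W ^^ n) x))\<^sup>2)"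
  have "decseq (\<alpha> x)" for x
    unfolding \<alpha>_def by (rule decseq_SucI) (simp add: W1 power_mono)
  have conv: "convergent (\<lambda>n. (W ^^ (2 * n)) x)" for x
  proof -
    obtain l where l: "\<alpha> x \<longlonglongrightarrow> l" "\<And>n. l \<le> \<alpha> x n"
      using decseq_convergent[OF \<open>decseq (\<alpha> x)\<close>, of 0] by (auto simp: \<alpha>_def)
    have eq: "(norm ((W ^^ (2 * m)) x - (W ^^ (2 * n)) x))\<^sup>2 = \<alpha> x (2 * m) - 2 * \<alpha> x (m + n) + \<alpha> x (2 * n)" for m n
    proof -
      have "cinner ((W ^^ (2 * m)) x) ((W ^^ (2 * n)) x) = cinner ((W ^^ (m + n)) x) ((W ^^ (m + n)) x)"
      proof -
        have "m + n + (m + n) = 2 * m + 2 * n" by simp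
        then show ?thesis unfolding Psa by (metis comp_apply funpow_add)
      qed
      then show ?thesis unfolding norm_diff_sq \<alpha>_def norm_sq_eq_cinner[of "(W ^^ (m + n)) x"] by simp
    qed
    have "Cauchy (\<lambda>n. (W ^^ (2 * n)) x)"
    proof (rule CauchyI)
      fix e :: real assume e: "0 < e"
      obtain N where N: "\<And>n. n \<ge> N \<Longrightarrow> \<alpha> x n < l + e\<^sup>2 / 2"
        using order_tendstoD(2)[OF l(1), of "l + e\<^sup>2 / 2"] e by (auto simp: eventually_sequentially)
      show "\<exists>N. \<forall>m\<ge>N. \<forall>n\<ge>N. norm ((W ^^ (2 * m)) x - (W ^^ (2 * n)) x) < e"
      proof (intro exI allI impI)
        fix m n assume "m \<ge> N" "n \<ge> N"
        then have "\<alpha> x (2 * m) < l + e\<^sup>2 / 2" "\<alpha> x (2 * n) < l + e\<^sup>2 / 2" by (auto intro: N)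
        then have "(norm ((W ^^ (2 * m)) x - (W ^^ (2 * n)) x))\<^sup>2 < e\<^sup>2"
          unfolding eq using l(2)[of "m + n"] by linarith
        then show "norm ((W ^^ (2 * m)) x - (W ^^ (2 * n)) x) < e" using e by (simp add: power2_less_imp_less)
      qed
    qed
    then show ?thesis by (simp add: Cauchy_convergent_iff)
  qed
  define E where "E = (\<lambda>x. lim (\<lambda>n. (W ^^ (2 * n)) x))"
  have E: "(\<lambda>n. (W ^^ (2 * n)) x) \<longlonglongrightarrow> E x" for x
    using conv[of x] by (simp add: E_def convergent_LIMSEQ_iff)
  have EM: "E \<in> M" by (rule strong_limit_mem[OF PM P1 E])
  have Esa: "selfadjoint E" by (rule selfadjoint_limit[OF _ E]) (simp add: selfadjoint_def Psa)
  have WE: "W (W (E x)) = E x" for x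
  proof -
    have "(\<lambda>n. W (W ((W ^^ (2 * n)) x))) \<longlonglongrightarrow> W (W (E x))"
      by (intro bounded_clinear_tendsto[OF bcl[OF WM]] E)
    moreover have "(\<lambda>n. (W ^^ (2 * Suc n)) x) \<longlonglongrightarrow> E x" by (rule LIMSEQ_Suc[OF E])
    ultimately show ?thesis using LIMSEQ_unique by fastforce
  qed
  have fixed: "E x = x" if "W (W x) = x" for x
  proof -
    have "(W ^^ (2 * n)) x = x" for n by (induction n) (auto simp: that)
    then show ?thesis using E[of x] by (simp add: LIMSEQ_const_iff)
  qed
  \<comment> \<open>If E fixes x, then so does the square of W, hence norm x \<le> norm (W x), and
    the loss recorded in \<open>Wle\<close> forces b x = 0.\<close>
  have ker: "E x = x \<longleftrightarrow> a x = 0" for x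
  proof
    assume "E x = x"
    then have "norm x \<le> norm (W x)" using WE[of x] W1[of "W x"] by simp
    then have "(norm x)\<^sup>2 \<le> (norm (W x))\<^sup>2" by (simp add: power_mono)
    then have "(norm (b x))\<^sup>2 \<le> 0" using Wle[of x] by linarith
    then show "a x = 0" using k by (simp add: b_def)
  next
    assume "a x = 0"
    then have "W x = x" by (simp add: W_def b_def lin(4)[OF a(1)])
    then show "E x = x" by (simp add: fixed)
  qed
  show ?thesis
  proof
    \<comment> \<open>E projects onto the kernel of a, so its complement is the support.\<close>
    show "projection (\<lambda>x. x - E x)"
      unfolding projection_def
      using diff_mem[OF id_mem EM] fixed[OF WE]
      by (auto simp: selfadjoint_def cinner_diff_left cinner_diff_right selfadjointD[OF Esa] lin(6)[OF EM])
    show "x - E x = 0 \<longleftrightarrow> a x = 0" for x using ker[of x] by auto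
  qed
qed

end

section \<open>Projections in von Neumann algebras\<close>

context vn_algebra
begin

text \<open>Minimality in algebraic form: the corner p M p consists of scalar multiples of p, which
  is what bounds the dimension of M later. The zero projection qualifies as well.\<close>

definition minimal_projection :: "('h \<Rightarrow> 'h) \<Rightarrow> bool" where
  "minimal_projection p \<longleftrightarrow> projection p \<and> (\<forall>T\<in>M. \<exists>c. \<forall>x. p (T (p x)) = c *\<^sub>C p x)"

lemma minimal_projectionD:
  assumes "minimal_projection p" "T \<in> M"
  obtains c where "\<And>x. p (T (p x)) = c *\<^sub>C p x"
  using assms unfolding minimal_projection_def by blast

lemma projection_nonneg:
  assumes "projection p"
  shows "cinner x (p x) = complex_of_real ((norm (p x))\<^sup>2)"
  using selfadjointD[OF projectionD(2)[OF assms], of x "p x"] projectionD(3)[OF assms, of x]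
  by (metis cinner_self)

text \<open>With S the adjoint of T, the operators T1 = T + S and T2 = i(T - S) are self-adjoint and
  T = (T1 - i T2)/2. So one of them has a corner that is not scalar, and this corner is V.\<close>

lemma selfadjoint_corner_not_scalar:
  assumes p: "projection p" and T: "T \<in> M" "\<not> (\<exists>c. \<forall>x. p (T (p x)) = c *\<^sub>C p x)"
  obtains V where "V \<in> M" "selfadjoint V" "\<forall>x. p (V x) = V x \<and> V (p x) = V x"
    "\<forall>c. \<exists>x. V x \<noteq> c *\<^sub>C p x"
proof -
  note pD = projectionD[OF p]
  obtain S where S: "S \<in> M" "\<And>x y. cinner (S x) y = cinner x (T y)" using adjoint_mem[OF T(1)] by blast
  have S': "cinner (T x) y = cinner x (S y)" for x y by (metis S(2) cinner_commute)
  define T1 where "T1 = (\<lambda>x. T x + S x)"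
  define T2 where "T2 = (\<lambda>x. \<i> *\<^sub>C (T x - S x))"
  have M: "T1 \<in> M" "T2 \<in> M" unfolding T1_def T2_def by (rule add_mem[OF T(1) S(1)], rule scaleC_mem[OF diff_mem[OF T(1) S(1)]])
  have sa: "selfadjoint T1" "selfadjoint T2"
    by (auto simp: selfadjoint_def T1_def T2_def cinner_add_left cinner_add_right cinner_scaleC_left
        cinner_scaleC_right cinner_diff_left cinner_diff_right S S' algebra_simps)
  have "\<exists>V\<in>{T1, T2}. \<not> (\<exists>c. \<forall>x. p (V (p x)) = c *\<^sub>C p x)"
  proof (rule ccontr)
    assume "\<not> ?thesis"
    then obtain c1 c2 where c: "\<And>x. p (T1 (p x)) = c1 *\<^sub>C p x" "\<And>x. p (T2 (p x)) = c2 *\<^sub>C p x" by auto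
    have "p (T (p x)) = ((c1 - \<i> * c2) / 2) *\<^sub>C p x" for x
    proof -
      have "T y = (1/2) *\<^sub>C (T1 y + (- \<i>) *\<^sub>C T2 y)" for y
      proof -
        have "T1 y + (- \<i>) *\<^sub>C T2 y = T1 y + (T y - S y)"
          by (simp add: T2_def scaleC_scaleC scaleC_scaleC)
        also have "\<dots> = (2::real) *\<^sub>R T y" by (simp add: T1_def scaleR_2)
        also have "\<dots> = 2 *\<^sub>C T y" by (simp flip: scaleC_of_real)
        finally show ?thesis by (simp add: scaleC_scaleC scaleC_scaleC)
      qed
      then have "p (T (p x)) = (1/2) *\<^sub>C (c1 *\<^sub>C p x + (- \<i>) *\<^sub>C c2 *\<^sub>C p x)"
        by (metis (no_types) c lin(1,2)[OF pD(1)])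
      then show ?thesis unfolding scaleC_scaleC scaleC_add_left[symmetric] by (simp add: field_simps)
    qed
    then show False using T(2) by blast
  qed
  then obtain V where V: "V \<in> M" "selfadjoint V" "\<not> (\<exists>c. \<forall>x. p (V (p x)) = c *\<^sub>C p x)"
    using M sa by auto
  show ?thesis
  proof
    show "(\<lambda>x. p (V (p x))) \<in> M" by (rule comp_mem[OF pD(1) comp_mem[OF V(1) pD(1)]])
    show "selfadjoint (\<lambda>x. p (V (p x)))"
      by (simp add: selfadjoint_def selfadjointD[OF pD(2)] selfadjointD[OF V(2)])
  qed (use V pD in auto)
qed

text \<open>With \<open>R = \<bar>S\<bar>\<close> for \<open>S = V - c p\<close>, the operators \<open>R p - S\<close> and \<open>R p + S\<close> annihilate each other; if \<open>c\<close> lies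
  strictly between two values of the quadratic form of \<open>V\<close>, both are nonzero, and the support
  projection of the first one splits \<open>p\<close>.\<close>

lemma split_projection:
  assumes p: "projection p" and nmin: "\<not> minimal_projection p"
  obtains q where "projection q" "\<And>x. q (p x) = q x" "\<exists>x. q x \<noteq> 0" "\<exists>x. q x \<noteq> p x"
proof -
  note pD = projectionD[OF p]
  obtain T where T: "T \<in> M" "\<not> (\<exists>c. \<forall>x. p (T (p x)) = c *\<^sub>C p x)"
    using nmin p by (auto simp: minimal_projection_def)
  obtain V where VM: "V \<in> M" "selfadjoint V" and Vp: "\<forall>x. p (V x) = V x \<and> V (p x) = V x"
    and Vc: "\<forall>c. \<exists>x. V x \<noteq> c *\<^sub>C p x"
    by (rule selfadjoint_corner_not_scalar[OF p T])
  note V = VM Vp[rule_format, THEN conjunct1] Vp[rule_format, THEN conjunct2] Vc[rule_format]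
  \<comment> \<open>The quadratic form of V - c p, with c still free; a c is wanted for which it
    takes both signs.\<close>
  define f where "f = (\<lambda>c x. Re (cinner x (V x)) - c * (norm (p x))\<^sup>2)"
  have "\<exists>c u v. f c u < 0 \<and> 0 < f c v"
  proof -
    obtain \<xi> where "p \<xi> \<noteq> 0"
    proof -
      obtain x where "V x \<noteq> 0 *\<^sub>C p x" using V(5) by blast
      then have "V x \<noteq> 0" using scaleC_of_real[of 0 "p x"] by simp
      then show ?thesis using that[of "V x"] V(3) by simp
    qed
    then have \<xi>: "0 < (norm (p \<xi>))\<^sup>2" by simp
    \<comment> \<open>The Rayleigh quotient at \<xi>, for which the form vanishes there.\<close>
    define c0 where "c0 = Re (cinner \<xi> (V \<xi>)) / (norm (p \<xi>))\<^sup>2"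
    have f0: "f c0 \<xi> = 0" using \<xi> by (simp add: f_def c0_def)
    have "\<exists>x. f c0 x \<noteq> 0"
    proof (rule ccontr)
      assume "\<not> ?thesis"
      then have z: "f c0 x = 0" for x by blast
      have "(\<lambda>x. V x - c0 *\<^sub>R p x) \<in> M" by (rule diff_mem[OF V(1) scaleR_mem[OF pD(1)]])
      then have "V x - c0 *\<^sub>R p x = 0" for x
        by (intro selfadjoint_eq_zeroI[where S="\<lambda>x. V x - c0 *\<^sub>R p x"] bcl)
          (use z in \<open>simp_all add: selfadjoint_def cinner_diff_left cinner_diff_right cinner_scaleR_left
            cinner_scaleR_right selfadjointD[OF V(2)] selfadjointD[OF pD(2)] projection_nonneg[OF p] f_def\<close>)
      then show False using V(5)[of "complex_of_real c0"] by (simp add: scaleC_of_real)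
    qed
    then obtain x where x: "f c0 x \<noteq> 0" by blast
    have "p x \<noteq> 0"
    proof
      assume "p x = 0"
      moreover from this have "V x = 0" using V(4)[of x] lin(4)[OF V(1)] by simp
      ultimately show False using x by (simp add: f_def)
    qed
    then have px: "0 < (norm (p x))\<^sup>2" by simp
    \<comment> \<open>This shift of c0 halves the value of the form at x, keeping its sign, and
      gives it the opposite sign at \<xi>.\<close>
    define c where "c = c0 + f c0 x / (2 * (norm (p x))\<^sup>2)"
    have 1: "f c x = f c0 x / 2" unfolding c_def f_def using px by (simp add: field_simps)
    have 2: "f c \<xi> = - (f c0 x / (2 * (norm (p x))\<^sup>2) * (norm (p \<xi>))\<^sup>2)"
      using f0 unfolding c_def f_def by (simp add: algebra_simps)
    show ?thesis
    proof (cases "f c0 x < 0")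
      case True
      then have "f c x < 0" "0 < f c \<xi>" unfolding 1 2 using px \<xi> by (simp_all add: divide_neg_pos mult_neg_pos)
      then show ?thesis by blast
    next
      case False
      then have "0 < f c x" "f c \<xi> < 0" unfolding 1 2 using px \<xi> x by simp_all
      then show ?thesis by blast
    qed
  qed
  then obtain c u v where uv: "f c u < 0" "0 < f c v" by blast
  define S where "S = (\<lambda>x. V x - c *\<^sub>R p x)"
  have SM: "S \<in> M" unfolding S_def by (rule diff_mem[OF V(1) scaleR_mem[OF pD(1)]])
  have Ssa: "selfadjoint S"
    by (simp add: S_def selfadjoint_def cinner_diff_left cinner_diff_right cinner_scaleR_left cinner_scaleR_right
        selfadjointD[OF V(2)] selfadjointD[OF pD(2)])
  have Sp: "S (p x) = S x" "p (S x) = S x" for x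
    by (simp_all add: S_def V pD(3) lin(3,6)[OF pD(1)])
  have Sf: "Re (cinner x (S x)) = f c x" for x
    by (simp add: S_def f_def cinner_diff_right cinner_scaleR_right projection_nonneg[OF p])
  obtain R where R: "R \<in> M" "selfadjoint R" "\<forall>x. R (R x) = S (S x)" "\<forall>x. 0 \<le> Re (cinner x (R x))"
    and Rcomm: "\<forall>T. bounded_clinear T \<longrightarrow> (\<forall>x. T (S x) = S (T x)) \<longrightarrow> (\<forall>x. T (R x) = R (T x))"
    by (rule ex_abs_operator[OF SM Ssa])
  have pR: "p (R x) = R (p x)" for x using Rcomm bcl[OF pD(1)] Sp by simp
  have SR: "S (R x) = R (S x)" for x using Rcomm bcl[OF SM] by simp
  have Rp_nonneg: "0 \<le> Re (cinner x (R (p x)))" for x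
  proof -
    have "cinner x (R (p x)) = cinner (p x) (R (p x))"
      using selfadjointD[OF pD(2), of x "R (p x)"] by (simp add: pR pD(3))
    then show ?thesis using R(4) by simp
  qed
  define a where "a = (\<lambda>x. R (p x) - S x)"
  define b where "b = (\<lambda>x. R (p x) + S x)"
  have aM: "a \<in> M" unfolding a_def by (rule diff_mem[OF comp_mem[OF R(1) pD(1)] SM])
  have asa: "selfadjoint a"
    by (simp add: a_def selfadjoint_def cinner_diff_left cinner_diff_right selfadjointD[OF R(2)]
        selfadjointD[OF pD(2)] selfadjointD[OF Ssa] pR)
  have ab: "a (b x) = 0" for x
    by (simp add: a_def b_def lin(1)[OF R(1)] lin(1)[OF pD(1)] lin(1)[OF SM] pR pD(3) Sp R(3) SR)
  obtain q where q: "projection q" "\<And>x. q x = 0 \<longleftrightarrow> a x = 0"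
    using ex_support_projection[OF aM asa] by metis
  show ?thesis
  proof
    show "projection q" by (rule q(1))
    \<comment> \<open>a vanishes on the range of 1 - p, hence so does q, which means q \<le>
      p.\<close>
    have "a (p x - x) = 0" for x
      by (simp add: a_def lin(6)[OF R(1)] lin(6)[OF pD(1)] lin(6)[OF SM] pD(3) Sp lin(4)[OF R(1)])
    then have "q (p x - x) = 0" for x by (simp add: q(2))
    then show "q (p x) = q x" for x using lin(6)[OF projectionD(1)[OF q(1)], of "p x" x] by simp
    \<comment> \<open>q = 0 would give a = 0, so S = R p would be positive, against
      \<open>f c u < 0\<close>.\<close>
    show "\<exists>x. q x \<noteq> 0"
    proof (rule ccontr)
      assume "\<nexists>x. q x \<noteq> 0"
      then have "S u = R (p u)" using q(2)[of u] by (simp add: a_def)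
      then show False using uv(1) Sf[of u] Rp_nonneg[of u] by simp
    qed
    \<comment> \<open>q = p would be the identity on the range of b, while a b = 0 puts this range
      into the kernel of q. Then b = 0 and S = - R p, against \<open>0 < f c v\<close>.\<close>
    show "\<exists>x. q x \<noteq> p x"
    proof (rule ccontr)
      assume "\<nexists>x. q x \<noteq> p x"
      moreover have "p (b x) = b x" for x by (simp add: b_def lin(1)[OF pD(1)] pR pD(3) Sp)
      ultimately have "b v = 0" using q(2)[of "b v"] ab by simp
      then have "S v = - R (p v)" by (simp add: b_def eq_neg_iff_add_eq_0 add.commute)
      then show False using uv(2) Sf[of v] Rp_nonneg[of v] by (simp add: cinner_minus_right)
    qed
  qed
qed

text \<open>The hypothesis q p = q expresses q \<le> p; its adjoint is p q = q.\<close>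

lemma projection_diff:
  assumes p: "projection p" and q: "projection q" and qp: "\<And>x. q (p x) = q x"
  shows "projection (\<lambda>x. p x - q x)" and "p (q x) = q x"
proof -
  note pD = projectionD[OF p] and qD = projectionD[OF q]
  show pq: "p (q x) = q x" for x
    by (rule cinner_eqI) (simp add: selfadjointD[OF pD(2)] selfadjointD[OF qD(2)] qp)
  show "projection (\<lambda>x. p x - q x)"
    unfolding projection_def
    using diff_mem[OF pD(1) qD(1)]
    by (auto simp: selfadjoint_def cinner_diff_left cinner_diff_right selfadjointD[OF pD(2)] selfadjointD[OF qD(2)]
        lin(6)[OF pD(1)] lin(6)[OF qD(1)] qp pq pD(3) qD(3))
qed

text \<open>The minimal projections in the list need not be orthogonal.\<close>

definition finite_projection :: "('h \<Rightarrow> 'h) \<Rightarrow> bool" where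
  "finite_projection p \<longleftrightarrow> (\<exists>ps. (\<forall>q\<in>set ps. minimal_projection q) \<and> (\<forall>x. p x = (\<Sum>q\<leftarrow>ps. q x)))"

text \<open>If q and p - q were both finite sums of minimal projections, so would be p; a piece that
  is not such a sum is kept. This is the step of an infinite descent.\<close>

lemma not_finite_projection_split:
  assumes p: "projection p" and nf: "\<not> finite_projection p"
  obtains q where "projection q" "\<not> finite_projection q" "\<And>x. q (p x) = q x" "\<exists>x. q x \<noteq> p x"
proof -
  have "\<not> minimal_projection p"
  proof
    assume "minimal_projection p"
    then have "finite_projection p" unfolding finite_projection_def by (intro exI[of _ "[p]"]) simp
    then show False using nf by simp
  qed
  then obtain q where q: "projection q" "\<And>x. q (p x) = q x" "\<exists>x. q x \<noteq> 0" "\<exists>x. q x \<noteq> p x"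
    using split_projection[OF p] by metis
  note r = projection_diff[OF p q(1,2)]
  show ?thesis
  proof (cases "finite_projection q")
    case False
    then show ?thesis using that q by blast
  next
    case True
    have "\<not> finite_projection (\<lambda>x. p x - q x)"
    proof
      assume "finite_projection (\<lambda>x. p x - q x)"
      then obtain ps qs where ps: "\<forall>r\<in>set ps. minimal_projection r" "\<And>x. p x - q x = (\<Sum>r\<leftarrow>ps. r x)"
        and qs: "\<forall>r\<in>set qs. minimal_projection r" "\<And>x. q x = (\<Sum>r\<leftarrow>qs. r x)"
        using True unfolding finite_projection_def by blast
      have "p x = (\<Sum>r\<leftarrow>ps @ qs. r x)" for x using ps(2)[of x] qs(2)[of x] by (simp add: diff_eq_eq)
      moreover have "\<forall>r\<in>set (ps @ qs). minimal_projection r" using ps(1) qs(1) by auto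
      ultimately show False using nf unfolding finite_projection_def by blast
    qed
    then show ?thesis
      using that[OF r(1)] q(2,3) projectionD(3)[OF p] by auto
  qed
qed

section \<open>Infinite sequences of orthogonal projections\<close>

definition orthogonal_projections :: "(nat \<Rightarrow> 'h \<Rightarrow> 'h) \<Rightarrow> bool" where
  "orthogonal_projections q \<longleftrightarrow> (\<forall>n. projection (q n)) \<and> (\<forall>n. \<exists>x. q n x \<noteq> 0) \<and>
    (\<forall>m n x. m \<noteq> n \<longrightarrow> q m (q n x) = 0)"

lemma orthogonal_projectionsD:
  assumes "orthogonal_projections q"
  shows "projection (q n)" "\<exists>x. q n x \<noteq> 0" "m \<noteq> n \<Longrightarrow> q m (q n x) = 0"
  using assms by (auto simp: orthogonal_projections_def)

text \<open>Descent from the identity yields a strictly decreasing chain of projections, whose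
  successive differences are nonzero and mutually orthogonal.\<close>

lemma ex_orthogonal_projections:
  assumes "\<not> finite_projection (\<lambda>x. x)"
  shows "\<exists>q. orthogonal_projections q"
proof -
  have "\<exists>P. \<forall>n. (projection (P n) \<and> \<not> finite_projection (P n)) \<and>
      ((\<forall>x. P (Suc n) (P n x) = P (Suc n) x) \<and> (\<exists>x. P (Suc n) x \<noteq> P n x))"
  proof (rule dependent_nat_choice)
    show "\<exists>p. projection p \<and> \<not> finite_projection p"
      using assms id_mem by (intro exI[of _ "\<lambda>x. x"]) (auto simp: projection_def selfadjoint_def)
    show "\<exists>q. (projection q \<and> \<not> finite_projection q) \<and> (\<forall>x. q (p x) = q x) \<and> (\<exists>x. q x \<noteq> p x)"
      if "projection p \<and> \<not> finite_projection p" for p and n :: nat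
      using not_finite_projection_split[of p] that by metis
  qed
  then obtain P where P: "\<And>n. projection (P n)" "\<And>n x. P (Suc n) (P n x) = P (Suc n) x"
    "\<And>n. \<exists>x. P (Suc n) x \<noteq> P n x" by blast
  have le: "P m (P n x) = P m x" if "n \<le> m" for m n x
    using that
  proof (induction m rule: dec_induct)
    case base
    then show ?case using projectionD(3)[OF P(1)] by simp
  next
    case (step m)
    have "P (Suc m) (P n x) = P (Suc m) (P m (P n x))" by (simp only: P(2))
    also have "\<dots> = P (Suc m) x" by (simp only: step.IH P(2))
    finally show ?case .
  qed
  have ge: "P n (P m x) = P m x" if "n \<le> m" for m n x
    by (rule projection_diff(2)[OF P(1)[of n] P(1)[of m] le[OF that]])
  define q where "q = (\<lambda>n x. P n x - P (Suc n) x)"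
  have q: "projection (q n)" for n unfolding q_def
    using projection_diff(1)[OF P(1)[of n] P(1)[of "Suc n"]] P(2)[of n] by blast
  have lt: "q m (q n x) = 0" if "m < n" for m n x
    using that by (simp add: q_def lin(6)[OF projectionD(1)[OF P(1)]] ge)
  \<comment> \<open>Orthogonality in the other order is the adjoint of \<open>lt\<close>.\<close>
  have gt: "q n (q m x) = 0" if "m < n" for m n x
    by (rule cinner_eqI) (simp add: selfadjointD[OF projectionD(2)[OF q]] lt[OF that])
  have "\<exists>x. q n x \<noteq> 0" for n using P(3)[of n] unfolding q_def by (metis right_minus_eq)
  moreover have "q m (q n x) = 0" if "m \<noteq> n" for m n x using that lt gt by (meson linorder_neqE_nat)
  ultimately show ?thesis using q unfolding orthogonal_projections_def by blast
qed

section \<open>Corners between minimal projections and finite dimension\<close>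

text \<open>Let e = p T0 q be nonzero with adjoint e'. Then e e' lies in p M p and e' T q in q M q,
  so e e' = c p and e' T q = d q with scalars c and d. Hence c p T q = e e' T q = d e, and c is not
  0.\<close>

lemma minimal_corner_one_dimensional:
  assumes p: "minimal_projection p" and q: "minimal_projection q"
  obtains e where "e \<in> M" "\<And>T. T \<in> M \<Longrightarrow> \<exists>c. \<forall>x. p (T (q x)) = c *\<^sub>C e x"
proof (cases "\<forall>T\<in>M. \<forall>x. p (T (q x)) = 0")
  case True
  then show ?thesis using that[OF zero_mem] by simp
next
  case False
  then obtain T0 where T0: "T0 \<in> M" "\<exists>x. p (T0 (q x)) \<noteq> 0" by blast
  have pp: "projection p" and qp: "projection q" using p q by (auto simp: minimal_projection_def)
  note pD = projectionD[OF pp] and qD = projectionD[OF qp]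
  obtain S0 where S0: "S0 \<in> M" "\<And>x y. cinner (S0 x) y = cinner x (T0 y)" using adjoint_mem[OF T0(1)] by blast
  define e where "e = (\<lambda>x. p (T0 (q x)))"
  define e' where "e' = (\<lambda>x. q (S0 (p x)))"
  have eM: "e \<in> M" unfolding e_def by (rule comp_mem[OF pD(1) comp_mem[OF T0(1) qD(1)]])
  have adj: "cinner (e' x) y = cinner x (e y)" for x y
    by (simp add: e_def e'_def selfadjointD[OF pD(2)] selfadjointD[OF qD(2)] S0)
  obtain c where c: "\<And>x. p (T0 (q (S0 (p x)))) = c *\<^sub>C p x"
    using minimal_projectionD[OF p comp_mem[OF T0(1) comp_mem[OF qD(1) S0(1)]]] by metis
  have ee: "e (e' x) = c *\<^sub>C p x" for x by (simp add: e_def e'_def qD(3) c)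
  \<comment> \<open><x, e e' x> is the squared norm of e' x, so e e' = 0 would give e' = 0 and with
    it e = 0.\<close>
  have "c \<noteq> 0"
  proof
    assume "c = 0"
    then have "e (e' x) = 0" for x using ee[of x] scaleC_of_real[of 0 "p x"] by simp
    then have "cinner (e' x) (e' x) = 0" for x by (simp add: adj)
    then have "e' x = 0" for x by (simp add: cinner_self)
    then have "cinner x (e y) = 0" for x y using adj[of x y] by simp
    then have "cinner (e y) (e y) = 0" for y by blast
    then have "e y = 0" for y by (simp add: cinner_self)
    then show False using T0(2) by (simp add: e_def)
  qed
  show ?thesis
  proof (rule that[OF eM])
    fix T assume T: "T \<in> M"
    obtain d where d: "\<And>x. q (S0 (p (T (q x)))) = d *\<^sub>C q x"
      using minimal_projectionD[OF q comp_mem[OF S0(1) comp_mem[OF pD(1) T]]] by metis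
    have "p (T (q x)) = (d / c) *\<^sub>C e x" for x
    proof -
      have "c *\<^sub>C p (T (q x)) = e (e' (p (T (q x))))" by (simp add: ee pD(3))
      also have "\<dots> = e (d *\<^sub>C q x)" by (simp add: e'_def pD(3) d)
      also have "\<dots> = d *\<^sub>C e x" by (simp add: lin(2)[OF eM]) (simp add: e_def qD(3))
      finally have "(1 / c) *\<^sub>C c *\<^sub>C p (T (q x)) = (1 / c) *\<^sub>C d *\<^sub>C e x" by simp
      then show ?thesis using \<open>c \<noteq> 0\<close> scaleC_of_real[of 1 "p (T (q x))"] by (simp add: scaleC_scaleC)
    qed
    then show "\<exists>c. \<forall>x. p (T (q x)) = c *\<^sub>C e x" by blast
  qed
qed

lemma scaleC_sum_left: "finite I \<Longrightarrow> (\<Sum>i\<in>I. c i) *\<^sub>C (x :: 'h) = (\<Sum>i\<in>I. c i *\<^sub>C x)"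
  by (induction I rule: finite_induct) (use scaleC_of_real[of 0 x] in \<open>auto simp: scaleC_add_left\<close>)

text \<open>Different indices may name the same operator. Their coefficients are added up, because
  \<open>finite_dimensional\<close> sums over a set of operators.\<close>

lemma finite_dimensionalI:
  assumes I: "finite I" and e: "\<And>i. i \<in> I \<Longrightarrow> e i \<in> M"
    and span: "\<And>T. T \<in> M \<Longrightarrow> \<exists>c. \<forall>x. T x = (\<Sum>i\<in>I. c i *\<^sub>C e i x)"
  shows "finite_dimensional M"
  unfolding finite_dimensional_def
proof (intro exI[of _ "e ` I"] conjI ballI)
  show "finite (e ` I)" "e ` I \<subseteq> M" using I e by auto
  fix T assume "T \<in> M"
  then obtain c where c: "\<And>x. T x = (\<Sum>i\<in>I. c i *\<^sub>C e i x)" using span by blast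
  have "T = (\<lambda>x. \<Sum>S\<in>e ` I. (\<Sum>i | i \<in> I \<and> e i = S. c i) *\<^sub>C S x)"
  proof
    fix x
    have "T x = (\<Sum>S\<in>e ` I. \<Sum>i | i \<in> I \<and> e i = S. c i *\<^sub>C e i x)"
      unfolding c by (rule sum.image_gen[OF I])
    also have "\<dots> = (\<Sum>S\<in>e ` I. (\<Sum>i | i \<in> I \<and> e i = S. c i) *\<^sub>C S x)"
      using I by (intro sum.cong refl) (simp add: scaleC_sum_left)
    finally show "T x = (\<Sum>S\<in>e ` I. (\<Sum>i | i \<in> I \<and> e i = S. c i) *\<^sub>C S x)" .
  qed
  then show "\<exists>c. T = (\<lambda>x. \<Sum>S\<in>e ` I. c S *\<^sub>C S x)"
    by (rule exI[of _ "\<lambda>S. \<Sum>i | i \<in> I \<and> e i = S. c i"])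
qed

text \<open>Multiplying T from both sides by 1, written as the sum of the p_i, cuts it into corners
  p_i T p_j, each a multiple of one fixed operator.\<close>

lemma finite_dimensional_if_finite_projection:
  assumes "finite_projection (\<lambda>x. x)"
  shows "finite_dimensional M"
proof -
  obtain ps where ps: "\<And>q. q \<in> set ps \<Longrightarrow> minimal_projection q" "\<And>x. x = (\<Sum>q\<leftarrow>ps. q x)"
    using assms unfolding finite_projection_def by blast
  let ?n = "length ps"
  have min: "minimal_projection (ps ! i)" if "i < ?n" for i using ps(1) that by simp
  have id: "(\<Sum>i<?n. (ps ! i) x) = x" for x
    using ps(2)[of x] by (simp add: sum_list_sum_nth atLeast0LessThan)
  have "\<forall>i<?n. \<forall>j<?n. \<exists>e\<in>M. \<forall>T\<in>M. \<exists>c. \<forall>x. (ps ! i) (T ((ps ! j) x)) = c *\<^sub>C e x"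
    using minimal_corner_one_dimensional[OF min min] by metis
  then obtain e where e: "\<And>i j. i < ?n \<Longrightarrow> j < ?n \<Longrightarrow> e i j \<in> M"
    "\<And>i j T. i < ?n \<Longrightarrow> j < ?n \<Longrightarrow> T \<in> M \<Longrightarrow> \<exists>c. \<forall>x. (ps ! i) (T ((ps ! j) x)) = c *\<^sub>C e i j x"
    by metis
  show ?thesis
  proof (rule finite_dimensionalI[where I="{..<?n} \<times> {..<?n}" and e="\<lambda>(i, j). e i j"])
    fix T assume T: "T \<in> M"
    obtain c where c: "\<And>i j x. i < ?n \<Longrightarrow> j < ?n \<Longrightarrow> (ps ! i) (T ((ps ! j) x)) = c i j *\<^sub>C e i j x"
      using e(2)[OF _ _ T] by metis
    have "T x = (\<Sum>(i, j)\<in>{..<?n} \<times> {..<?n}. c i j *\<^sub>C e i j x)" for x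
    proof -
      have "T x = (\<Sum>i<?n. (ps ! i) (T (\<Sum>j<?n. (ps ! j) x)))" by (simp add: id)
      also have "\<dots> = (\<Sum>i<?n. \<Sum>j<?n. (ps ! i) (T ((ps ! j) x)))"
        using min by (intro sum.cong refl) (simp add: lin(7)[OF T] lin(7) minimal_projection_def projection_def)
      also have "\<dots> = (\<Sum>i<?n. \<Sum>j<?n. c i j *\<^sub>C e i j x)"
        by (intro sum.cong refl) (simp add: c)
      finally show ?thesis by (simp add: sum.cartesian_product)
    qed
    then show "\<exists>c. \<forall>x. T x = (\<Sum>i\<in>{..<?n} \<times> {..<?n}. c i *\<^sub>C (case i of (i, j) \<Rightarrow> e i j) x)"
      by (intro exI[of _ "\<lambda>(i, j). c i j"]) (simp add: case_prod_unfold)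
  qed (use e in auto)
qed

end

section \<open>Infinite-dimensional algebras\<close>

lemma norm_sum_orthogonal_sq:
  fixes v :: "'i \<Rightarrow> 'h :: chilbert_space"
  assumes "finite F" "\<And>i j. i \<in> F \<Longrightarrow> j \<in> F \<Longrightarrow> i \<noteq> j \<Longrightarrow> cinner (v i) (v j) = 0"
  shows "(norm (\<Sum>i\<in>F. v i))\<^sup>2 = (\<Sum>i\<in>F. (norm (v i))\<^sup>2)"
  using assms
proof (induction F rule: finite_induct)
  case (insert a F)
  have "cinner (v a) (\<Sum>i\<in>F. v i) = 0"
    unfolding cinner_sum_right by (rule sum.neutral) (use insert in auto)
  then show ?case using insert by (simp add: norm_add_sq)
qed simp

section \<open>Rademacher functions and diagonal operators\<close>

text \<open>The terms for S and \<open>insert a S\<close> cancel.\<close>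

lemma sum_Pow_eq_zero_if_toggle:
  fixes f :: "'a set \<Rightarrow> real"
  assumes "finite U" "a \<in> U" "\<And>S. S \<subseteq> U \<Longrightarrow> a \<notin> S \<Longrightarrow> f (insert a S) = - f S"
  shows "(\<Sum>S\<in>Pow U. f S) = 0"
proof -
  define U' where "U' = U - {a}"
  have U: "U = insert a U'" "a \<notin> U'" "finite U'" using assms by (auto simp: U'_def)
  have inj: "inj_on (insert a) (Pow U')" using U(2) by (auto simp: inj_on_def)
  have "(\<Sum>S\<in>Pow U. f S) = (\<Sum>S\<in>Pow U'. f S) + (\<Sum>S\<in>insert a ` Pow U'. f S)"
    unfolding U(1) Pow_insert by (rule sum.union_disjoint) (use U in auto)
  also have "(\<Sum>S\<in>insert a ` Pow U'. f S) = (\<Sum>S\<in>Pow U'. f (insert a S))"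
    by (simp add: sum.reindex[OF inj])
  also have "\<dots> = - (\<Sum>S\<in>Pow U'. f S)"
    unfolding sum_negf[symmetric] using assms(3) U by (intro sum.cong) auto
  finally show ?thesis by simp
qed

text \<open>The k-th Rademacher function, at a number given by the set of positions where its binary
  digit is 1.\<close>

definition rademacher :: "nat \<Rightarrow> nat set \<Rightarrow> real" where
  "rademacher k S = (if k \<in> S then -1 else 1)"

text \<open>Even and odd indices are kept apart so that different pairs (i, j) give different Walsh
  functions. If i differs from k, then 2i occurs exactly once among the four indices, and toggling
  this digit changes the sign; similarly for j and l.\<close>

lemma sum_rademacher_products:
  assumes "i < N" "j < N" "k < N" "l < N"
  shows "(\<Sum>S\<in>Pow {..<2 * N}. rademacher (2 * i) S * rademacher (2 * j + 1) S * (rademacher (2 * k) S * rademacher (2 * l + 1) S))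
    = (if i = k \<and> j = l then 2 ^ (2 * N) else 0)"
proof -
  consider "i = k" "j = l" | "i \<noteq> k" | "j \<noteq> l" by blast
  then show ?thesis
  proof cases
    case 1
    have "(\<Sum>S\<in>Pow {..<2 * N}. rademacher (2 * i) S * rademacher (2 * j + 1) S * (rademacher (2 * k) S * rademacher (2 * l + 1) S))
      = (\<Sum>S\<in>Pow {..<2 * N}. 1)"
      using 1 by (intro sum.cong) (auto simp: rademacher_def)
    then show ?thesis using 1 by (simp add: card_Pow)
  next
    case 2
    then have "2 * i \<noteq> 2 * k" "2 * i \<noteq> 2 * j + 1" "2 * i \<noteq> 2 * l + 1" by presburger+
    then have "(\<Sum>S\<in>Pow {..<2 * N}. rademacher (2 * i) S * rademacher (2 * j + 1) S * (rademacher (2 * k) S * rademacher (2 * l + 1) S)) = 0"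
      using assms by (intro sum_Pow_eq_zero_if_toggle[of _ "2 * i"]) (auto simp: rademacher_def)
    then show ?thesis using 2 by simp
  next
    case 3
    then have "2 * j + 1 \<noteq> 2 * l + 1" "2 * j + 1 \<noteq> 2 * i" "2 * j + 1 \<noteq> 2 * k" by presburger+
    then have "(\<Sum>S\<in>Pow {..<2 * N}. rademacher (2 * i) S * rademacher (2 * j + 1) S * (rademacher (2 * k) S * rademacher (2 * l + 1) S)) = 0"
      using assms by (intro sum_Pow_eq_zero_if_toggle[of _ "2 * j + 1"]) (auto simp: rademacher_def)
    then show ?thesis using 3 by simp
  qed
qed

context vn_algebra
begin

text \<open>By orthogonality of the vectors q_n x, the partial sums of \<epsilon>_n q_n are
  uniformly bounded and strongly Cauchy. For signs \<epsilon>_n they do not converge in norm, so it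
  is strong closedness that puts the limit in M.\<close>

lemma ex_diagonal_operator:
  fixes \<epsilon> :: "nat \<Rightarrow> real"
  assumes "orthogonal_projections q" and \<epsilon>: "\<And>n. \<bar>\<epsilon> n\<bar> \<le> 1"
  shows "\<exists>T\<in>M. (\<forall>x. norm (T x) \<le> norm x) \<and> (\<forall>n x. q n x = x \<longrightarrow> T x = \<epsilon> n *\<^sub>R x)"
proof -
  note q = orthogonal_projectionsD(1)[OF assms(1)] and orth = orthogonal_projectionsD(3)[OF assms(1)]
  have perp: "cinner (q m x) (q n y) = 0" if "m \<noteq> n" for m n x y
    using orth[OF that] by (simp add: selfadjointD[OF projectionD(2)[OF q]])
  \<comment> \<open>As for orthonormal vectors: the projection s of x onto the ranges of the q_n
    with n in F satisfies <x, s> = <s, s>.\<close>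
  have bessel: "(\<Sum>n\<in>F. (norm (q n x))\<^sup>2) \<le> (norm x)\<^sup>2" if F: "finite F" for F x
  proof -
    define s where "s = (\<Sum>n\<in>F. q n x)"
    have ns: "(norm s)\<^sup>2 = (\<Sum>n\<in>F. (norm (q n x))\<^sup>2)"
      unfolding s_def by (rule norm_sum_orthogonal_sq[OF F perp])
    have "cinner x s = complex_of_real ((norm s)\<^sup>2)"
      unfolding ns by (simp add: s_def cinner_sum_right projection_nonneg[OF q])
    then have "(norm s)\<^sup>2 \<le> norm x * norm s" using cauchy_schwarz[of x s] by (simp add: norm_power)
    then have "norm s \<le> norm x" by (cases "norm s = 0") (auto simp: power2_eq_square)
    then show ?thesis unfolding ns[symmetric] by (simp add: power_mono)
  qed
  have le: "(norm (\<Sum>n\<in>F. \<epsilon> n *\<^sub>R q n x))\<^sup>2 \<le> (\<Sum>n\<in>F. (norm (q n x))\<^sup>2)" if F: "finite F" for F x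
  proof -
    have "(norm (\<Sum>n\<in>F. \<epsilon> n *\<^sub>R q n x))\<^sup>2 = (\<Sum>n\<in>F. (norm (\<epsilon> n *\<^sub>R q n x))\<^sup>2)"
      by (rule norm_sum_orthogonal_sq[OF F]) (simp add: cinner_scaleR_left cinner_scaleR_right perp)
    also have "\<dots> \<le> (\<Sum>n\<in>F. (norm (q n x))\<^sup>2)"
      by (intro sum_mono power_mono) (use \<epsilon> in \<open>simp_all add: mult_left_le_one_le\<close>)
    finally show ?thesis .
  qed
  define P where "P = (\<lambda>N x. \<Sum>n<N. \<epsilon> n *\<^sub>R q n x)"
  have PM: "P N \<in> M" for N unfolding P_def by (intro sum_mem scaleR_mem projectionD(1)[OF q])
  have P1: "norm (P N x) \<le> 1 * norm x" for N x
    unfolding P_def mult_1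
    by (rule power2_le_imp_le[OF order_trans[OF le bessel]]) simp_all
  have "summable (\<lambda>n. \<epsilon> n *\<^sub>R q n x)" for x
    unfolding summable_Cauchy
  proof (intro allI impI)
    fix e :: real assume e: "e > 0"
    have "summable (\<lambda>n. (norm (q n x))\<^sup>2)"
      by (rule summableI_nonneg_bounded[of _ "(norm x)\<^sup>2"]) (auto intro: bessel)
    then obtain N where N: "\<forall>m\<ge>N. \<forall>n. norm (\<Sum>k\<in>{m..<n}. (norm (q k x))\<^sup>2) < e\<^sup>2"
      using e unfolding summable_Cauchy by (meson zero_less_power)
    show "\<exists>N. \<forall>m\<ge>N. \<forall>n. norm (\<Sum>k\<in>{m..<n}. \<epsilon> k *\<^sub>R q k x) < e"
    proof (intro exI allI impI)
      fix m n assume "N \<le> m"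
      then have "norm (\<Sum>k\<in>{m..<n}. (norm (q k x))\<^sup>2) < e\<^sup>2" using N by blast
      then have "(norm (\<Sum>k\<in>{m..<n}. \<epsilon> k *\<^sub>R q k x))\<^sup>2 < e\<^sup>2"
        using le[of "{m..<n}" x] by simp
      then show "norm (\<Sum>k\<in>{m..<n}. \<epsilon> k *\<^sub>R q k x) < e" using e by (simp add: power2_less_imp_less)
    qed
  qed
  then have lim: "(\<lambda>N. P N x) \<longlonglongrightarrow> (\<Sum>n. \<epsilon> n *\<^sub>R q n x)" for x
    unfolding P_def by (rule summable_LIMSEQ)
  define T where "T = (\<lambda>x. \<Sum>n. \<epsilon> n *\<^sub>R q n x)"
  have TM: "T \<in> M" unfolding T_def by (rule strong_limit_mem[OF PM P1 lim])
  have T1: "norm (T x) \<le> norm x" for x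
    unfolding T_def using bounded_clinear_strong_limit(2)[OF bcl[OF PM] P1 lim] by simp
  have "T x = \<epsilon> n *\<^sub>R x" if x: "q n x = x" for n x
  proof -
    have "\<epsilon> m *\<^sub>R q m x = (if m = n then \<epsilon> n *\<^sub>R x else 0)" for m
      using orth[of m n x] x by auto
    then show ?thesis unfolding T_def using sums_single[of n "\<lambda>_. \<epsilon> n *\<^sub>R x"]
      by (simp add: sums_iff eq_commute cong: if_cong)
  qed
  then show ?thesis using TM T1 by blast
qed

text \<open>\<zeta>_N spreads evenly over the 2^(2N) numbers with binary digits only below position
  2N, using one unit vector in the range of each q_n. Its inner products are averages over digit
  patterns, with both normalising factors 1/2^N combined, so orthonormality becomes that of Walsh
  functions. The operators with even index serve as r, those with odd index as s.\<close>

lemma ex_rademacher_operators: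
  assumes "orthogonal_projections q"
  shows "\<exists>r s \<zeta>. (\<forall>k. r k \<in> M \<and> s k \<in> M \<and> (\<forall>x. norm (r k x) \<le> norm x) \<and> (\<forall>x. norm (s k x) \<le> norm x)) \<and>
    (\<forall>N::nat. norm (\<zeta> N) \<le> 1 \<and> (\<forall>i<N. \<forall>j<N. \<forall>k<N. \<forall>l<N.
      cinner (r i (s j (\<zeta> N))) (r k (s l (\<zeta> N))) = (if i = k \<and> j = l then 1 else 0)))"
proof -
  note q = orthogonal_projectionsD(1,2)[OF assms] and orth = orthogonal_projectionsD(3)[OF assms]
  have "\<exists>\<xi>. q n \<xi> = \<xi> \<and> norm \<xi> = 1" for n
  proof -
    obtain x where x: "q n x \<noteq> 0" using q(2) by blast
    show ?thesis
      by (rule exI[of _ "(1 / norm (q n x)) *\<^sub>R q n x"])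
        (use x projectionD[OF q(1)] in \<open>simp add: lin(3)\<close>)
  qed
  then obtain \<xi> where \<xi>: "\<And>n. q n (\<xi> n) = \<xi> n" "\<And>n. norm (\<xi> n) = 1" by metis
  have on: "cinner (\<xi> m) (\<xi> n) = (if m = n then 1 else 0)" for m n
  proof (cases "m = n")
    case False
    have "cinner (\<xi> m) (\<xi> n) = cinner (q m (\<xi> m)) (q n (\<xi> n))" by (simp add: \<xi>)
    also have "\<dots> = 0" using orth[OF False] by (simp add: selfadjointD[OF projectionD(2)[OF q(1)]])
    finally show ?thesis using False by simp
  qed (simp add: cinner_self \<xi>(2))
  have "\<exists>T\<in>M. (\<forall>x. norm (T x) \<le> norm x) \<and> (\<forall>n x. q n x = x \<longrightarrow> T x = rademacher k (set_decode n) *\<^sub>R x)" for k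
    by (rule ex_diagonal_operator[OF assms]) (simp_all add: rademacher_def)
  then obtain \<rho> where \<rho>: "\<And>k. \<rho> k \<in> M" "\<And>k x. norm (\<rho> k x) \<le> norm x"
    "\<And>k n x. q n x = x \<Longrightarrow> \<rho> k x = rademacher k (set_decode n) *\<^sub>R x" by metis
  have \<rho>\<xi>: "\<rho> k (\<xi> (set_encode S)) = rademacher k S *\<^sub>R \<xi> (set_encode S)" if "finite S" for k S
    using \<rho>(3)[OF \<xi>(1)[of "set_encode S"], of k] that by simp
  define \<zeta> where "\<zeta> = (\<lambda>N. (1 / 2 ^ N) *\<^sub>R (\<Sum>S\<in>Pow {..<2 * N}. \<xi> (set_encode S)))"
  have inner: "cinner ((1 / 2 ^ N) *\<^sub>R (\<Sum>S\<in>Pow {..<2 * N}. a S *\<^sub>R \<xi> (set_encode S)))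
      ((1 / 2 ^ N) *\<^sub>R (\<Sum>S\<in>Pow {..<2 * N}. b S *\<^sub>R \<xi> (set_encode S)))
      = complex_of_real ((\<Sum>S\<in>Pow {..<2 * N}. a S * b S) / 2 ^ (2 * N))" for N a b
  proof -
    have fin: "finite S" if "S \<in> Pow {..<2 * N}" for S using that finite_subset by auto
    have "cinner (\<Sum>S\<in>Pow {..<2 * N}. a S *\<^sub>R \<xi> (set_encode S)) (\<Sum>S\<in>Pow {..<2 * N}. b S *\<^sub>R \<xi> (set_encode S))
      = (\<Sum>R\<in>Pow {..<2 * N}. \<Sum>S\<in>Pow {..<2 * N}. if S = R then complex_of_real (a S * b R) else 0)"
      unfolding cinner_sum_left cinner_sum_right cinner_scaleR_left cinner_scaleR_right on
      by (intro sum.cong refl, subst sum_distrib_left, intro sum.cong refl)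
        (use fin in \<open>auto simp: set_encode_eq\<close>)
    also have "\<dots> = complex_of_real (\<Sum>S\<in>Pow {..<2 * N}. a S * b S)" by simp
    finally show ?thesis
      by (simp add: cinner_scaleR_left cinner_scaleR_right power_add mult_2)
  qed
  have rs: "\<rho> (2 * i) (\<rho> (2 * j + 1) (\<zeta> N)) =
      (1 / 2 ^ N) *\<^sub>R (\<Sum>S\<in>Pow {..<2 * N}. (rademacher (2 * i) S * rademacher (2 * j + 1) S) *\<^sub>R \<xi> (set_encode S))" for i j N
  proof -
    have fin: "finite S" if "S \<in> Pow {..<2 * N}" for S using that finite_subset by auto
    have "\<rho> k (a *\<^sub>R x) = a *\<^sub>R \<rho> k x" "\<rho> k (\<Sum>S\<in>Pow {..<2 * N}. f S) = (\<Sum>S\<in>Pow {..<2 * N}. \<rho> k (f S))" for k a x f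
      using lin(3,7)[OF \<rho>(1)] by blast+
    then show ?thesis unfolding \<zeta>_def using fin
      by (simp add: \<rho>\<xi> mult.commute del: Pow_iff cong: sum.cong)
  qed
  show ?thesis
  proof (intro exI conjI allI impI)
    fix N
    have "cinner (\<zeta> N) (\<zeta> N) = 1"
      using inner[of N "\<lambda>_. 1" "\<lambda>_. 1"] by (simp add: \<zeta>_def card_Pow)
    then have "(norm (\<zeta> N))\<^sup>2 = 1" by (simp add: norm_sq_eq_cinner)
    then show "norm (\<zeta> N) \<le> 1" by (auto simp: power2_eq_1_iff)
    show "cinner (\<rho> (2 * i) (\<rho> (2 * j + 1) (\<zeta> N))) (\<rho> (2 * k) (\<rho> (2 * l + 1) (\<zeta> N))) = (if i = k \<and> j = l then 1 else 0)"
      if "i < N" "j < N" "k < N" "l < N" for i j k l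
      unfolding rs inner sum_rademacher_products[OF that] by simp
  qed (rule \<rho>)+
qed

section \<open>Arens regularity of the tensor square of M\<close>

lemma onorm_le_one: "T \<in> M \<Longrightarrow> (\<And>x. norm (T x) \<le> norm x) \<Longrightarrow> onorm T \<le> 1"
  by (rule onorm_bound) auto

lemma operator_algebra_simps [simp]:
  "vcarrier (operator_algebra M) = M" "vadd (operator_algebra M) S T = (\<lambda>x. S x + T x)"
  "vscale (operator_algebra M) c T = (\<lambda>x. c *\<^sub>C T x)" "vnorm (operator_algebra M) T = onorm T"
  "vmult (operator_algebra M) S T = (\<lambda>x. S (T x))"
  by (simp_all add: operator_algebra_def comp_def)

lemma normed_calgebra_operator_algebra: "normed_calgebra (operator_algebra M)"
proof
  show "vcarrier (operator_algebra M) \<noteq> {}" using zero_mem by auto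
next
  fix S T assume ST: "S \<in> vcarrier (operator_algebra M)" "T \<in> vcarrier (operator_algebra M)"
  then have M: "S \<in> M" "T \<in> M" by simp_all
  show "vadd (operator_algebra M) S T \<in> vcarrier (operator_algebra M)" using add_mem M by simp
  show "vmult (operator_algebra M) S T \<in> vcarrier (operator_algebra M)" using comp_mem M by simp
  show "vnorm (operator_algebra M) (vadd (operator_algebra M) S T) \<le> vnorm (operator_algebra M) S + vnorm (operator_algebra M) T"
    using onorm_triangle[OF lin(9)[OF M(1)] lin(9)[OF M(2)]] by simp
  show "vnorm (operator_algebra M) (vmult (operator_algebra M) S T) \<le> vnorm (operator_algebra M) S * vnorm (operator_algebra M) T"
    using onorm_compose[OF lin(9)[OF M(1)] lin(9)[OF M(2)]] by (simp add: comp_def)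
next
  fix T c assume "T \<in> vcarrier (operator_algebra M)"
  then have M: "T \<in> M" by simp
  show "vscale (operator_algebra M) c T \<in> vcarrier (operator_algebra M)" using scaleC_mem M by simp
  show "0 \<le> vnorm (operator_algebra M) T" using lin(10)[OF M] by simp
  have "norm (c *\<^sub>C T x) \<le> cmod c * onorm T * norm x" for x
    using mult_left_mono[OF lin(8)[OF M, of x], of "cmod c"] by (simp add: norm_scaleC mult.assoc)
  then show "vnorm (operator_algebra M) (vscale (operator_algebra M) c T) \<le> cmod c * vnorm (operator_algebra M) T"
    using onorm_bound[of "cmod c * onorm T" "\<lambda>x. c *\<^sub>C T x"] lin(10)[OF M] by simp
qed (simp_all add: ac_simps scaleC_add_right scaleC_add_left scaleC_scaleC lin)

text \<open>The bilinear form \<open>u(x, y) = lim \<Sum>\<^bsub>i<j<N\<^esub> \<langle>w\<^sub>i\<^sub>j \<zeta>, x \<zeta>\<rangle> \<langle>w\<^sub>i\<^sub>j \<zeta>, y \<zeta>\<rangle>\<close> with \<open>w\<^sub>i\<^sub>j = r\<^sub>i s\<^sub>j\<close> and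
  \<open>\<zeta> = \<zeta>\<^sub>N\<close> is bounded by Bessel's inequality, and \<open>u(w\<^sub>i\<^sub>j, w\<^sub>i\<^sub>j)\<close> is 1 or 0 according to whether \<open>i < j\<close>.\<close>

lemma not_arens_regular_if_orthogonal_projections:
  assumes "orthogonal_projections q"
  shows "\<not> arens_regular (projective_tensor (operator_algebra M) (operator_algebra M))"
proof -
  interpret O: normed_calgebra "operator_algebra M" by (rule normed_calgebra_operator_algebra)
  interpret OO: calgebra_pair "operator_algebra M" "operator_algebra M" by unfold_locales
  interpret PT: normed_calgebra "projective_tensor (operator_algebra M) (operator_algebra M)"
    by (rule OO.normed_calgebra_projective_tensor)
  obtain r s \<zeta> where rs': "\<forall>k. r k \<in> M \<and> s k \<in> M \<and> (\<forall>x. norm (r k x) \<le> norm x) \<and> (\<forall>x. norm (s k x) \<le> norm x)"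
    and \<zeta>': "\<forall>N::nat. norm (\<zeta> N) \<le> 1 \<and> (\<forall>i<N. \<forall>j<N. \<forall>k<N. \<forall>l<N.
      cinner (r i (s j (\<zeta> N))) (r k (s l (\<zeta> N))) = (if i = k \<and> j = l then 1 else 0))"
    using ex_rademacher_operators[OF assms] by (elim exE conjE)
  have rs: "\<And>k. r k \<in> M" "\<And>k. s k \<in> M" "\<And>k x. norm (r k x) \<le> norm x" "\<And>k x. norm (s k x) \<le> norm x"
    using rs' by blast+
  have \<zeta>: "norm (\<zeta> N) \<le> 1" for N using \<zeta>' by blast
  have on: "cinner (r i (s j (\<zeta> N))) (r k (s l (\<zeta> N))) = (if i = k \<and> j = l then 1 else 0)"
    if "i < N" "j < N" "k < N" "l < N" for N i j k l
    using \<zeta>' that by blast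
  \<comment> \<open>The sums for growing N need not converge. Limits along U exist for all pairs of
    operators at once and keep bilinearity and the bound.\<close>
  obtain U :: "nat filter" where U: "U \<noteq> bot" "U \<le> sequentially"
    "\<And>(f :: nat \<Rightarrow> complex) K. (\<And>n. cmod (f n) \<le> K) \<Longrightarrow> (f \<longlongrightarrow> Lim U f) U"
    using ex_bounded_limit_filter by metis
  define e where "e = (\<lambda>N (i, j). r i (s j (\<zeta> N)))"
  define P where "P = (\<lambda>N::nat. {(i, j). i < j \<and> j < N})"
  have fin: "finite (P N)" for N
    by (rule finite_subset[of _ "{..<N} \<times> {..<N}"]) (auto simp: P_def)
  \<comment> \<open>Both operators stand in the linear argument of \<open>cinner\<close>, so u is
    bilinear and not sesquilinear.\<close>
  define u where "u = (\<lambda>N x y. \<Sum>p\<in>P N. cinner (e N p) (x (\<zeta> N)) * cinner (e N p) (y (\<zeta> N)))"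
  have bes: "L2_set (\<lambda>p. cmod (cinner (e N p) (x (\<zeta> N)))) (P N) \<le> onorm x" if x: "x \<in> M" for N x
  proof -
    have "(\<Sum>p\<in>P N. (cmod (cinner (e N p) (x (\<zeta> N))))\<^sup>2) \<le> (norm (x (\<zeta> N)))\<^sup>2"
      by (rule bessel_inequality[OF fin]) (auto simp: P_def e_def on split: if_splits)
    then have "L2_set (\<lambda>p. cmod (cinner (e N p) (x (\<zeta> N)))) (P N) \<le> norm (x (\<zeta> N))"
      unfolding L2_set_def by (rule real_le_lsqrt[OF norm_ge_zero])
    also have "\<dots> \<le> onorm x * norm (\<zeta> N)" by (rule lin(8)[OF x])
    also have "\<dots> \<le> onorm x * 1" by (intro mult_left_mono \<zeta> lin(10)[OF x])
    finally show ?thesis by simp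
  qed
  have ubd: "cmod (u N x y) \<le> onorm x * onorm y" if xy: "x \<in> M" "y \<in> M" for N x y
  proof -
    have "cmod (u N x y) \<le> (\<Sum>p\<in>P N. \<bar>cmod (cinner (e N p) (x (\<zeta> N)))\<bar> * \<bar>cmod (cinner (e N p) (y (\<zeta> N)))\<bar>)"
      unfolding u_def by (rule sum_norm_le) (simp add: norm_mult)
    also have "\<dots> \<le> L2_set (\<lambda>p. cmod (cinner (e N p) (x (\<zeta> N)))) (P N) * L2_set (\<lambda>p. cmod (cinner (e N p) (y (\<zeta> N)))) (P N)"
      by (rule L2_set_mult_ineq)
    also have "\<dots> \<le> onorm x * onorm y"
      by (intro mult_mono bes xy L2_set_nonneg lin(10)[OF xy(1)])
    finally show ?thesis .
  qed
  have lim: "((\<lambda>N. u N x y) \<longlongrightarrow> Lim U (\<lambda>N. u N x y)) U" if "x \<in> M" "y \<in> M" for x y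
    by (rule U(3)[OF ubd[OF that]])
  note Lim = tendsto_Lim[OF U(1)]
  have add1: "u N (\<lambda>z. x z + x' z) y = u N x y + u N x' y" for N x x' y
    by (simp add: u_def cinner_add_right algebra_simps sum.distrib)
  have add2: "u N y (\<lambda>z. x z + x' z) = u N y x + u N y x'" for N x x' y
    by (simp add: u_def cinner_add_right algebra_simps sum.distrib)
  have sc: "u N (\<lambda>z. c *\<^sub>C x z) y = c * u N x y" "u N y (\<lambda>z. c *\<^sub>C x z) = c * u N y x" for N c x y
    by (simp_all add: u_def cinner_scaleC_right algebra_simps sum_distrib_left)
  have form: "OO.bounded_bilinear_form (\<lambda>x y. Lim U (\<lambda>N. u N x y)) 1"
    unfolding OO.bounded_bilinear_form_def operator_algebra_simps
  proof (intro conjI ballI allI)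
    fix x x' y assume "x \<in> M" "x' \<in> M" "y \<in> M"
    then show "Lim U (\<lambda>N. u N (\<lambda>z. x z + x' z) y) = Lim U (\<lambda>N. u N x y) + Lim U (\<lambda>N. u N x' y)"
      unfolding add1 by (intro Lim tendsto_add lim)
  next
    fix x y y' assume "x \<in> M" "y \<in> M" "y' \<in> M"
    then show "Lim U (\<lambda>N. u N x (\<lambda>z. y z + y' z)) = Lim U (\<lambda>N. u N x y) + Lim U (\<lambda>N. u N x y')"
      unfolding add2 by (intro Lim tendsto_add lim)
  next
    fix c x y assume xy: "x \<in> M" "y \<in> M"
    show "Lim U (\<lambda>N. u N (\<lambda>z. c *\<^sub>C x z) y) = c * Lim U (\<lambda>N. u N x y)"
      and "Lim U (\<lambda>N. u N x (\<lambda>z. c *\<^sub>C y z)) = c * Lim U (\<lambda>N. u N x y)"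
      unfolding sc by (rule Lim[OF tendsto_mult_left[OF lim[OF xy]]])+
  next
    fix x y assume xy: "x \<in> M" "y \<in> M"
    show "cmod (Lim U (\<lambda>N. u N x y)) \<le> 1 * (onorm x * onorm y)"
      by (rule tendsto_upperbound[OF tendsto_norm[OF lim[OF xy]] _ U(1)]) (simp add: ubd[OF xy])
  qed simp
  obtain f where f: "f \<in> vcarrier (dual_space (projective_tensor (operator_algebra M) (operator_algebra M)))"
    "\<And>x y. x \<in> M \<Longrightarrow> y \<in> M \<Longrightarrow> f (OO.elementary_tensor x y) = Lim U (\<lambda>N. u N x y)"
    using OO.projective_tensor_functional_of_bilinear[OF form] by (metis operator_algebra_simps(1))
  \<comment> \<open>Orthonormality leaves only the term with index (k, l), which belongs to
    \<open>P N\<close> exactly when k < l.\<close>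
  have uw: "u N (\<lambda>x. r k (s l x)) (\<lambda>x. r k (s l x)) = (if k < l then 1 else 0)" if "k < N" "l < N" for N k l
  proof -
    have "u N (\<lambda>x. r k (s l x)) (\<lambda>x. r k (s l x)) = (\<Sum>p\<in>P N. if p = (k, l) then 1 else 0)"
      unfolding u_def by (rule sum.cong) (use that in \<open>auto simp: e_def P_def on split: if_splits\<close>)
    also have "\<dots> = (if k < l then 1 else 0)" using fin[of N] that by (simp add: P_def)
    finally show ?thesis .
  qed
  have Limw: "Lim U (\<lambda>N. u N (\<lambda>x. r k (s l x)) (\<lambda>x. r k (s l x))) = (if k < l then 1 else 0)" for k l
  proof (rule Lim, rule tendsto_mono[OF U(2)], rule tendsto_eventually)
    show "\<forall>\<^sub>F N in sequentially. u N (\<lambda>x. r k (s l x)) (\<lambda>x. r k (s l x)) = (if k < l then 1 else 0)"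
      using eventually_gt_at_top[of k] eventually_gt_at_top[of l] by eventually_elim (rule uw)
  qed
  have norm1: "onorm (r k) * onorm (r k) \<le> 1" "onorm (s k) * onorm (s k) \<le> 1" for k
    using mult_mono[OF onorm_le_one onorm_le_one zero_le_one lin(10)] rs by fastforce+
  have et: "OO.elementary_tensor x x \<in> vcarrier (projective_tensor (operator_algebra M) (operator_algebra M))"
    "vnorm (projective_tensor (operator_algebra M) (operator_algebra M)) (OO.elementary_tensor x x) \<le> 1"
    if "x \<in> M" "onorm x * onorm x \<le> 1" for x
    using OO.elementary_tensor(1,2)[of x x] that by simp_all
  show ?thesis
  proof (rule PT.not_arens_regularI[OF f(1), where a="\<lambda>n. OO.elementary_tensor (r n) (r n)" and b="\<lambda>n. OO.elementary_tensor (s n) (s n)" and K=1])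
    fix i j
    show "f (vmult (projective_tensor (operator_algebra M) (operator_algebra M)) (OO.elementary_tensor (r i) (r i))
        (OO.elementary_tensor (s j) (s j))) = (if i < j then 1 else 0)"
      using rs(1,2) by (simp add: OO.elementary_tensor(3) f(2) comp_mem Limw)
  qed (intro et rs norm1)+
qed

text \<open>A linear functional on M that vanishes on a spanning set vanishes, which is the form of
  finite dimension that the criterion for tensor products asks for.\<close>

lemma arens_regular_if_finite_dimensional:
  assumes "finite_dimensional M"
  shows "arens_regular (projective_tensor (operator_algebra M) (operator_algebra M))"
proof -
  interpret O: normed_calgebra "operator_algebra M" by (rule normed_calgebra_operator_algebra)
  interpret OO: calgebra_pair "operator_algebra M" "operator_algebra M" by unfold_locales
  obtain B where B: "finite B" "B \<subseteq> M" "\<And>T. T \<in> M \<Longrightarrow> \<exists>c. T = (\<lambda>x. \<Sum>S\<in>B. c S *\<^sub>C S x)"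
    using assms unfolding finite_dimensional_def by blast
  have span: "\<phi> T = 0"
    if add: "\<And>S T. S \<in> M \<Longrightarrow> T \<in> M \<Longrightarrow> \<phi> (\<lambda>x. S x + T x) = \<phi> S + \<phi> T"
      and scale: "\<And>c S. S \<in> M \<Longrightarrow> \<phi> (\<lambda>x. c *\<^sub>C S x) = c * \<phi> S"
      and z: "\<And>S. S \<in> B \<Longrightarrow> \<phi> S = 0" and T: "T \<in> M" for \<phi> :: "('h \<Rightarrow> 'h) \<Rightarrow> complex" and T
  proof -
    obtain c where c: "T = (\<lambda>x. \<Sum>S\<in>B. c S *\<^sub>C S x)" using B(3)[OF T] by blast
    have "\<phi> (\<lambda>x. \<Sum>S\<in>F. c S *\<^sub>C S x) = 0" if "finite F" "F \<subseteq> B" for F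
      using that
    proof (induction F rule: finite_induct)
      case empty
      show ?case using scale[OF zero_mem, of 0] by simp
    next
      case (insert S F)
      have S: "S \<in> M" and F: "(\<lambda>x. \<Sum>S\<in>F. c S *\<^sub>C S x) \<in> M"
        using insert.prems B(2) by (auto intro!: sum_mem scaleC_mem)
      have "\<phi> (\<lambda>x. c S *\<^sub>C S x + (\<Sum>S\<in>F. c S *\<^sub>C S x)) = 0"
        unfolding add[OF scaleC_mem[OF S] F] scale[OF S] using insert z[of S] by simp
      then show ?case using insert.hyps by simp
    qed
    then show ?thesis using B(1) c by simp
  qed
  show ?thesis
    by (rule OO.arens_regular_projective_tensorI[OF B(1) _ B(1)]) (use B(2) span in \<open>simp_all\<close>)
qed

end

theorem corollary4p2:
  fixes M :: "('h::chilbert_space \<Rightarrow> 'h) set"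
  assumes "von_neumann_algebra M"
  shows "arens_regular (projective_tensor (operator_algebra M) (operator_algebra M))
    \<longleftrightarrow> finite_dimensional M"
proof -
  interpret vn_algebra M by unfold_locales (rule assms)
  show ?thesis
  proof
    assume reg: "arens_regular (projective_tensor (operator_algebra M) (operator_algebra M))"
    show "finite_dimensional M"
    proof (rule ccontr)
      assume "\<not> finite_dimensional M"
      then obtain q where "orthogonal_projections q"
        using finite_dimensional_if_finite_projection ex_orthogonal_projections by blast
      then show False using not_arens_regular_if_orthogonal_projections reg by blast
    qed
  qed (rule arens_regular_if_finite_dimensional)
qed

end
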